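(* Let $m\in\{2,3\}$, let $\Omega$ be a (nonempty) bounded open connected set of $\mathbb{R}^m$, and let $k>0$. There exists a real-valued function $v\in C^2(\Omega)$ such that $\triangle v+k^2v\le 0$ in $\Omega$ and $v(x)>0$ for all $x\in\Omega$ if and only if $k^2\le\lambda_{1,m}(\Omega)$.
   Context: For a bounded connected open set $U\subset\mathbb{R}^m$, $\lambda_{1,m}(U)$ denotes the first Dirichlet eigenvalue of $-\triangle$ in $U$ (no boundary regularity is assumed; the Dirichlet condition is understood in the sense of $H^1_0(U)$). *)

theory Defs
  imports "HOL-Analysis.Analysis"
begin

section \<open>Classical differentiability\<close>

definition pderiv_at :: "'a::euclidean_space \<Rightarrow> ('a \<Rightarrow> real) \<Rightarrow> 'a \<Rightarrow> real" where
  "pderiv_at i f x = frechet_derivative f (at x) i"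

definition gradient :: "('a::euclidean_space \<Rightarrow> real) \<Rightarrow> 'a \<Rightarrow> 'a" where
  "gradient f x = (\<Sum>i\<in>Basis. pderiv_at i f x *\<^sub>R i)"

definition laplacian :: "('a::euclidean_space \<Rightarrow> real) \<Rightarrow> 'a \<Rightarrow> real" where
  "laplacian f x = (\<Sum>i\<in>Basis. pderiv_at i (pderiv_at i f) x)"

text \<open>\<open>Ck_on n S f\<close> is meant for open \<open>S\<close>: derivatives are taken at points of \<open>S\<close> in the ambient
  space, so for open \<open>S\<close> only the values of \<open>f\<close> on \<open>S\<close> matter.\<close>

fun Ck_on :: "nat \<Rightarrow> 'a::euclidean_space set \<Rightarrow> ('a \<Rightarrow> real) \<Rightarrow> bool" where
  "Ck_on 0 S f \<longleftrightarrow> continuous_on S f"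
| "Ck_on (Suc n) S f \<longleftrightarrow>
     (\<forall>x\<in>S. f differentiable (at x)) \<and> (\<forall>i\<in>Basis. Ck_on n S (pderiv_at i f))"

text \<open>Elements of \<open>C\<^sub>c\<^sup>\<infinity>(U)\<close>, extended by zero to the whole space.\<close>

definition test_function :: "'a::euclidean_space set \<Rightarrow> ('a \<Rightarrow> real) \<Rightarrow> bool" where
  "test_function U \<phi> \<longleftrightarrow>
     (\<forall>n. Ck_on n UNIV \<phi>) \<and>
     compact (closure {x. \<phi> x \<noteq> 0}) \<and> closure {x. \<phi> x \<noteq> 0} \<subseteq> U"


section \<open>Sobolev spaces and the first Dirichlet eigenvalue\<close>

text \<open>Elements of \<open>L\<^sup>2\<close> and \<open>H\<^sup>1\<close> are represented by functions, not by classes modulo null sets.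
  Requiring Borel representatives loses nothing, since every Lebesgue measurable function agrees
  almost everywhere with a Borel one.\<close>

definition L2_on :: "'a::euclidean_space set \<Rightarrow> ('a \<Rightarrow> 'b::euclidean_space) \<Rightarrow> bool" where
  "L2_on U f \<longleftrightarrow>
     set_borel_measurable lborel U f \<and> set_integrable lborel U (\<lambda>x. (norm (f x))\<^sup>2)"

definition weak_gradient_on ::
  "'a::euclidean_space set \<Rightarrow> ('a \<Rightarrow> real) \<Rightarrow> ('a \<Rightarrow> 'a) \<Rightarrow> bool" where
  "weak_gradient_on U u G \<longleftrightarrow>
     (\<forall>\<phi>. test_function U \<phi> \<longrightarrow> (\<forall>i\<in>Basis.
        (LINT x:U|lborel. u x * pderiv_at i \<phi> x) = - (LINT x:U|lborel. (G x \<bullet> i) * \<phi> x)))"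

text \<open>\<open>H1 U u G\<close>: \<open>u \<in> H\<^sup>1(U)\<close> with weak gradient \<open>G\<close>, which is unique up to null sets.\<close>

definition H1 :: "'a::euclidean_space set \<Rightarrow> ('a \<Rightarrow> real) \<Rightarrow> ('a \<Rightarrow> 'a) \<Rightarrow> bool" where
  "H1 U u G \<longleftrightarrow> L2_on U u \<and> L2_on U G \<and> weak_gradient_on U u G"

text \<open>\<open>H10 U u G\<close>: moreover \<open>u\<close> belongs to \<open>H\<^sup>1\<^sub>0(U)\<close>, the closure of \<open>C\<^sub>c\<^sup>\<infinity>(U)\<close> in the norm
  of \<open>H\<^sup>1(U)\<close>.\<close>

definition H10 :: "'a::euclidean_space set \<Rightarrow> ('a \<Rightarrow> real) \<Rightarrow> ('a \<Rightarrow> 'a) \<Rightarrow> bool" where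
  "H10 U u G \<longleftrightarrow>
     H1 U u G \<and>
     (\<exists>\<phi> :: nat \<Rightarrow> 'a \<Rightarrow> real.
        (\<forall>n. test_function U (\<phi> n)) \<and>
        (\<lambda>n. (LINT x:U|lborel. (u x - \<phi> n x)\<^sup>2)
            + (LINT x:U|lborel. (norm (G x - gradient (\<phi> n) x))\<^sup>2)) \<longlonglongrightarrow> 0)"

text \<open>Weak formulation of \<open>-\<Delta>u = \<mu>u\<close> with \<open>0 \<noteq> u \<in> H\<^sup>1\<^sub>0(U)\<close>.\<close>

definition dirichlet_eigenvalue :: "'a::euclidean_space set \<Rightarrow> real \<Rightarrow> bool" where
  "dirichlet_eigenvalue U \<mu> \<longleftrightarrow>
     (\<exists>u G. H10 U u G \<and> \<not> (AE x\<in>U in lborel. u x = 0) \<and>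
        (\<forall>v H. H10 U v H \<longrightarrow>
           (LINT x:U|lborel. G x \<bullet> H x) = \<mu> * (LINT x:U|lborel. u x * v x)))"

definition first_dirichlet_eigenvalue :: "'a::euclidean_space set \<Rightarrow> real" where
  "first_dirichlet_eigenvalue U = (LEAST \<mu>. dirichlet_eigenvalue U \<mu>)"

end

theory Submission
  imports Defs "HOL-Complex_Analysis.Great_Picard"
begin

text \<open>The two sides of the equivalence are linked by the infimum \<open>\<mu>\<close> of the Rayleigh quotient
\<open>\<integral>|\<nabla>\<phi>|\<^sup>2 / \<integral>\<phi>\<^sup>2\<close> over the test functions \<open>\<phi> \<noteq> 0\<close> (\<open>rayleigh_inf\<close>).

The first Dirichlet eigenvalue is \<open>\<mu>\<close>, and it is attained by a function that is nonnegative almost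
everywhere (\<open>ground_state_exists\<close>, \<open>first_dirichlet_eigenvalue_eq\<close>). No eigenvalue is smaller, since
test functions are dense in \<open>H\<^sup>1\<^sub>0\<close>. For the attainment take a minimising sequence of test functions.
Replacing \<open>\<phi>\<close> by \<open>sqrt (\<phi>\<^sup>2 + \<epsilon>\<^sup>2) - \<epsilon>\<close> keeps it smooth, makes it nonnegative, does not increase the
energy and hardly changes the mass. By Rellich's theorem a subsequence converges in \<open>L\<^sup>2\<close>; the form
\<open>\<integral>|\<nabla>\<phi>|\<^sup>2 - \<mu> \<integral>\<phi>\<^sup>2\<close> is nonnegative and tends to \<open>0\<close> along the sequence, so its parallelogram law
makes the gradients converge and its Cauchy-Schwarz inequality gives the weak equation in the limit.

If \<open>v > 0\<close> and \<open>\<Delta>v + k\<^sup>2 v \<le> 0\<close>, integrate \<open>0 \<le> |\<nabla>\<phi> - \<phi> \<nabla>v / v|\<^sup>2\<close>: this is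
\<open>|\<nabla>\<phi>|\<^sup>2 - div (\<phi>\<^sup>2 \<nabla>v / v) + \<phi>\<^sup>2 \<Delta>v / v\<close>, the divergence integrates to \<open>0\<close>, and
\<open>k\<^sup>2 \<integral>\<phi>\<^sup>2 \<le> \<integral>|\<nabla>\<phi>|\<^sup>2\<close> remains (\<open>positive_supersolution_bound\<close>). Hence \<open>k\<^sup>2 \<le> \<mu>\<close>.

Conversely, if \<open>k\<^sup>2 \<le> \<mu>\<close>, then a positive classical solution of \<open>\<Delta>v = -\<mu> v\<close> satisfies
\<open>\<Delta>v + k\<^sup>2 v = (k\<^sup>2 - \<mu>) v \<le> 0\<close>. Such a \<open>v\<close> comes from the nonnegative weak solution \<open>u\<close> by a mean
value property. Let \<open>j\<close> be the radial solution of \<open>\<Delta>j = -\<mu> j\<close> with \<open>j(0) = 1\<close>, and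
\<open>\<eta>\<^sub>s(x) = s\<^sup>-\<^sup>m \<eta>(x / s)\<close> a radial bump in dimension \<open>m\<close>. Then \<open>\<partial>\<^sub>s \<eta>\<^sub>s = - div (x \<eta>\<^sub>s) / s\<close>, while
\<open>(\<Delta> + \<mu>)(j h) = div (j\<^sup>2 \<nabla>h) / j\<close>; choosing the radial \<open>h\<close> with \<open>j\<^sup>2 \<nabla>h = - x \<eta>\<^sub>s / s\<close> exhibits
\<open>\<partial>\<^sub>s (\<eta>\<^sub>s / j)\<close> as \<open>\<Delta> + \<mu>\<close> applied to a test function. So the average of \<open>u\<close> against
\<open>\<eta>\<^sub>s / j\<close> centred at \<open>x\<close> does not depend on \<open>s\<close>, as long as the ball of radius \<open>s\<close> lies in the domain and
\<open>j > 0\<close> there. This average is \<open>v(x)\<close>. It is smooth and solves the equation because the kernel is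
smooth and \<open>u\<close> is a weak solution. The kernel is positive inside its ball, so \<open>v(x) = 0\<close> forces \<open>u = 0\<close>
near \<open>x\<close> and then \<open>v = 0\<close> near \<open>x\<close>: the zero set of \<open>v\<close> is open and closed, and by connectedness it is
empty, since otherwise \<open>u\<close> would vanish (\<open>mean_value_pos\<close>).\<close>

section \<open>Calculus of \<open>C\<^sup>k\<close> functions\<close>

lemma pderiv_at_eq: "(f has_derivative f') (at x) \<Longrightarrow> pderiv_at i f x = f' i"
  unfolding pderiv_at_def by (metis frechet_derivative_at)

lemma pderiv_at_has_derivative:
  assumes "f differentiable (at x)"
  shows "(f has_derivative (\<lambda>h. \<Sum>i\<in>Basis. (h \<bullet> i) * pderiv_at i f x)) (at x)"
proof -
  let ?D = "frechet_derivative f (at x)"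
  have d: "(f has_derivative ?D) (at x)"
    using assms frechet_derivative_works by blast
  then interpret linear ?D by (rule has_derivative_linear)
  have "?D h = (\<Sum>i\<in>Basis. (h \<bullet> i) * pderiv_at i f x)" for h
  proof -
    have "?D h = ?D (\<Sum>i\<in>Basis. (h \<bullet> i) *\<^sub>R i)" by (simp add: euclidean_representation)
    also have "\<dots> = (\<Sum>i\<in>Basis. (h \<bullet> i) * pderiv_at i f x)"
      by (simp add: sum scale pderiv_at_def)
    finally show ?thesis .
  qed
  then have "?D = (\<lambda>h. \<Sum>i\<in>Basis. (h \<bullet> i) * pderiv_at i f x)" by auto
  with d show ?thesis by simp
qed

lemma inner_gradient_Basis: "i \<in> Basis \<Longrightarrow> gradient f x \<bullet> i = pderiv_at i f x"
  unfolding gradient_def by (simp add: inner_sum_left inner_Basis if_distrib cong: if_cong)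

lemma gradient_has_derivative:
  assumes "f differentiable (at x)"
  shows "(f has_derivative (\<lambda>h. h \<bullet> gradient f x)) (at x)"
proof -
  have "(\<lambda>h. h \<bullet> gradient f x) = (\<lambda>h. \<Sum>i\<in>Basis. (h \<bullet> i) * pderiv_at i f x)"
    by (auto simp: gradient_def inner_sum_right mult.commute)
  with pderiv_at_has_derivative[OF assms] show ?thesis by simp
qed

lemma gradient_eqI:
  assumes "(f has_derivative (\<lambda>h. h \<bullet> g)) (at x)"
  shows "gradient f x = g"
proof -
  have "gradient f x = (\<Sum>i\<in>Basis. (g \<bullet> i) *\<^sub>R i)"
    unfolding gradient_def using pderiv_at_eq[OF assms] by (simp add: inner_commute)
  then show ?thesis by (simp add: euclidean_representation)
qed

lemma Ck_on_mono: "Ck_on n T f \<Longrightarrow> S \<subseteq> T \<Longrightarrow> Ck_on n S f"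
  by (induction n arbitrary: f) (auto intro: continuous_on_subset)

lemma Ck_on_Suc_imp: "Ck_on (Suc n) S f \<Longrightarrow> Ck_on n S f"
proof (induction n arbitrary: f)
  case 0
  then show ?case
    by (auto intro!: continuous_at_imp_continuous_on differentiable_imp_continuous_within)
next
  case (Suc n)
  have "Ck_on n S (pderiv_at i f)" if "i \<in> Basis" for i
    by (rule Suc.IH) (use Suc.prems that in simp)
  then show ?case using Suc.prems by simp
qed

lemma Ck_on_le: "Ck_on n S f \<Longrightarrow> m \<le> n \<Longrightarrow> Ck_on m S f"
  proof (induction n)
  case (Suc n)
  then show ?case using Ck_on_Suc_imp le_Suc_eq by metis
qed simp

lemma Ck_on_imp_continuous_on: "Ck_on n S f \<Longrightarrow> continuous_on S f"
  using Ck_on_le[of n S f 0] by simp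

text \<open>Functions given by different formulas on different open sets (for instance by \<open>0\<close> off a compact set)
are shown to be smooth by this lemma.\<close>

lemma Ck_on_local:
  assumes "\<And>x. x \<in> S \<Longrightarrow> \<exists>N. open N \<and> x \<in> N \<and> Ck_on n N f"
  shows "Ck_on n S f"
  using assms
proof (induction n arbitrary: f)
  case 0
  then have "isCont f x" if "x \<in> S" for x
    using that continuous_on_eq_continuous_at by fastforce
  then show ?case by (simp add: continuous_at_imp_continuous_on)
next
  case (Suc n)
  have "f differentiable at x" if "x \<in> S" for x
    using Suc.prems[OF that] by auto
  moreover have "Ck_on n S (pderiv_at i f)" if "i \<in> Basis" for i
  proof (rule Suc.IH)
    fix x assume "x \<in> S"
    from Suc.prems[OF this] show "\<exists>N. open N \<and> x \<in> N \<and> Ck_on n N (pderiv_at i f)"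
      using that by auto
  qed
  ultimately show ?case by simp
qed

lemma pderiv_at_cong_open:
  assumes "open S" "x \<in> S" "\<And>y. y \<in> S \<Longrightarrow> f y = g y"
  shows "pderiv_at i f x = pderiv_at i g x"
proof -
  have "(f has_derivative D) (at x) \<longleftrightarrow> (g has_derivative D) (at x)" for D
    using assms by (metis has_derivative_transform_within_open)
  then show ?thesis unfolding pderiv_at_def frechet_derivative_def by simp
qed

lemma Ck_on_cong:
  assumes "open S" "\<And>x. x \<in> S \<Longrightarrow> f x = g x" "Ck_on n S f"
  shows "Ck_on n S g"
  using assms(2,3)
proof (induction n arbitrary: f g)
  case 0
  then show ?case by (simp cong: continuous_on_cong)
next
  case (Suc n)
  have "g differentiable at x" if "x \<in> S" for x
  proof -
    have "f differentiable at x" using Suc.prems that by simp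
    then show ?thesis
      using has_derivative_transform_within_open[OF _ assms(1) that] Suc.prems(1)
      unfolding differentiable_def by blast
  qed
  moreover have "Ck_on n S (pderiv_at i g)" if "i \<in> Basis" for i
  proof (rule Suc.IH)
    show "pderiv_at i f x = pderiv_at i g x" if "x \<in> S" for x
      by (rule pderiv_at_cong_open[OF assms(1) that Suc.prems(1)])
    show "Ck_on n S (pderiv_at i f)" using Suc.prems(2) that by simp
  qed
  ultimately show ?case by simp
qed

lemma Ck_on_SucI:
  assumes "open S" "\<And>x. x \<in> S \<Longrightarrow> (f has_derivative f' x) (at x)"
    and "\<And>i. i \<in> Basis \<Longrightarrow> Ck_on n S (\<lambda>x. f' x i)"
  shows "Ck_on (Suc n) S f"
proof -
  have "Ck_on n S (pderiv_at i f)" if "i \<in> Basis" for i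
    by (rule Ck_on_cong[OF assms(1) _ assms(3)[OF that]])
      (simp add: pderiv_at_eq[OF assms(2)])
  moreover have "f differentiable at x" if "x \<in> S" for x
    using assms(2)[OF that] by (auto simp: differentiable_def)
  ultimately show ?thesis by simp
qed

lemma Ck_on_SucD:
  assumes "Ck_on (Suc n) S f" "x \<in> S"
  shows "(f has_derivative frechet_derivative f (at x)) (at x)"
  using assms frechet_derivative_works by auto

lemma Ck_on_const [intro]: "Ck_on n S (\<lambda>x. c)"
proof (induction n arbitrary: c)
  case (Suc n)
  have "pderiv_at i (\<lambda>x. c) = (\<lambda>x. 0)" for i :: 'a
    by (auto intro!: pderiv_at_eq[of _ "\<lambda>_. 0", simplified])
  then show ?case using Suc by simp
qed simp

lemma Ck_on_inner: "open S \<Longrightarrow> Ck_on n S (\<lambda>x. x \<bullet> a)"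
proof (cases n)
  case (Suc k)
  assume "open S"
  then show ?thesis unfolding Suc
    by (rule Ck_on_SucI[where f' = "\<lambda>x h. h \<bullet> a"]) (auto intro!: derivative_eq_intros)
qed (auto intro!: continuous_intros)

lemma Ck_on_add:
  assumes "open S" shows "Ck_on n S f \<Longrightarrow> Ck_on n S g \<Longrightarrow> Ck_on n S (\<lambda>x. f x + g x)"
proof (induction n arbitrary: f g)
  case 0
  then show ?case by (simp add: continuous_on_add)
next
  case (Suc n)
  show ?case
  proof (rule Ck_on_SucI[OF assms has_derivative_add])
    fix i :: 'a assume "i \<in> Basis"
    then show "Ck_on n S (\<lambda>x. frechet_derivative f (at x) i + frechet_derivative g (at x) i)"
      using Suc by (simp add: pderiv_at_def[abs_def])
  qed (rule Ck_on_SucD[OF Suc.prems(1)] Ck_on_SucD[OF Suc.prems(2)]; assumption)+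
qed

lemma Ck_on_mult:
  assumes "open S" shows "Ck_on n S f \<Longrightarrow> Ck_on n S g \<Longrightarrow> Ck_on n S (\<lambda>x. f x * g x)"
proof (induction n arbitrary: f g)
  case 0
  then show ?case by (simp add: continuous_on_mult)
next
  case (Suc n)
  show ?case
  proof (rule Ck_on_SucI[OF assms has_derivative_mult])
    fix i :: 'a assume "i \<in> Basis"
    then show "Ck_on n S (\<lambda>x. f x * frechet_derivative g (at x) i + frechet_derivative f (at x) i * g x)"
      using Suc.prems Ck_on_Suc_imp[OF Suc.prems(1)] Ck_on_Suc_imp[OF Suc.prems(2)]
      by (intro Ck_on_add[OF assms] Suc.IH) (simp_all add: pderiv_at_def[abs_def])
  qed (rule Ck_on_SucD[OF Suc.prems(1)] Ck_on_SucD[OF Suc.prems(2)]; assumption)+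
qed

lemma Ck_on_cmult: "open S \<Longrightarrow> Ck_on n S f \<Longrightarrow> Ck_on n S (\<lambda>x. c * f x)"
  by (intro Ck_on_mult Ck_on_const)

lemma Ck_on_diff:
  assumes "open S" "Ck_on n S f" "Ck_on n S g" shows "Ck_on n S (\<lambda>x. f x - g x)"
  using Ck_on_add[OF assms(1,2) Ck_on_cmult[OF assms(1,3), of "-1"]] by simp

lemma Ck_on_sum:
  assumes "open S" "\<And>i. i \<in> I \<Longrightarrow> Ck_on n S (f i)"
  shows "Ck_on n S (\<lambda>x. \<Sum>i\<in>I. f i x)"
  using assms(2) by (induction I rule: infinite_finite_induct) (auto intro!: Ck_on_add[OF assms(1)])

lemma Ck_on_real_SucI:
  fixes f :: "real \<Rightarrow> real"
  assumes "open S" "\<And>x. x \<in> S \<Longrightarrow> (f has_real_derivative f' x) (at x)" "Ck_on n S f'"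
  shows "Ck_on (Suc n) S f"
proof (rule Ck_on_SucI[where f' = "\<lambda>x h. f' x * h", OF assms(1)])
  show "(f has_derivative (\<lambda>h. f' x * h)) (at x)" if "x \<in> S" for x
    using assms(2)[OF that] by (simp only: has_field_derivative_def)
  fix i :: real assume "i \<in> Basis"
  then have "i = 1" by simp
  then show "Ck_on n S (\<lambda>x. f' x * i)" using assms(3) by (simp only: mult_1_right)
qed

lemma Ck_on_real_SucD:
  fixes f :: "real \<Rightarrow> real"
  assumes "Ck_on (Suc n) S f" "x \<in> S"
  shows "(f has_real_derivative pderiv_at 1 f x) (at x)"
proof -
  have "(f has_derivative (\<lambda>h. \<Sum>i\<in>Basis. (h \<bullet> i) * pderiv_at i f x)) (at x)"
    by (rule pderiv_at_has_derivative) (use assms in simp)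
  moreover have "(\<lambda>h. \<Sum>i\<in>Basis. (h \<bullet> i) * pderiv_at i f x) = (*) (pderiv_at 1 f x)"
    by (auto simp: mult.commute)
  ultimately show ?thesis by (simp only: has_field_derivative_def)
qed

text \<open>All functions built below arise from smooth functions of one real variable, to which \<open>Ck_on\<close> applies
with \<open>Basis = {1}\<close>; the chain rule is therefore wanted only for a real outer function.\<close>

lemma Ck_on_compose:
  fixes f :: "real \<Rightarrow> real"
  assumes "open S"
  shows "Ck_on n T f \<Longrightarrow> Ck_on n S g \<Longrightarrow> g ` S \<subseteq> T \<Longrightarrow> Ck_on n S (\<lambda>x. f (g x))"
proof (induction n arbitrary: f)
  case 0
  then show ?case by (auto intro: continuous_on_compose2)
next
  case (Suc n)
  show ?case
  proof (rule Ck_on_SucI[OF assms])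
    fix x assume x: "x \<in> S"
    have "(f has_real_derivative pderiv_at 1 f (g x)) (at (g x))"
      by (rule Ck_on_real_SucD[OF Suc.prems(1)]) (use Suc.prems(3) x in auto)
    from has_derivative_compose[OF Ck_on_SucD[OF Suc.prems(2) x] this[unfolded has_field_derivative_def]]
    show "((\<lambda>x. f (g x)) has_derivative (\<lambda>h. pderiv_at 1 f (g x) * frechet_derivative g (at x) h)) (at x)" .
  next
    fix i :: 'a assume i: "i \<in> Basis"
    show "Ck_on n S (\<lambda>x. pderiv_at 1 f (g x) * frechet_derivative g (at x) i)"
    proof (rule Ck_on_mult[OF assms])
      have "Ck_on n T (pderiv_at 1 f)" using Suc.prems(1) by simp
      then show "Ck_on n S (\<lambda>x. pderiv_at 1 f (g x))"
        by (rule Suc.IH[OF _ Ck_on_Suc_imp[OF Suc.prems(2)] Suc.prems(3)])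
      have "Ck_on n S (pderiv_at i g)" using Suc.prems(2) i by simp
      then show "Ck_on n S (\<lambda>x. frechet_derivative g (at x) i)"
        unfolding pderiv_at_def[abs_def] .
    qed
  qed
qed

lemma Ck_on_inverse: "Ck_on n (- {0}) (inverse :: real \<Rightarrow> real)"
proof (induction n)
  case (Suc n)
  have o: "open (- {0 :: real})" by auto
  show ?case
  proof (rule Ck_on_real_SucI[OF o])
    show "(inverse has_real_derivative (- 1) * (inverse x * inverse x)) (at x)" if "x \<in> - {0}" for x :: real
      using that by (auto intro!: derivative_eq_intros)
    show "Ck_on n (- {0}) (\<lambda>x :: real. (- 1) * (inverse x * inverse x))"
      by (intro Ck_on_cmult Ck_on_mult o Suc)
  qed
qed (auto intro!: continuous_intros)

lemma Ck_on_sqrt: "Ck_on n {0<..} sqrt"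
proof (induction n)
  case (Suc n)
  show ?case
  proof (rule Ck_on_real_SucI)
    show "(sqrt has_real_derivative inverse (2 * sqrt x)) (at x)" if "x \<in> {0<..}" for x
      using that DERIV_real_sqrt[of x] by (simp add: field_simps)
    show "Ck_on n {0<..} (\<lambda>x. inverse (2 * sqrt x))"
      by (rule Ck_on_compose[OF _ Ck_on_inverse]) (auto intro!: Ck_on_cmult Suc)
  qed auto
qed (auto intro!: continuous_intros)

lemma Ck_on_divide:
  assumes "open S" "Ck_on n S f" "Ck_on n S g" "\<And>x. x \<in> S \<Longrightarrow> g x \<noteq> (0::real)"
  shows "Ck_on n S (\<lambda>x. f x / g x)"
proof -
  have "Ck_on n S (\<lambda>x. inverse (g x))"
    by (rule Ck_on_compose[OF assms(1) Ck_on_inverse assms(3)]) (use assms(4) in auto)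
  from Ck_on_mult[OF assms(1,2) this] show ?thesis by (simp only: divide_inverse)
qed

lemma Ck_on_power2_norm: "open S \<Longrightarrow> Ck_on n S (\<lambda>x::'a::euclidean_space. (norm (x - a))\<^sup>2)"
proof -
  assume S: "open S"
  have eq: "(norm (x - a))\<^sup>2 = (\<Sum>i\<in>Basis. (x \<bullet> i - a \<bullet> i) * (x \<bullet> i - a \<bullet> i))" for x
    unfolding power2_norm_eq_inner by (subst euclidean_inner) (simp add: inner_diff_left)
  show ?thesis unfolding eq
    by (intro Ck_on_sum Ck_on_mult Ck_on_diff Ck_on_inner Ck_on_const S)
qed

section \<open>A smooth function that is flat at the origin\<close>

text \<open>The powers of \<open>t\<close> make the family closed under differentiation up to linear combinations, so that the
smoothness of all members can be proved by one induction.\<close>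

definition flat :: "nat \<Rightarrow> real \<Rightarrow> real" where
  "flat n t = (if t \<le> 0 then 0 else exp (- 1 / t) / t ^ n)"

lemma exp_series_term_le: "0 \<le> (x::real) \<Longrightarrow> x ^ n / fact n \<le> exp x"
proof -
  assume x: "0 \<le> x"
  have "(\<Sum>k\<in>{n}. x ^ k /\<^sub>R fact k) \<le> (\<Sum>k. x ^ k /\<^sub>R fact k)"
    by (rule sum_le_suminf) (use x summable_exp_generic[of x] in auto)
  then show ?thesis by (simp add: exp_def divide_inverse mult.commute)
qed

text \<open>Any bound of order \<open>o(t)\<close> gives derivative \<open>0\<close> at the origin; a quadratic one comes from a single
term of the series of \<open>exp (1 / t)\<close>.\<close>

lemma flat_le: "0 \<le> flat n t \<and> flat n t \<le> fact (n + 2) * t\<^sup>2"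
proof (cases "t \<le> 0")
  case False
  then have t: "t > 0" by simp
  have "(1 / t) ^ (n + 2) / fact (n + 2) \<le> exp (1 / t)"
    using exp_series_term_le[of "1/t" "n + 2"] t by simp
  moreover define c :: real where "c = fact (n + 2)"
  moreover have "c > 0" by (simp add: c_def)
  ultimately have "exp (- 1 / t) \<le> c * t ^ (n + 2)"
    using t by (simp add: exp_minus power_divide divide_simps mult_ac del: power_add power_Suc fact_Suc)
  then have "exp (- 1 / t) / t ^ n \<le> c * t\<^sup>2"
    using t by (simp add: divide_simps power_add power2_eq_square mult_ac)
  then show ?thesis using t False by (auto simp: flat_def c_def)
qed (auto simp: flat_def)

lemma flat_pos: "t > 0 \<Longrightarrow> flat n t > 0"
  by (simp add: flat_def)

lemma DERIV_flat: "(flat n has_real_derivative flat (n + 2) t - real n * flat (n + 1) t) (at t)"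
proof -
  consider "t < 0" | "t = 0" | "t > 0" by linarith
  then show ?thesis
  proof cases
    case 1
    have "((\<lambda>_. 0) has_real_derivative 0) (at t)" by simp
    then have "(flat n has_real_derivative 0) (at t)"
      by (rule DERIV_cong_ev[THEN iffD1, rotated -1])
        (use 1 in \<open>auto simp: flat_def intro!: eventually_mono[OF eventually_nhds_in_open[of "{..<0}"]]\<close>)
    then show ?thesis using 1 by (simp add: flat_def)
  next
    case 2
    have "((\<lambda>h. (flat n (0 + h) - flat n 0) / h) \<longlongrightarrow> 0) (at 0)"
    proof (rule Lim_null_comparison)
      show "\<forall>\<^sub>F h in at 0. norm ((flat n (0 + h) - flat n 0) / h) \<le> fact (n + 2) * \<bar>h\<bar>"
      proof (rule eventually_at_filter[THEN iffD2], rule always_eventually, intro allI impI)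
        fix h :: real assume "h \<noteq> 0"
        have "norm ((flat n (0 + h) - flat n 0) / h) = flat n h / \<bar>h\<bar>"
          using flat_le[of n h] by (simp add: flat_def)
        also have "\<dots> \<le> fact (n + 2) * h\<^sup>2 / \<bar>h\<bar>"
          using flat_le[of n h] by (intro divide_right_mono) auto
        also have "\<dots> = fact (n + 2) * \<bar>h\<bar>"
          using \<open>h \<noteq> 0\<close> by (simp add: power2_eq_square field_simps abs_if)
        finally show "norm ((flat n (0 + h) - flat n 0) / h) \<le> fact (n + 2) * \<bar>h\<bar>" .
      qed
      show "((\<lambda>h::real. fact (n + 2) * \<bar>h\<bar>) \<longlongrightarrow> 0) (at 0)"
        by (auto intro!: tendsto_eq_intros)
    qed
    then show ?thesis using 2 by (simp add: DERIV_def flat_def)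
  next
    case 3
    have "((\<lambda>t. exp (- 1 / t) / t ^ n) has_real_derivative flat (n + 2) t - real n * flat (n + 1) t) (at t)"
      proof -
      have "((\<lambda>t. t ^ n) has_real_derivative real n * t ^ n / t) (at t)"
        using 3 DERIV_pow[of n t] by (cases n) auto
      moreover have "((\<lambda>t. exp (- 1 / t)) has_real_derivative exp (- 1 / t) / t\<^sup>2) (at t)"
        using 3 by (auto intro!: derivative_eq_intros simp: field_simps power2_eq_square)
      ultimately have "((\<lambda>t. exp (- 1 / t) / t ^ n) has_real_derivative
          (exp (- 1 / t) / t\<^sup>2 * t ^ n - exp (- 1 / t) * (real n * t ^ n / t)) / (t ^ n * t ^ n)) (at t)"
        by (intro DERIV_divide) (use 3 in auto)
      moreover have "(exp (- 1 / t) / t\<^sup>2 * t ^ n - exp (- 1 / t) * (real n * t ^ n / t)) / (t ^ n * t ^ n)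
          = exp (- 1 / t) / t\<^sup>2 / t ^ n - real n * (exp (- 1 / t) / t / t ^ n)"
        using 3 by (simp add: diff_divide_distrib)
      ultimately show ?thesis using 3 by (simp add: flat_def power2_eq_square mult_ac)
    qed
    then show ?thesis
      by (rule DERIV_cong_ev[THEN iffD1, rotated -1])
        (use 3 in \<open>auto simp: flat_def intro!: eventually_mono[OF eventually_nhds_in_open[of "{0<..}"]]\<close>)
  qed
qed

lemma Ck_on_flat: "Ck_on k UNIV (flat n)"
proof (induction k arbitrary: n)
  case 0
  then show ?case using DERIV_flat by (auto intro!: continuous_at_imp_continuous_on DERIV_isCont)
next
  case (Suc k)
  show ?case
    by (rule Ck_on_real_SucI[OF _ DERIV_flat]) (auto intro!: Ck_on_diff Ck_on_cmult Suc)
qed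

section \<open>Radial solutions of the Helmholtz equation\<close>

lemma power_series_real_deriv:
  fixes a :: "nat \<Rightarrow> real"
  assumes "\<And>x. summable (\<lambda>n. a n * x ^ n)"
  shows "((\<lambda>x. \<Sum>n. a n * x ^ n) has_real_derivative (\<Sum>n. diffs a n * x ^ n)) (at x)"
  using assms by (rule termdiffs_strong_converges_everywhere)

text \<open>With \<open>a = - \<mu> / 4\<close>, \<open>c = m / 2\<close> and \<open>t = |x|\<^sup>2\<close> this is the radial solution of
\<open>\<Delta>j = -\<mu> j\<close> on an \<open>m\<close>-dimensional space with \<open>j(0) = 1\<close>: a normalised Bessel function, the entire series
\<open>\<^sub>0F\<^sub>1(c; a t)\<close>. In the variable \<open>t\<close> there is no singularity at the origin.\<close>

definition bess :: "real \<Rightarrow> real \<Rightarrow> real \<Rightarrow> real" where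
  "bess a c t = (\<Sum>n. a ^ n / (fact n * pochhammer c n) * t ^ n)"

lemma pochhammer_ge: "c > 0 \<Longrightarrow> pochhammer c n \<ge> (min c 1) ^ n" for c :: real
proof (induction n)
  case (Suc n)
  have "min c 1 ^ n * min c 1 \<le> pochhammer c n * (c + real n)"
    by (intro mult_mono Suc) (use Suc.prems pochhammer_pos[of c n] in \<open>auto intro: min.coboundedI1\<close>)
  then show ?case by (simp add: pochhammer_Suc mult.commute)
qed simp

lemma bess_summable:
  assumes "c > (0::real)" shows "summable (\<lambda>n. a ^ n / (fact n * pochhammer c n) * t ^ n)"
proof (rule summable_comparison_test)
  let ?q = "\<bar>a\<bar> * \<bar>t\<bar> / min c 1"
  show "summable (\<lambda>n. ?q ^ n /\<^sub>R fact n)" by (rule summable_exp_generic)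
  have "norm (a ^ n / (fact n * pochhammer c n) * t ^ n) \<le> ?q ^ n /\<^sub>R fact n" for n
  proof -
    have p: "pochhammer c n > 0" using assms by (rule pochhammer_pos)
    have m: "min c 1 ^ n > 0" using assms by simp
    have "norm (a ^ n / (fact n * pochhammer c n) * t ^ n) = (\<bar>a\<bar> * \<bar>t\<bar>) ^ n / fact n / pochhammer c n"
      using p by (simp add: abs_mult power_abs power_mult_distrib)
    also have "\<dots> \<le> (\<bar>a\<bar> * \<bar>t\<bar>) ^ n / fact n / min c 1 ^ n"
      by (intro divide_left_mono pochhammer_ge[OF assms] mult_pos_pos p m) auto
    also have "\<dots> = ?q ^ n /\<^sub>R fact n" by (simp add: divide_inverse power_mult_distrib power_inverse mult_ac)
    finally show ?thesis .
  qed
  then show "\<exists>N. \<forall>n\<ge>N. norm (a ^ n / (fact n * pochhammer c n) * t ^ n) \<le> ?q ^ n /\<^sub>R fact n" by blast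
qed

lemma bess_coeff_diffs:
  assumes "c > (0::real)"
  shows "diffs (\<lambda>n. a ^ n / (fact n * pochhammer c n)) n = a / c * (a ^ n / (fact n * pochhammer (c + 1) n))"
proof -
  have "pochhammer c (Suc n) = c * pochhammer (c + 1) n" by (rule pochhammer_rec)
  moreover have "pochhammer (c + 1) n > 0" using assms by (intro pochhammer_pos) simp
  ultimately show ?thesis using assms unfolding diffs_def
    by (simp add: divide_simps del: of_nat_Suc)
qed

text \<open>Differentiation only shifts \<open>c\<close>, so the family is closed under it and smoothness follows by
induction.\<close>

lemma DERIV_bess:
  assumes "c > 0"
  shows "(bess a c has_real_derivative a / c * bess a (c + 1) t) (at t)"
proof -
  have "(bess a c has_real_derivative (\<Sum>n. a / c * (a ^ n / (fact n * pochhammer (c + 1) n) * t ^ n))) (at t)"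
    using power_series_real_deriv[OF bess_summable[OF assms], of a t]
    by (simp add: bess_coeff_diffs[OF assms] bess_def[abs_def] mult.assoc)
  moreover have "(\<Sum>n. a / c * (a ^ n / (fact n * pochhammer (c + 1) n) * t ^ n)) = a / c * bess a (c + 1) t"
    unfolding bess_def by (rule suminf_mult) (use assms bess_summable in simp)
  ultimately show ?thesis by simp
qed

lemma Ck_on_bess: "c > 0 \<Longrightarrow> Ck_on k UNIV (bess a c)"
proof (induction k arbitrary: c)
  case 0
  then show ?case using DERIV_bess by (auto intro!: continuous_at_imp_continuous_on DERIV_isCont)
next
  case (Suc k)
  show ?case
    by (rule Ck_on_real_SucI[OF _ DERIV_bess[OF Suc.prems]]) (use Suc.prems in \<open>auto intro!: Ck_on_cmult Suc.IH simp del: times_divide_eq_left\<close>)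
qed

text \<open>By the derivative rule, \<open>a\<close> times the right-hand side is \<open>c j' + t j''\<close>: this contiguity relation is
the radial Helmholtz equation.\<close>

lemma bess_contiguous:
  assumes "c > 0"
  shows "bess a c t = bess a (c + 1) t + a * t / (c * (c + 1)) * bess a (c + 2) t"
proof -
  let ?f = "\<lambda>c n. a ^ n / (fact n * pochhammer c n) * t ^ n"
  define d where "d = (\<lambda>n. ?f c n - ?f (c + 1) n)"
  have A: "d sums (bess a c t - bess a (c + 1) t)"
    unfolding bess_def d_def by (intro sums_diff summable_sums bess_summable) (use assms in auto)
  have B: "(\<lambda>n. d (Suc n)) = (\<lambda>n. a * t / (c * (c + 1)) * ?f (c + 2) n)"
  proof
    fix n
    let ?P = "pochhammer (c + 2) n"
    have P: "?P > 0" using assms by (intro pochhammer_pos) simp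
    have 1: "pochhammer c (Suc n) = c * pochhammer (c + 1) n" by (rule pochhammer_rec)
    have 2: "pochhammer (c + 1) (Suc n) = (c + 1) * ?P" using pochhammer_rec[of "c + 1" n] by (simp add: add.assoc)
    have 3: "pochhammer (c + 1) n * (c + 1 + n) = (c + 1) * ?P" using 2 by (simp add: pochhammer_Suc)
    define Q where "Q = (c + 1) * ?P"
    have Q: "Q > 0" using assms P by (simp add: Q_def)
    have 4: "pochhammer (c + 1) n = Q / (c + 1 + n)"
      using 3 assms by (simp add: Q_def field_simps)
    have "1 / pochhammer c (Suc n) - 1 / pochhammer (c + 1) (Suc n) = (c + 1 + n) / (c * Q) - 1 / Q"
      unfolding 1 2 4 Q_def[symmetric] using assms Q by simp
    also have "\<dots> = (Suc n) / (c * (c + 1)) / ?P"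
      using assms P Q unfolding Q_def
      by (simp add: divide_simps)
    finally have 5: "1 / pochhammer c (Suc n) - 1 / pochhammer (c + 1) (Suc n) = (Suc n) / (c * (c + 1)) / ?P" .
    have "d (Suc n) = a ^ Suc n * t ^ Suc n / fact (Suc n) * (1 / pochhammer c (Suc n) - 1 / pochhammer (c + 1) (Suc n))"
      by (simp add: d_def right_diff_distrib del: fact_Suc power_Suc)
    also have "\<dots> = a * t / (c * (c + 1)) * ?f (c + 2) n"
      unfolding 5 by (simp add: field_simps del: of_nat_Suc)
    finally show "d (Suc n) = a * t / (c * (c + 1)) * ?f (c + 2) n" .
  qed
  have "(\<lambda>n. d (Suc n)) sums (a * t / (c * (c + 1)) * bess a (c + 2) t)"
    unfolding bess_def B by (intro sums_mult summable_sums bess_summable) (use assms in auto)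
  then have "d sums (a * t / (c * (c + 1)) * bess a (c + 2) t + d 0)" by (rule sums_Suc)
  with A have "bess a c t - bess a (c + 1) t = a * t / (c * (c + 1)) * bess a (c + 2) t + d 0"
    by (rule sums_unique2)
  then show ?thesis by (simp add: d_def)
qed

lemma bess_0 [simp]: "bess a c 0 = 1"
proof -
  have "(\<lambda>n. a ^ n / (fact n * pochhammer c n) * 0 ^ n) = (\<lambda>n. if n = 0 then 1 else 0)"
    by (auto simp: fun_eq_iff)
  then show ?thesis unfolding bess_def using sums_If_finite_set[of "{0::nat}" "\<lambda>_. 1::real"]
    by (simp add: sums_iff)
qed

text \<open>All terms of the series are nonnegative here and the first one is \<open>1\<close>.\<close>

lemma bess_pos_nonpos:
  assumes "c > 0" "a * t \<ge> 0" shows "bess a c t > 0"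
proof -
  have "a ^ n / (fact n * pochhammer c n) * t ^ n \<ge> 0" for n
  proof -
    have "a ^ n / (fact n * pochhammer c n) * t ^ n = (a * t) ^ n / (fact n * pochhammer c n)"
      by (simp add: power_mult_distrib)
    then show ?thesis using assms pochhammer_pos[OF assms(1), of n] by simp
  qed
  then have "(\<Sum>n\<in>{0}. a ^ n / (fact n * pochhammer c n) * t ^ n) \<le> bess a c t"
    unfolding bess_def by (intro sum_le_suminf bess_summable assms) auto
  then show ?thesis by simp
qed

lemma ex_antiderivative:
  fixes f :: "real \<Rightarrow> real"
  assumes "continuous_on UNIV f"
  obtains F where "\<And>t. (F has_real_derivative f t) (at t)"
proof -
  have "\<exists>F. \<forall>x::real. -\<infinity> < ereal x \<longrightarrow> ereal x < \<infinity> \<longrightarrow> (F has_vector_derivative f x) (at x)"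
    by (rule einterval_antiderivative) (use assms in \<open>auto simp: continuous_on_eq_continuous_at\<close>)
  then show ?thesis using that by (auto simp: has_real_derivative_iff_has_vector_derivative)
qed

lemma Ck_on_antiderivative:
  fixes F :: "real \<Rightarrow> real"
  assumes "\<And>t. (F has_real_derivative f t) (at t)" "\<And>k. Ck_on k UNIV f"
  shows "Ck_on k UNIV F"
  by (cases k) (use assms in \<open>auto intro!: Ck_on_real_SucI simp del: Ck_on.simps intro: Ck_on_Suc_imp\<close>)

text \<open>For the boundary point of the support, where no neighbourhood is available.\<close>

lemma DERIV_eq_zero_if_const_right:
  fixes f :: "real \<Rightarrow> real"
  assumes "(f has_real_derivative D) (at r)" "\<And>t. t \<ge> r \<Longrightarrow> f t = 0"
  shows "D = 0"
proof -
  have "(f has_real_derivative D) (at_right r)"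
    using assms(1) has_field_derivative_at_within by blast
  then have "((\<lambda>y. (f y - f r) / (y - r)) \<longlongrightarrow> D) (at_right r)"
    by (simp add: has_field_derivative_iff)
  moreover have "((\<lambda>y. (f y - f r) / (y - r)) \<longlongrightarrow> 0) (at_right r)"
    by (rule tendsto_eventually) (auto simp: eventually_at_filter assms(2))
  ultimately show ?thesis using tendsto_unique trivial_limit_at_right_real by blast
qed

text \<open>For \<open>f(|x|\<^sup>2)\<close> the Laplacian is \<open>4 t f'' + 2 m f'\<close> at \<open>t = |x|\<^sup>2\<close> (see \<open>laplacian_radial\<close>
below), so this says \<open>\<Delta>j + \<mu> j = 0\<close>.\<close>

lemma radial_bess_equation:
  fixes m \<mu> t :: real
  assumes "m > 0"
  defines "c \<equiv> m / 2" and "a \<equiv> - \<mu> / 4"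
  shows "4 * t * (a / c * (a / (c + 1) * bess a (c + 2) t)) + 2 * m * (a / c * bess a (c + 1) t)
      + \<mu> * bess a c t = 0"
proof -
  have c: "c > 0" using assms by simp
  have "4 * t * (a / c * (a / (c + 1) * bess a (c + 2) t)) + 2 * m * (a / c * bess a (c + 1) t)
      + \<mu> * bess a c t
    = 4 * a * (a * t / (c * (c + 1)) * bess a (c + 2) t + bess a (c + 1) t - bess a c t)"
  proof -
    have m: "m = 2 * c" and mu: "\<mu> = - 4 * a" by (simp_all add: c_def a_def)
    show ?thesis unfolding m mu using c by (simp add: divide_simps) (simp add: algebra_simps)
  qed
  also have "\<dots> = 0" using bess_contiguous[OF c, of a t] by simp
  finally show ?thesis .
qed

text \<open>This inverts \<open>\<Delta> + \<mu>\<close> on radial functions of divergence form without leaving the compactly supported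
ones. With \<open>F = j h\<close> one has \<open>(\<Delta> + \<mu>) F = div (j\<^sup>2 \<nabla>h) / j\<close>, and \<open>h' = - w / (2 j\<^sup>2)\<close> turns
\<open>j\<^sup>2 \<nabla>h\<close> into \<open>- w x\<close>, whose divergence is \<open>- (m w + 2 t w')\<close>. The primitive \<open>h\<close> is
normalised to vanish where \<open>w\<close> does.\<close>

lemma radial_primitive:
  fixes w w' :: "real \<Rightarrow> real" and m \<mu> r r' :: real
  defines "j \<equiv> bess (- \<mu> / 4) (m / 2)"
  assumes m: "m > 0" and r: "r < r'" and jpos: "\<And>t. t < r' \<Longrightarrow> j t > 0"
    and w: "\<And>t. (w has_real_derivative w' t) (at t)" "\<And>k. Ck_on k UNIV w"
    and w0: "\<And>t. t \<ge> r \<Longrightarrow> w t = 0"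
  obtains F F' F'' where "\<And>k. Ck_on k UNIV F" "\<And>t. t \<ge> r \<Longrightarrow> F t = 0"
    "\<And>t. (F has_real_derivative F' t) (at t)" "\<And>t. (F' has_real_derivative F'' t) (at t)"
    "\<And>t. 4 * t * F'' t + 2 * m * F' t + \<mu> * F t = - (m * w t + 2 * t * w' t) / j t"
proof -
  define a where "a = - \<mu> / 4"
  define c where "c = m / 2"
  define j' where "j' t = a / c * bess a (c + 1) t" for t
  define j'' where "j'' t = a / c * (a / (c + 1) * bess a (c + 2) t)" for t
  have c: "c > 0" using m by (simp add: c_def)
  have j: "j = bess a c" by (simp add: j_def a_def c_def)
  have dj: "(j has_real_derivative j' t) (at t)" for t
    unfolding j j'_def by (rule DERIV_bess[OF c])
  have dj': "(j' has_real_derivative j'' t) (at t)" for t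
    unfolding j'_def[abs_def] j''_def using DERIV_cmult[OF DERIV_bess[of "c + 1" a t], of "a / c"] c
    by (simp add: add.assoc)
  have eqj: "4 * t * j'' t + 2 * m * j' t + \<mu> * j t = 0" for t
    unfolding j j'_def j''_def unfolding a_def c_def
    by (rule radial_bess_equation[OF m])
  define \<kappa> where "\<kappa> t = w t / (2 * (j t * j t))" for t
  have \<kappa>0: "\<kappa> t = 0" if "t \<ge> r" for t using w0[OF that] by (simp add: \<kappa>_def)
  have Cj: "Ck_on k UNIV j" for k unfolding j by (rule Ck_on_bess[OF c])
  have C\<kappa>: "Ck_on k UNIV \<kappa>" for k
  proof (rule Ck_on_local)
    fix t :: real
    show "\<exists>N. open N \<and> t \<in> N \<and> Ck_on k N \<kappa>"
    proof (cases "t < r'")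
      case True
      have "Ck_on k {..<r'} \<kappa>" unfolding \<kappa>_def[abs_def]
        by (intro Ck_on_divide Ck_on_mult Ck_on_const Ck_on_mono[OF Cj] Ck_on_mono[OF w(2)])
          (use jpos in fastforce)+
      then show ?thesis using True by (intro exI[of _ "{..<r'}"]) auto
    next
      case False
      have "Ck_on k {r<..} \<kappa>"
        by (rule Ck_on_cong[OF _ _ Ck_on_const[of _ _ 0]]) (auto simp: \<kappa>0)
      then show ?thesis using False r by (intro exI[of _ "{r<..}"]) auto
    qed
  qed
  define \<kappa>' where "\<kappa>' = pderiv_at 1 \<kappa>"
  have d\<kappa>: "(\<kappa> has_real_derivative \<kappa>' t) (at t)" for t
    unfolding \<kappa>'_def by (rule Ck_on_real_SucD[OF C\<kappa>]) simp
  have "continuous_on UNIV (\<lambda>t. - \<kappa> t)"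
    using C\<kappa>[of 0] by (auto intro: continuous_on_minus)
  then obtain H where dH: "\<And>t. (H has_real_derivative - \<kappa> t) (at t)"
    by (rule ex_antiderivative) blast
  define h where "h t = H t - H r" for t
  have dh: "(h has_real_derivative - \<kappa> t) (at t)" for t
    unfolding h_def[abs_def] by (auto intro!: derivative_eq_intros dH)
  have Ch: "Ck_on k UNIV h" for k
    by (rule Ck_on_antiderivative[OF dh]) (use Ck_on_cmult[OF _ C\<kappa>, where c = "-1"] in simp)
  have h0: "h t = 0" if "t \<ge> r" for t
  proof (cases "t = r")
    case False
    then have "r < t" using that by simp
    then obtain z where "r < z" "h t - h r = (t - r) * - \<kappa> z"
      using MVT2[of r t h "\<lambda>t. - \<kappa> t"] dh by auto
    then show ?thesis using \<kappa>0[of z] by (simp add: h_def)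
  qed (simp add: h_def)
  have \<kappa>'0: "\<kappa>' t = 0" if "t \<ge> r" for t
    by (rule DERIV_eq_zero_if_const_right[OF d\<kappa>]) (use that \<kappa>0 in auto)
  have w'0: "w' t = 0" if "t \<ge> r" for t
    by (rule DERIV_eq_zero_if_const_right[OF w(1)]) (use that w0 in auto)
  have \<kappa>'eq: "\<kappa>' t = w' t / (2 * (j t * j t)) - w t * j' t / (j t * j t * j t)" if "t < r'" for t
  proof -
    have jt: "j t \<noteq> 0" using jpos[OF that] by simp
    have "(\<kappa> has_real_derivative (w' t * (2 * (j t * j t)) - w t * (2 * (j' t * j t + j' t * j t)))
        / ((2 * (j t * j t)) * (2 * (j t * j t)))) (at t)"
      unfolding \<kappa>_def[abs_def]
      by (intro DERIV_divide DERIV_cmult DERIV_mult w dj) (use jt in simp)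
    from DERIV_unique[OF d\<kappa> this] show ?thesis using jt by (simp add: diff_divide_distrib)
  qed
  define F where "F t = j t * h t" for t
  define F' where "F' t = j' t * h t - j t * \<kappa> t" for t
  define F'' where "F'' t = j'' t * h t - 2 * j' t * \<kappa> t - j t * \<kappa>' t" for t
  show ?thesis
  proof (rule that)
    show "Ck_on k UNIV F" for k unfolding F_def[abs_def] by (intro Ck_on_mult Cj Ch) simp
    show "F t = 0" if "t \<ge> r" for t using h0[OF that] by (simp add: F_def)
    show "(F has_real_derivative F' t) (at t)" for t
      unfolding F_def[abs_def] F'_def by (auto intro!: derivative_eq_intros dj dh)
    show "(F' has_real_derivative F'' t) (at t)" for t
      unfolding F'_def[abs_def] F''_def by (auto intro!: derivative_eq_intros dj dj' dh d\<kappa>)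
    show "4 * t * F'' t + 2 * m * F' t + \<mu> * F t = - (m * w t + 2 * t * w' t) / j t" for t
    proof (cases "t < r'")
      case True
      then have jt: "j t \<noteq> 0" using jpos by fastforce
      have "4 * t * F'' t + 2 * m * F' t + \<mu> * F t = h t * (4 * t * j'' t + 2 * m * j' t + \<mu> * j t)
          - (8 * t * j' t * \<kappa> t + 4 * t * (j t * \<kappa>' t) + 2 * m * (j t * \<kappa> t))"
        by (simp add: F_def F'_def F''_def algebra_simps)
      also have "\<dots> = - (8 * t * j' t * \<kappa> t + 4 * t * (j t * \<kappa>' t) + 2 * m * (j t * \<kappa> t))"
        by (simp add: eqj)
      also have "\<dots> = - (m * w t + 2 * t * w' t) / j t"
        unfolding \<kappa>'eq[OF True] \<kappa>_def using jt by (simp add: field_simps)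
      finally show ?thesis .
    next
      case False
      then have "t \<ge> r" using r by simp
      then show ?thesis
        by (simp add: F_def F'_def F''_def h0 \<kappa>0 \<kappa>'0 w0 w'0)
    qed
  qed
qed

text \<open>Test functions are obtained from profiles \<open>f\<close> in the variable \<open>t = |x - a|\<^sup>2\<close>, which is smooth
everywhere, unlike the distance itself.\<close>

lemma has_derivative_radial:
  fixes f :: "real \<Rightarrow> real" and x a :: "'a::euclidean_space"
  assumes "(f has_real_derivative f') (at ((norm (x - a))\<^sup>2))"
  shows "((\<lambda>x. f ((norm (x - a))\<^sup>2)) has_derivative (\<lambda>h. h \<bullet> ((2 * f') *\<^sub>R (x - a)))) (at x)"
proof -
  have "((\<lambda>x. (norm (x - a))\<^sup>2) has_derivative (\<lambda>h. 2 * (h \<bullet> (x - a)))) (at x)"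
    unfolding power2_norm_eq_inner
    by (auto intro!: derivative_eq_intros simp: inner_commute)
  from has_derivative_compose[OF this assms[unfolded has_field_derivative_def]]
  show ?thesis by (simp add: mult_ac)
qed

lemma pderiv_at_radial:
  fixes f :: "real \<Rightarrow> real" and x a :: "'a::euclidean_space"
  assumes "(f has_real_derivative f') (at ((norm (x - a))\<^sup>2))"
  shows "pderiv_at i (\<lambda>x. f ((norm (x - a))\<^sup>2)) x = 2 * f' * (i \<bullet> (x - a))"
  using pderiv_at_eq[OF has_derivative_radial[OF assms]] by simp

lemma laplacian_radial:
  fixes f f' f'' :: "real \<Rightarrow> real" and x a :: "'a::euclidean_space" and t :: real
  assumes "\<And>t. (f has_real_derivative f' t) (at t)" "\<And>t. (f' has_real_derivative f'' t) (at t)"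
  defines "t \<equiv> (norm (x - a))\<^sup>2"
  shows "laplacian (\<lambda>x. f ((norm (x - a))\<^sup>2)) x = 4 * t * f'' t + 2 * DIM('a) * f' t"
proof -
  have 1: "pderiv_at i (\<lambda>x. f ((norm (x - a))\<^sup>2)) = (\<lambda>x. 2 * f' ((norm (x - a))\<^sup>2) * (i \<bullet> (x - a)))" for i
    by (rule ext, rule pderiv_at_radial) (rule assms)
  have 2: "pderiv_at i (\<lambda>x. 2 * f' ((norm (x - a))\<^sup>2) * (i \<bullet> (x - a))) x
      = 4 * f'' t * (i \<bullet> (x - a))\<^sup>2 + 2 * f' t" if "i \<in> Basis" for i
  proof -
    have "((\<lambda>x. 2 * f' ((norm (x - a))\<^sup>2) * (i \<bullet> (x - a))) has_derivative
        (\<lambda>h. 2 * f' t * (i \<bullet> h) + 2 * (h \<bullet> ((2 * f'' t) *\<^sub>R (x - a))) * (i \<bullet> (x - a)))) (at x)"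
      unfolding t_def
      by (rule has_derivative_mult has_derivative_mult_right has_derivative_radial assms
            | auto intro!: derivative_eq_intros)+
    from pderiv_at_eq[OF this, of i] show ?thesis using that
      by (simp add: inner_same_Basis power2_eq_square mult_ac)
  qed
  have "laplacian (\<lambda>x. f ((norm (x - a))\<^sup>2)) x = (\<Sum>i\<in>Basis. 4 * f'' t * (i \<bullet> (x - a))\<^sup>2 + 2 * f' t)"
    unfolding laplacian_def 1 by (intro sum.cong refl 2)
  also have "\<dots> = 4 * f'' t * (\<Sum>i\<in>Basis. (i \<bullet> (x - a))\<^sup>2) + 2 * DIM('a) * f' t"
    by (simp add: sum.distrib sum_distrib_left)
  also have "(\<Sum>i\<in>Basis. (i \<bullet> (x - a))\<^sup>2) = t"
    unfolding t_def power2_norm_eq_inner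
    by (subst euclidean_inner) (simp add: power2_eq_square inner_commute)
  finally show ?thesis by (simp add: mult_ac)
qed

lemma test_function_radial:
  fixes f :: "real \<Rightarrow> real" and a :: "'a::euclidean_space"
  assumes "\<And>k. Ck_on k UNIV f" "\<And>t. t \<ge> s\<^sup>2 \<Longrightarrow> f t = 0" "s \<ge> 0" "cball a s \<subseteq> U"
  shows "test_function U (\<lambda>x. f ((norm (x - a))\<^sup>2))"
proof -
  have "Ck_on k UNIV (\<lambda>x. f ((norm (x - a))\<^sup>2))" for k
    by (rule Ck_on_compose[OF _ assms(1) Ck_on_power2_norm]) auto
  moreover have sub: "closure {x. f ((norm (x - a))\<^sup>2) \<noteq> 0} \<subseteq> cball a s"
  proof (rule closure_minimal)
    show "{x. f ((norm (x - a))\<^sup>2) \<noteq> 0} \<subseteq> cball a s"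
    proof
      fix x assume "x \<in> {x. f ((norm (x - a))\<^sup>2) \<noteq> 0}"
      then have "\<not> (norm (x - a))\<^sup>2 \<ge> s\<^sup>2" using assms(2) by auto
      then have "(norm (x - a))\<^sup>2 < s\<^sup>2" by simp
      then have "norm (x - a) < s" using assms(3) by (rule power2_less_imp_less)
      then show "x \<in> cball a s" by (simp add: dist_norm norm_minus_commute)
    qed
  qed simp
  moreover have "compact (closure {x. f ((norm (x - a))\<^sup>2) \<noteq> 0})"
    using sub by (meson bounded_cball bounded_subset closed_closure compact_eq_bounded_closed)
  ultimately show ?thesis using assms(4) unfolding test_function_def by blast
qed

section \<open>Square-integrable functions\<close>

text \<open>Functions rather than classes, as in \<open>L2_on\<close>, but over an arbitrary measure.\<close>

definition L2 :: "'a measure \<Rightarrow> ('a \<Rightarrow> 'b::euclidean_space) \<Rightarrow> bool" where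
  "L2 M f \<longleftrightarrow> f \<in> borel_measurable M \<and> integrable M (\<lambda>x. (norm (f x))\<^sup>2)"

lemma L2_measurable: "L2 M f \<Longrightarrow> f \<in> borel_measurable M"
  and L2_integrable: "L2 M f \<Longrightarrow> integrable M (\<lambda>x. (norm (f x))\<^sup>2)"
  by (auto simp: L2_def)

lemma norm_inner_le_squares: "norm (x \<bullet> y) \<le> (norm x)\<^sup>2 + (norm (y :: 'a::real_inner))\<^sup>2"
proof -
  have "norm (x \<bullet> y) \<le> norm x * norm y" using Cauchy_Schwarz_ineq2[of x y] by simp
  also have "\<dots> \<le> (norm x)\<^sup>2 + (norm y)\<^sup>2"
    using sum_squares_bound[of "norm x" "norm y"] zero_le_power2[of "norm x"] zero_le_power2[of "norm y"]
      mult_nonneg_nonneg[OF norm_ge_zero[of x] norm_ge_zero[of y]] by linarith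
  finally show ?thesis .
qed

lemma L2_inner_integrable:
  assumes "L2 M f" "L2 M g" shows "integrable M (\<lambda>x. f x \<bullet> g x)"
proof (rule Bochner_Integration.integrable_bound)
  show "integrable M (\<lambda>x. (norm (f x))\<^sup>2 + (norm (g x))\<^sup>2)"
    using assms by (intro Bochner_Integration.integrable_add L2_integrable)
  show "(\<lambda>x. f x \<bullet> g x) \<in> borel_measurable M"
    using assms by (intro borel_measurable_inner L2_measurable)
  show "AE x in M. norm (f x \<bullet> g x) \<le> norm ((norm (f x))\<^sup>2 + (norm (g x))\<^sup>2)"
    by (intro AE_I2 order_trans[OF norm_inner_le_squares]) simp
qed

lemma norm_add_squared: "(norm (x + y))\<^sup>2 = (norm x)\<^sup>2 + 2 * (x \<bullet> y) + (norm (y :: 'a::real_inner))\<^sup>2"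
  by (simp add: power2_norm_eq_inner inner_add_left inner_add_right inner_commute)

lemma norm_diff_squared: "(norm (x - y))\<^sup>2 = (norm x)\<^sup>2 - 2 * (x \<bullet> y) + (norm (y :: 'a::real_inner))\<^sup>2"
  by (simp add: power2_norm_eq_inner inner_diff_left inner_diff_right inner_commute)

lemma L2_add: "L2 M f \<Longrightarrow> L2 M g \<Longrightarrow> L2 M (\<lambda>x. f x + g x)"
  unfolding L2_def norm_add_squared using L2_inner_integrable[of M f g]
  by (auto simp: L2_def)

lemma L2_scaleR: "L2 M f \<Longrightarrow> L2 M (\<lambda>x. c *\<^sub>R f x)"
  unfolding L2_def by (auto simp: power_mult_distrib)

lemma L2_diff: "L2 M f \<Longrightarrow> L2 M g \<Longrightarrow> L2 M (\<lambda>x. f x - g x)"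
  using L2_add[of M f "\<lambda>x. (-1) *\<^sub>R g x"] L2_scaleR[of M g "-1"] by simp

lemma L2_inner_const: "L2 M f \<Longrightarrow> L2 M (\<lambda>x. f x \<bullet> c)"
proof -
  assume f: "L2 M f"
  have "integrable M (\<lambda>x. (norm (f x \<bullet> c))\<^sup>2)"
  proof (rule Bochner_Integration.integrable_bound)
    show "integrable M (\<lambda>x. (norm c)\<^sup>2 * (norm (f x))\<^sup>2)" using f by (auto simp: L2_def)
    show "(\<lambda>x. (norm (f x \<bullet> c))\<^sup>2) \<in> borel_measurable M" using f by (auto simp: L2_def)
    have "(norm (f x \<bullet> c))\<^sup>2 \<le> (norm c)\<^sup>2 * (norm (f x))\<^sup>2" for x
      using power_mono[OF Cauchy_Schwarz_ineq2[of "f x" c], of 2] by (simp add: power_mult_distrib mult.commute)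
    then show "AE x in M. norm ((norm (f x \<bullet> c))\<^sup>2) \<le> norm ((norm c)\<^sup>2 * (norm (f x))\<^sup>2)" by simp
  qed
  then show ?thesis using f by (auto simp: L2_def)
qed

lemma L2_norm_add_squared:
  assumes "L2 M f" "L2 M g"
  shows "(\<integral>x. (norm (f x + t *\<^sub>R g x))\<^sup>2 \<partial>M)
    = (\<integral>x. (norm (f x))\<^sup>2 \<partial>M) + 2 * t * (\<integral>x. f x \<bullet> g x \<partial>M) + t\<^sup>2 * (\<integral>x. (norm (g x))\<^sup>2 \<partial>M)"
proof -
  have "(norm (f x + t *\<^sub>R g x))\<^sup>2 = (norm (f x))\<^sup>2 + (2 * t) * (f x \<bullet> g x) + t\<^sup>2 * (norm (g x))\<^sup>2" for x
    by (simp add: norm_add_squared power_mult_distrib)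
  then show ?thesis
    using assms L2_inner_integrable[OF assms] by (simp add: L2_def)
qed

text \<open>The common source of the Cauchy-Schwarz inequalities for \<open>L\<^sup>2\<close> and for the form of the
Rayleigh quotient, whose null space is not trivial.\<close>

lemma discriminant_le:
  fixes a b c :: real
  assumes "\<And>t. a + 2 * t * b + t\<^sup>2 * c \<ge> 0" "c \<ge> 0"
  shows "b\<^sup>2 \<le> a * c"
proof (cases "c = 0")
  case True
  have "b = 0"
  proof (rule ccontr)
    assume "b \<noteq> 0"
    then have "2 * (- (a + 1) / (2 * b)) * b = - (a + 1)" by simp
    then show False using assms(1)[of "- (a + 1) / (2 * b)"] unfolding True by linarith
  qed
  then show ?thesis using True by simp
next
  case False
  then have c: "c > 0" using assms(2) by simp
  have "0 \<le> c * (a + 2 * (- b / c) * b + (- b / c)\<^sup>2 * c)"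
    using assms(1)[of "- b / c"] c by (intro mult_nonneg_nonneg) auto
  also have "\<dots> = a * c - b\<^sup>2" using c by (simp add: field_simps power2_eq_square)
  finally show ?thesis by simp
qed

lemma L2_Cauchy_Schwarz:
  assumes "L2 M f" "L2 M g"
  shows "(\<integral>x. f x \<bullet> g x \<partial>M)\<^sup>2 \<le> (\<integral>x. (norm (f x))\<^sup>2 \<partial>M) * (\<integral>x. (norm (g x))\<^sup>2 \<partial>M)"
proof (rule discriminant_le)
  show "(\<integral>x. (norm (f x))\<^sup>2 \<partial>M) + 2 * t * (\<integral>x. f x \<bullet> g x \<partial>M) + t\<^sup>2 * (\<integral>x. (norm (g x))\<^sup>2 \<partial>M) \<ge> 0" for t
    unfolding L2_norm_add_squared[OF assms, symmetric] by simp
qed simp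

lemma L2_tendsto_inner:
  assumes f: "\<And>n. L2 M (f n)" "L2 M f'" and g: "L2 M g"
    and lim: "(\<lambda>n. \<integral>x. (norm (f n x - f' x))\<^sup>2 \<partial>M) \<longlonglongrightarrow> 0"
  shows "(\<lambda>n. \<integral>x. f n x \<bullet> g x \<partial>M) \<longlonglongrightarrow> (\<integral>x. f' x \<bullet> g x \<partial>M)"
proof -
  let ?d = "\<lambda>n. \<integral>x. (f n x - f' x) \<bullet> g x \<partial>M"
  have "(\<lambda>n. (?d n)\<^sup>2) \<longlonglongrightarrow> 0"
  proof (rule tendsto_sandwich[where f = "\<lambda>_. 0"])
    show "\<forall>\<^sub>F n in sequentially. (?d n)\<^sup>2
        \<le> (\<integral>x. (norm (f n x - f' x))\<^sup>2 \<partial>M) * (\<integral>x. (norm (g x))\<^sup>2 \<partial>M)"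
      by (intro always_eventually allI L2_Cauchy_Schwarz L2_diff f g)
    show "(\<lambda>n. (\<integral>x. (norm (f n x - f' x))\<^sup>2 \<partial>M) * (\<integral>x. (norm (g x))\<^sup>2 \<partial>M)) \<longlonglongrightarrow> 0"
      using tendsto_mult_left_zero[OF lim] by simp
  qed auto
  then have "?d \<longlonglongrightarrow> 0" by simp
  moreover have "?d n = (\<integral>x. f n x \<bullet> g x \<partial>M) - (\<integral>x. f' x \<bullet> g x \<partial>M)" for n
    by (simp add: inner_diff_left L2_inner_integrable f g)
  ultimately have "(\<lambda>n. (\<integral>x. f n x \<bullet> g x \<partial>M) - (\<integral>x. f' x \<bullet> g x \<partial>M)) \<longlonglongrightarrow> 0" by simp
  then show ?thesis by (rule LIM_zero_cancel)
qed

lemma L2_tendsto_norm: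
  assumes f: "\<And>n. L2 M (f n)" "L2 M f'"
    and lim: "(\<lambda>n. \<integral>x. (norm (f n x - f' x))\<^sup>2 \<partial>M) \<longlonglongrightarrow> 0"
  shows "(\<lambda>n. \<integral>x. (norm (f n x))\<^sup>2 \<partial>M) \<longlonglongrightarrow> (\<integral>x. (norm (f' x))\<^sup>2 \<partial>M)"
proof -
  have "(\<integral>x. (norm (f n x))\<^sup>2 \<partial>M) = (\<integral>x. (norm (f n x - f' x))\<^sup>2 \<partial>M)
      + 2 * (\<integral>x. f n x \<bullet> f' x \<partial>M) - (\<integral>x. f' x \<bullet> f' x \<partial>M)" for n
  proof -
    have "(\<integral>x. (norm (f n x))\<^sup>2 \<partial>M)
        = (\<integral>x. (norm (f n x - f' x))\<^sup>2 + 2 * (f n x \<bullet> f' x) - f' x \<bullet> f' x \<partial>M)"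
      by (simp add: norm_diff_squared dot_square_norm)
    then show ?thesis
      using L2_integrable[OF L2_diff[OF f(1)[of n] f(2)]] L2_inner_integrable[OF f(1)[of n] f(2)]
        L2_inner_integrable[OF f(2) f(2)] by simp
  qed
  moreover have "(\<lambda>n. (\<integral>x. (norm (f n x - f' x))\<^sup>2 \<partial>M)
      + 2 * (\<integral>x. f n x \<bullet> f' x \<partial>M) - (\<integral>x. f' x \<bullet> f' x \<partial>M))
      \<longlonglongrightarrow> 0 + 2 * (\<integral>x. f' x \<bullet> f' x \<partial>M) - (\<integral>x. f' x \<bullet> f' x \<partial>M)"
    by (intro tendsto_intros lim L2_tendsto_inner f)
  ultimately show ?thesis by (simp add: power2_norm_eq_inner)
qed

text \<open>On a finite measure space this compares \<open>L\<^sup>1\<close> with \<open>L\<^sup>2\<close>.\<close>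

lemma le_add_square_divide: "d > 0 \<Longrightarrow> (h::real) \<le> d + h\<^sup>2 / d"
proof -
  assume d: "d > 0"
  have "h * d \<le> d\<^sup>2 + h\<^sup>2" using norm_inner_le_squares[of h d] d by (simp add: abs_mult abs_if split: if_splits)
  then show ?thesis using d by (simp add: field_simps power2_eq_square)
qed

lemma (in finite_measure) L2_imp_integrable:
  assumes "L2 M f" shows "integrable M f"
proof (rule Bochner_Integration.integrable_bound)
  show "integrable M (\<lambda>x. 1 + (norm (f x))\<^sup>2)" using assms by (simp add: L2_def)
  show "f \<in> borel_measurable M" using assms by (simp add: L2_def)
  have "norm (f x) \<le> 1 + (norm (f x))\<^sup>2" for x using le_add_square_divide[of 1 "norm (f x)"] by simp
  then show "AE x in M. norm (f x) \<le> norm (1 + (norm (f x))\<^sup>2)" by simp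
qed

text \<open>On a finite measure space \<open>L\<^sup>2\<close>-Cauchy sequences are \<open>L\<^sup>1\<close>-Cauchy and so have an almost
everywhere convergent subsequence; Fatou's lemma upgrades this to convergence in \<open>L\<^sup>2\<close>.\<close>

lemma (in finite_measure) L2_complete:
  fixes f :: "nat \<Rightarrow> 'a \<Rightarrow> 'b::euclidean_space"
  assumes f: "\<And>n. L2 M (f n)"
    and Cauchy: "\<And>e. e > 0 \<Longrightarrow> \<exists>N. \<forall>i\<ge>N. \<forall>j\<ge>N. (\<integral>x. (norm (f i x - f j x))\<^sup>2 \<partial>M) < e"
  obtains g where "L2 M g" "(\<lambda>n. \<integral>x. (norm (f n x - g x))\<^sup>2 \<partial>M) \<longlonglongrightarrow> 0"
proof -
  have int: "integrable M (f n)" for n by (rule L2_imp_integrable[OF f])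
  have meas [measurable]: "f n \<in> borel_measurable M" for n using f by (simp add: L2_def)
  have L1: "\<exists>N. \<forall>i\<ge>N. \<forall>j\<ge>N. (\<integral>x. norm (f i x - f j x) \<partial>M) < e" if e: "e > 0" for e
  proof -
    define d where "d = e / (2 * (measure M (space M) + 1))"
    have d: "d > 0" using e by (simp add: d_def add_nonneg_pos)
    obtain N where N: "\<And>i j. i \<ge> N \<Longrightarrow> j \<ge> N \<Longrightarrow> (\<integral>x. (norm (f i x - f j x))\<^sup>2 \<partial>M) < d * e / 2"
      using Cauchy[of "d * e / 2"] d e by auto
    have "(\<integral>x. norm (f i x - f j x) \<partial>M) < e" if ij: "i \<ge> N" "j \<ge> N" for i j
    proof -
      have sq: "integrable M (\<lambda>x. (norm (f i x - f j x))\<^sup>2)" by (intro L2_integrable L2_diff f)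
      have "(\<integral>x. norm (f i x - f j x) \<partial>M) \<le> (\<integral>x. d + (norm (f i x - f j x))\<^sup>2 / d \<partial>M)"
        by (intro integral_mono) (use int sq d le_add_square_divide in auto)
      also have "\<dots> = d * measure M (space M) + (\<integral>x. (norm (f i x - f j x))\<^sup>2 \<partial>M) / d"
        using sq by simp
      also have "d * measure M (space M) < e / 2"
      proof -
        have "d * measure M (space M) < d * (measure M (space M) + 1)" using d by simp
        also have "\<dots> = e / 2"
          using measure_nonneg[of M "space M"] by (simp add: d_def divide_simps add_nonneg_eq_0_iff)
        finally show ?thesis .
      qed
      also have "(\<integral>x. (norm (f i x - f j x))\<^sup>2 \<partial>M) / d < e / 2"
        using N[OF ij] d by (simp add: field_simps)
      finally show ?thesis by simp
    qed
    then show ?thesis by blast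
  qed
  obtain r where r: "strict_mono r" and ae: "AE x in M. Cauchy (\<lambda>i. f (r i) x)"
    by (rule cauchy_L1_AE_cauchy_subseq[of M f, OF int L1])
  define g where "g x = lim (\<lambda>i. f (r i) x)" for x
  have g [measurable]: "g \<in> borel_measurable M" unfolding g_def[abs_def] by (rule borel_measurable_lim_metric) simp
  have lim: "AE x in M. (\<lambda>i. f (r i) x) \<longlonglongrightarrow> g x"
    using ae unfolding g_def by eventually_elim (simp add: Cauchy_convergent_iff convergent_LIMSEQ_iff)
  have bound: "(\<integral>\<^sup>+x. ennreal ((norm (f n x - g x))\<^sup>2) \<partial>M) \<le> ennreal e"
    if N: "\<And>j. j \<ge> N \<Longrightarrow> (\<integral>x. (norm (f n x - f j x))\<^sup>2 \<partial>M) < e" for N n e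
  proof -
    have "(\<integral>\<^sup>+x. ennreal ((norm (f n x - g x))\<^sup>2) \<partial>M)
        = (\<integral>\<^sup>+x. liminf (\<lambda>k. ennreal ((norm (f n x - f (r k) x))\<^sup>2)) \<partial>M)"
    proof (rule nn_integral_cong_AE)
      show "AE x in M. ennreal ((norm (f n x - g x))\<^sup>2) = liminf (\<lambda>k. ennreal ((norm (f n x - f (r k) x))\<^sup>2))"
        using lim
      proof eventually_elim
        case (elim x)
        then have "(\<lambda>k. ennreal ((norm (f n x - f (r k) x))\<^sup>2)) \<longlonglongrightarrow> ennreal ((norm (f n x - g x))\<^sup>2)"
          by (intro tendsto_ennrealI tendsto_intros)
        from lim_imp_Liminf[OF _ this] show ?case by simp
      qed
    qed
    also have "\<dots> \<le> liminf (\<lambda>k. \<integral>\<^sup>+x. ennreal ((norm (f n x - f (r k) x))\<^sup>2) \<partial>M)"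
      by (rule nn_integral_liminf) simp
    also have "\<dots> \<le> ennreal e"
    proof (rule Liminf_le)
      show "\<forall>\<^sub>F k in sequentially. (\<integral>\<^sup>+x. ennreal ((norm (f n x - f (r k) x))\<^sup>2) \<partial>M) \<le> ennreal e"
        using eventually_ge_at_top[of N]
      proof eventually_elim
        case (elim k)
        then have "r k \<ge> N" using seq_suble[OF r, of k] by simp
        moreover have "integrable M (\<lambda>x. (norm (f n x - f (r k) x))\<^sup>2)" by (intro L2_integrable L2_diff f)
        ultimately show ?case using N by (simp add: nn_integral_eq_integral ennreal_leI less_imp_le)
      qed
    qed simp
    finally show ?thesis .
  qed
  have L2g: "L2 M g"
  proof -
    obtain N where N: "\<And>i j. i \<ge> N \<Longrightarrow> j \<ge> N \<Longrightarrow> (\<integral>x. (norm (f i x - f j x))\<^sup>2 \<partial>M) < 1"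
      using Cauchy[of 1] by auto
    have "(\<integral>\<^sup>+x. ennreal ((norm (f N x - g x))\<^sup>2) \<partial>M) < \<infinity>"
      using bound[of N N 1] N by (simp add: order_le_less_trans)
    then have "L2 M (\<lambda>x. f N x - g x)"
      unfolding L2_def by (auto intro!: integrableI_bounded)
    from L2_diff[OF f[of N] this] show ?thesis by simp
  qed
  have "(\<lambda>n. \<integral>x. (norm (f n x - g x))\<^sup>2 \<partial>M) \<longlonglongrightarrow> 0"
  proof (rule LIMSEQ_I)
    fix e :: real assume "e > 0"
    then obtain N where N: "\<And>i j. i \<ge> N \<Longrightarrow> j \<ge> N \<Longrightarrow> (\<integral>x. (norm (f i x - f j x))\<^sup>2 \<partial>M) < e / 2"
      using Cauchy[of "e / 2"] by auto
    have "norm ((\<integral>x. (norm (f n x - g x))\<^sup>2 \<partial>M) - 0) < e" if "n \<ge> N" for n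
    proof -
      have "ennreal (\<integral>x. (norm (f n x - g x))\<^sup>2 \<partial>M) \<le> ennreal (e / 2)"
        using bound[of N n "e / 2"] N that
        by (subst nn_integral_eq_integral[symmetric]) (auto intro!: L2_integrable L2_diff f L2g)
      then show ?thesis using \<open>e > 0\<close> by (simp add: ennreal_le_iff)
    qed
    then show "\<exists>no. \<forall>n\<ge>no. norm ((\<integral>x. (norm (f n x - g x))\<^sup>2 \<partial>M) - 0) < e" by blast
  qed
  with L2g show ?thesis by (rule that)
qed

section \<open>Test functions\<close>

lemma test_function_Ck: "test_function U \<phi> \<Longrightarrow> Ck_on n UNIV \<phi>"
  by (simp add: test_function_def)

lemma test_function_differentiable: "test_function U \<phi> \<Longrightarrow> \<phi> differentiable (at x)"
  using test_function_Ck[of U \<phi> "Suc 0"] by simp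

lemma test_function_continuous: "test_function U \<phi> \<Longrightarrow> continuous_on S \<phi>"
  using test_function_Ck[of U \<phi> 0] by (auto intro: continuous_on_subset)

lemma test_functionE:
  assumes "test_function U \<phi>"
  obtains K where "compact K" "K \<subseteq> U" "\<And>x. x \<notin> K \<Longrightarrow> \<phi> x = 0"
  using assms closure_subset[of "{x. \<phi> x \<noteq> 0}"] unfolding test_function_def by blast

lemma test_functionI:
  assumes "\<And>n. Ck_on n UNIV \<phi>" "compact K" "K \<subseteq> U" "\<And>x. x \<notin> K \<Longrightarrow> \<phi> x = 0"
  shows "test_function U \<phi>"
proof -
  have sub: "closure {x. \<phi> x \<noteq> 0} \<subseteq> K"
    by (rule closure_minimal) (use assms compact_imp_closed in auto)
  then have "compact (closure {x. \<phi> x \<noteq> 0})"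
    using bounded_subset[OF compact_imp_bounded[OF assms(2)]] closed_closure
    by (simp only: compact_eq_bounded_closed simp_thms)
  then show ?thesis using assms(1,3) sub by (auto simp: test_function_def)
qed

lemma test_function_0: "test_function U \<phi> \<Longrightarrow> x \<notin> U \<Longrightarrow> \<phi> x = 0"
  by (metis test_functionE subsetD)

lemma pderiv_at_0_outside:
  assumes "closed K" "\<And>x. x \<notin> K \<Longrightarrow> \<phi> x = 0" "x \<notin> K"
  shows "pderiv_at i \<phi> x = 0"
proof -
  have "pderiv_at i \<phi> x = pderiv_at i (\<lambda>_. 0) x"
    by (rule pderiv_at_cong_open[of "- K"]) (use assms in auto)
  also have "\<dots> = 0" by (rule pderiv_at_eq[of "\<lambda>_. 0" "\<lambda>_. 0"]) simp
  finally show ?thesis .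
qed

lemma test_function_pderiv:
  assumes "test_function U \<phi>" "i \<in> Basis"
  shows "test_function U (pderiv_at i \<phi>)"
proof -
  obtain K where K: "compact K" "K \<subseteq> U" "\<And>x. x \<notin> K \<Longrightarrow> \<phi> x = 0"
    using assms(1) by (rule test_functionE) blast
  show ?thesis
    by (rule test_functionI[OF _ K(1,2)])
      (use assms test_function_Ck[OF assms(1), of "Suc _"] pderiv_at_0_outside[OF compact_imp_closed[OF K(1)] K(3)] in auto)
qed

lemma test_function_lincomb:
  assumes "test_function U \<phi>" "test_function U \<psi>"
  shows "test_function U (\<lambda>x. a * \<phi> x + b * \<psi> x)"
proof -
  obtain K where K: "compact K" "K \<subseteq> U" "\<And>x. x \<notin> K \<Longrightarrow> \<phi> x = 0"
    using assms(1) by (rule test_functionE) blast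
  obtain L where L: "compact L" "L \<subseteq> U" "\<And>x. x \<notin> L \<Longrightarrow> \<psi> x = 0"
    using assms(2) by (rule test_functionE) blast
  show ?thesis
    by (rule test_functionI[of _ "K \<union> L"])
      (use K L in \<open>auto intro!: Ck_on_add Ck_on_cmult test_function_Ck[OF assms(1)] test_function_Ck[OF assms(2)]\<close>)
qed

lemma gradient_lincomb:
  assumes "\<phi> differentiable (at x)" "\<psi> differentiable (at x)"
  shows "gradient (\<lambda>x. a * \<phi> x + b * \<psi> x) x = a *\<^sub>R gradient \<phi> x + b *\<^sub>R gradient \<psi> x"
proof (rule gradient_eqI)
  show "((\<lambda>x. a * \<phi> x + b * \<psi> x) has_derivative
      (\<lambda>h. h \<bullet> (a *\<^sub>R gradient \<phi> x + b *\<^sub>R gradient \<psi> x))) (at x)"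
    using has_derivative_add[OF has_derivative_mult_right[OF gradient_has_derivative[OF assms(1)], of a]
        has_derivative_mult_right[OF gradient_has_derivative[OF assms(2)], of b]]
    by (simp add: inner_add_right)
qed

lemma gradient_0_outside:
  assumes "closed K" "\<And>x. x \<notin> K \<Longrightarrow> \<phi> x = 0" "x \<notin> K"
  shows "gradient \<phi> x = 0"
  using pderiv_at_0_outside[OF assms] by (simp add: gradient_def)

lemma test_function_gradient_0: "test_function U \<phi> \<Longrightarrow> x \<notin> U \<Longrightarrow> gradient \<phi> x = 0"
  by (metis test_functionE subsetD gradient_0_outside compact_imp_closed)

lemma Ck_on_continuous_gradient: "Ck_on (Suc n) S \<phi> \<Longrightarrow> continuous_on S (gradient \<phi>)"
  unfolding gradient_def[abs_def]
  by (intro continuous_intros Ck_on_imp_continuous_on[of n]) simp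

lemma test_function_continuous_gradient: "test_function U \<phi> \<Longrightarrow> continuous_on S (gradient \<phi>)"
  using Ck_on_continuous_gradient[OF test_function_Ck[of U \<phi> "Suc 0"]] by (auto intro: continuous_on_subset)

section \<open>Integration by parts and the translation estimate\<close>

lemma compact_support_integrable:
  fixes f :: "'a::euclidean_space \<Rightarrow> 'b::{banach, second_countable_topology}"
  assumes "continuous_on UNIV f" "compact K" "\<And>x. x \<notin> K \<Longrightarrow> f x = 0"
  shows "integrable lborel f"
proof -
  have "integrable lborel (\<lambda>x. indicator K x *\<^sub>R f x)"
    by (rule borel_integrable_compact[OF assms(2) continuous_on_subset[OF assms(1)]]) simp
  moreover have "(\<lambda>x. indicator K x *\<^sub>R f x) = f"
    using assms(3) by (auto simp: fun_eq_iff indicator_def)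
  ultimately show ?thesis by simp
qed

lemma compact_support_bounded:
  fixes f :: "'a::topological_space \<Rightarrow> 'b::real_normed_vector"
  assumes "continuous_on UNIV f" "compact K" "\<And>x. x \<notin> K \<Longrightarrow> f x = 0"
  obtains B where "B \<ge> 0" "\<And>x. norm (f x) \<le> B"
proof -
  have "bounded (f ` K)"
    using compact_imp_bounded[OF compact_continuous_image[OF continuous_on_subset[OF assms(1)] assms(2)]] by simp
  then obtain B where B: "\<And>x. x \<in> K \<Longrightarrow> norm (f x) \<le> B" by (auto simp: bounded_iff)
  have "norm (f x) \<le> max 0 B" for x using B[of x] assms(3)[of x] by (cases "x \<in> K") auto
  then show ?thesis using that[of "max 0 B"] by simp
qed

lemma integral_translation:
  fixes f :: "'a::euclidean_space \<Rightarrow> 'b::{banach, second_countable_topology}"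
  assumes "f \<in> borel_measurable borel"
  shows "(\<integral>x. f (c + x) \<partial>lborel) = integral\<^sup>L lborel f"
proof -
  have "integral\<^sup>L lborel f = integral\<^sup>L (distr lborel borel ((+) c)) f" by (simp add: lborel_distr_plus)
  also have "\<dots> = (\<integral>x. f (c + x) \<partial>lborel)" by (rule integral_distr) (use assms in auto)
  finally show ?thesis by simp
qed

lemma integrable_translation:
  fixes f :: "'a::euclidean_space \<Rightarrow> 'b::{banach, second_countable_topology}"
  assumes "integrable lborel f"
  shows "integrable lborel (\<lambda>x. f (c + x))"
proof -
  have m: "f \<in> borel_measurable borel" using borel_measurable_integrable[OF assms] by simp
  have "integrable (distr lborel borel ((+) c)) f" using assms by (simp only: lborel_distr_plus)
  then show ?thesis by (rule integrable_distr_eq[THEN iffD1, rotated 2]) (use m in auto)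
qed

lemma nn_integral_translation:
  fixes f :: "'a::euclidean_space \<Rightarrow> ennreal"
  assumes "f \<in> borel_measurable borel"
  shows "(\<integral>\<^sup>+x. f (c + x) \<partial>lborel) = integral\<^sup>N lborel f"
proof -
  have "integral\<^sup>N lborel f = integral\<^sup>N (distr lborel borel ((+) c)) f" by (simp add: lborel_distr_plus)
  also have "\<dots> = (\<integral>\<^sup>+x. f (c + x) \<partial>lborel)" by (rule nn_integral_distr) (use assms in auto)
  finally show ?thesis by simp
qed

lemma DERIV_along_line:
  fixes F :: "'a::euclidean_space \<Rightarrow> real"
  assumes "F differentiable (at (x + t *\<^sub>R z))"
  shows "((\<lambda>t. F (x + t *\<^sub>R z)) has_real_derivative z \<bullet> gradient F (x + t *\<^sub>R z)) (at t)"
proof -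
  have "((\<lambda>t. x + t *\<^sub>R z) has_derivative (\<lambda>h. h *\<^sub>R z)) (at t)"
    by (auto intro!: derivative_eq_intros)
  from has_derivative_compose[OF this gradient_has_derivative[OF assms]]
  show ?thesis by (simp add: has_field_derivative_def mult.commute[of _ "z \<bullet> _"])
qed

text \<open>By translation invariance all difference quotients have integral \<open>0\<close>, and they converge boundedly, with
supports in a common ball, to the derivative.\<close>

lemma integral_pderiv_eq_0:
  fixes F :: "'a::euclidean_space \<Rightarrow> real"
  assumes F: "Ck_on 1 UNIV F" and K: "compact K" "\<And>x. x \<notin> K \<Longrightarrow> F x = 0" and i: "i \<in> Basis"
  shows "(\<integral>x. pderiv_at i F x \<partial>lborel) = 0"
proof -
  have cF: "continuous_on UNIV F" by (rule Ck_on_imp_continuous_on[OF F])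
  have cp: "continuous_on UNIV (pderiv_at i F)" using F i by simp
  have df: "F differentiable (at x)" for x using F by simp
  have p0: "pderiv_at i F x = 0" if "x \<notin> K" for x
    by (rule pderiv_at_0_outside[OF compact_imp_closed[OF K(1)] K(2) that])
  obtain B where B: "B \<ge> 0" "\<And>x. norm (pderiv_at i F x) \<le> B"
    by (rule compact_support_bounded[OF cp K(1) p0]) auto
  obtain R where R: "K \<subseteq> cball 0 R"
    using compact_imp_bounded[OF K(1)] by (auto simp: bounded_iff subset_iff)
  define t where "t n = inverse (real (Suc n))" for n
  have t: "0 < t n" "t n \<le> 1" for n by (auto simp: t_def inverse_eq_divide)
  define q where "q n x = (F (t n *\<^sub>R i + x) - F x) / t n" for n x
  have meas: "F \<in> borel_measurable borel" using cF by (rule borel_measurable_continuous_onI)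
  have lim: "(\<lambda>n. q n x) \<longlonglongrightarrow> pderiv_at i F x" for x
  proof -
    have "((\<lambda>s. F (x + s *\<^sub>R i)) has_real_derivative pderiv_at i F x) (at 0)"
      using DERIV_along_line[of F x 0 i] df by (simp add: inner_commute[of i] inner_gradient_Basis[OF i])
    then have "((\<lambda>h. (F (x + h *\<^sub>R i) - F x) / h) \<longlongrightarrow> pderiv_at i F x) (at 0)"
      by (simp add: DERIV_def)
    moreover have "filterlim t (at 0) sequentially"
      unfolding filterlim_at using t LIMSEQ_inverse_real_of_nat
      by (auto simp: t_def[abs_def] less_imp_neq[symmetric])
    ultimately have "(\<lambda>n. (F (x + t n *\<^sub>R i) - F x) / t n) \<longlonglongrightarrow> pderiv_at i F x"
      by (rule filterlim_compose)
    then show ?thesis unfolding q_def by (simp add: add.commute)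
  qed
  have bound: "norm (q n x) \<le> B * indicator (cball 0 (R + 1)) x" for n x
  proof (cases "x \<in> cball 0 (R + 1)")
    case True
    have "\<exists>z>0. z < t n \<and> F (x + t n *\<^sub>R i) - F (x + 0 *\<^sub>R i) = (t n - 0) * (i \<bullet> gradient F (x + z *\<^sub>R i))"
      by (rule MVT2[where f = "\<lambda>s. F (x + s *\<^sub>R i)", OF t(1) DERIV_along_line[OF df]])
    then obtain z where "F (x + t n *\<^sub>R i) - F x = t n * pderiv_at i F (x + z *\<^sub>R i)"
      by (auto simp: inner_commute[of i] inner_gradient_Basis[OF i])
    then have "q n x = pderiv_at i F (x + z *\<^sub>R i)" using t[of n] by (simp add: q_def add.commute)
    then show ?thesis using B True by simp
  next
    case False
    then have n: "norm x > R + 1" by simp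
    have "norm x - norm (t n *\<^sub>R i) \<le> norm (t n *\<^sub>R i + x)" by (metis add.commute norm_diff_ineq)
    then have "norm (t n *\<^sub>R i + x) > R" using n t[of n] i by simp
    then have "t n *\<^sub>R i + x \<notin> K" "x \<notin> K" using R n by auto
    then show ?thesis using K(2) False by (simp add: q_def)
  qed
  have "(\<lambda>n. integral\<^sup>L lborel (q n)) \<longlonglongrightarrow> (\<integral>x. pderiv_at i F x \<partial>lborel)"
  proof (rule integral_dominated_convergence)
    show "integrable lborel (\<lambda>x::'a. B * indicator (cball 0 (R + 1)) x)"
      using emeasure_bounded_finite[of "cball (0::'a) (R + 1)"] by (intro integrable_mult_right) (simp add: integrable_indicator_iff)
    show "pderiv_at i F \<in> borel_measurable lborel" using borel_measurable_continuous_onI[OF cp] by simp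
    show "q n \<in> borel_measurable lborel" for n unfolding q_def[abs_def] using meas by measurable
  qed (use lim bound in auto)
  moreover have "integral\<^sup>L lborel (q n) = 0" for n
  proof -
    have int: "integrable lborel F" by (rule compact_support_integrable[OF cF K])
    have "integrable lborel (\<lambda>x. F (t n *\<^sub>R i + x))"
      by (rule integrable_translation[OF int])
    then show ?thesis using int integral_translation[OF meas, of "t n *\<^sub>R i"] t[of n]
      by (simp add: q_def[abs_def])
  qed
  ultimately show ?thesis by (simp add: LIMSEQ_const_iff)
qed

lemma integral_by_parts_pderiv:
  fixes f g :: "'a::euclidean_space \<Rightarrow> real"
  assumes "Ck_on 1 UNIV f" "test_function U g" "i \<in> Basis"
  shows "(\<integral>x. f x * pderiv_at i g x \<partial>lborel) = - (\<integral>x. pderiv_at i f x * g x \<partial>lborel)"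
proof -
  obtain K where K: "compact K" "K \<subseteq> U" "\<And>x. x \<notin> K \<Longrightarrow> g x = 0"
    using assms(2) by (rule test_functionE) blast
  have g1: "Ck_on 1 UNIV g" by (rule test_function_Ck[OF assms(2)])
  have p0: "pderiv_at i g x = 0" if "x \<notin> K" for x
    by (rule pderiv_at_0_outside[OF compact_imp_closed[OF K(1)] K(3) that])
  have eq: "pderiv_at i (\<lambda>x. f x * g x) x = f x * pderiv_at i g x + pderiv_at i f x * g x" for x
    using pderiv_at_eq[OF has_derivative_mult[OF Ck_on_SucD[of 0 UNIV f] Ck_on_SucD[of 0 UNIV g]]] assms(1) g1
    by (simp add: pderiv_at_def)
  have "(\<integral>x. f x * pderiv_at i g x + pderiv_at i f x * g x \<partial>lborel) = 0"
    using integral_pderiv_eq_0[of "\<lambda>x. f x * g x" K i] K assms(3) Ck_on_mult[OF _ assms(1) g1] by (simp add: eq)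
  moreover have "integrable lborel (\<lambda>x. f x * pderiv_at i g x)"
    by (rule compact_support_integrable[OF _ K(1)])
      (use assms g1 p0 Ck_on_imp_continuous_on[OF assms(1)] in \<open>auto intro!: continuous_intros\<close>)
  moreover have "integrable lborel (\<lambda>x. pderiv_at i f x * g x)"
    by (rule compact_support_integrable[OF _ K(1)])
      (use assms K Ck_on_imp_continuous_on[OF g1] in \<open>auto intro!: continuous_intros\<close>)
  ultimately show ?thesis by simp
qed

lemma integrable_Icc:
  fixes f :: "real \<Rightarrow> real"
  assumes "continuous_on UNIV f"
  shows "integrable lborel (\<lambda>t. f t * indicator {a..b} t)"
  using borel_integrable_compact[of "{a..b}" f] continuous_on_subset[OF assms, of "{a..b}"]
  by (simp add: mult.commute)

text \<open>The fundamental theorem of calculus followed by Cauchy-Schwarz on the unit interval.\<close>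

lemma square_difference_le:
  fixes g :: "real \<Rightarrow> real"
  assumes "\<And>t. (g has_real_derivative g' t) (at t)" "continuous_on UNIV g'"
  shows "(g 1 - g 0)\<^sup>2 \<le> (\<integral>t. (g' t)\<^sup>2 * indicator {0..1} t \<partial>lborel)"
proof -
  let ?M = "restrict_space lborel {0..1::real}"
  have i: "integrable ?M g'" "integrable ?M (\<lambda>t. (g' t)\<^sup>2)" "integrable ?M (\<lambda>t. 1::real)"
    using integrable_Icc[OF assms(2), of 0 1] integrable_Icc[OF continuous_on_power[OF assms(2)], of 2 0 1]
      integrable_Icc[of "\<lambda>_. 1" 0 1]
    by (simp_all add: integrable_restrict_space mult.commute)
  have I: "(\<integral>t. f t \<partial>?M) = (\<integral>t. f t * indicator {0..1} t \<partial>lborel)" for f :: "real \<Rightarrow> real"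
    by (simp add: integral_restrict_space mult.commute)
  have "(\<integral>t. g' t * indicator {0..1} t \<partial>lborel) = g 1 - g 0"
    by (rule integral_FTC_Icc_real) (use assms in \<open>auto simp: continuous_on_eq_continuous_at\<close>)
  then have eq: "(\<integral>t. g' t \<bullet> 1 \<partial>?M) = g 1 - g 0" by (simp add: I)
  have "(\<integral>t. g' t \<bullet> 1 \<partial>?M)\<^sup>2 \<le> (\<integral>t. (norm (g' t))\<^sup>2 \<partial>?M) * (\<integral>t. (norm (1::real))\<^sup>2 \<partial>?M)"
    by (rule L2_Cauchy_Schwarz) (use i in \<open>auto simp: L2_def\<close>)
  then show ?thesis unfolding eq by (simp add: I measure_restrict_space)
qed

text \<open>Integrate the one-dimensional inequality along the segment from \<open>x\<close> to \<open>x + z\<close> over all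
\<open>x\<close> and exchange the integrals; every translate of the gradient has the same norm.\<close>

lemma translation_estimate:
  fixes \<phi> :: "'a::euclidean_space \<Rightarrow> real"
  assumes \<phi>: "test_function U \<phi>"
  shows "(\<integral>\<^sup>+x. ennreal ((\<phi> (x + z) - \<phi> x)\<^sup>2) \<partial>lborel)
    \<le> ennreal ((norm z)\<^sup>2) * (\<integral>\<^sup>+x. ennreal ((norm (gradient \<phi> x))\<^sup>2) \<partial>lborel)"
proof -
  let ?G = "\<lambda>x. (norm (gradient \<phi> x))\<^sup>2"
  have cG: "continuous_on UNIV (gradient \<phi>)" by (rule test_function_continuous_gradient[OF \<phi>])
  have mG [measurable]: "gradient \<phi> \<in> borel_measurable borel" by (rule borel_measurable_continuous_onI[OF cG])
  have le: "ennreal ((\<phi> (x + z) - \<phi> x)\<^sup>2)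
      \<le> (\<integral>\<^sup>+t. ennreal ((norm z)\<^sup>2 * ?G (t *\<^sub>R z + x)) * indicator {0..1} t \<partial>lborel)" for x
  proof -
    let ?g' = "\<lambda>t. z \<bullet> gradient \<phi> (x + t *\<^sub>R z)"
    have cl: "continuous_on S (\<lambda>t. gradient \<phi> (x + t *\<^sub>R z))" for S
      by (rule continuous_on_compose2[OF cG]) (auto intro!: continuous_intros)
    have "(\<phi> (x + z) - \<phi> x)\<^sup>2 \<le> (\<integral>t. (?g' t)\<^sup>2 * indicator {0..1} t \<partial>lborel)"
      using square_difference_le[of "\<lambda>t. \<phi> (x + t *\<^sub>R z)" ?g'] DERIV_along_line[OF test_function_differentiable[OF \<phi>]]
        continuous_on_inner[OF continuous_on_const cl[of UNIV], of z]
      by simp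
    also have "\<dots> \<le> (\<integral>t. (norm z)\<^sup>2 * ?G (t *\<^sub>R z + x) * indicator {0..1} t \<partial>lborel)"
    proof (rule integral_mono)
      show "integrable lborel (\<lambda>t. (?g' t)\<^sup>2 * indicator {0..1} t)"
        "integrable lborel (\<lambda>t. (norm z)\<^sup>2 * ?G (t *\<^sub>R z + x) * indicator {0..1} t)"
        using cl[of UNIV] by (auto intro!: integrable_Icc continuous_intros simp: add.commute)
      show "(?g' t)\<^sup>2 * indicator {0..1} t \<le> (norm z)\<^sup>2 * ?G (t *\<^sub>R z + x) * indicator {0..1} t" for t
        using power_mono[OF Cauchy_Schwarz_ineq2[of z "gradient \<phi> (x + t *\<^sub>R z)"], of 2]
        by (auto simp: power_mult_distrib indicator_def add.commute)
    qed
    finally have "ennreal ((\<phi> (x + z) - \<phi> x)\<^sup>2)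
        \<le> ennreal (\<integral>t. (norm z)\<^sup>2 * ?G (t *\<^sub>R z + x) * indicator {0..1} t \<partial>lborel)"
      by (rule ennreal_leI)
    also have "\<dots> = (\<integral>\<^sup>+t. ennreal ((norm z)\<^sup>2 * ?G (t *\<^sub>R z + x) * indicator {0..1} t) \<partial>lborel)"
      using cl[of UNIV] by (intro nn_integral_eq_integral[symmetric])
        (auto intro!: integrable_Icc continuous_intros simp: add.commute)
    also have "\<dots> = (\<integral>\<^sup>+t. ennreal ((norm z)\<^sup>2 * ?G (t *\<^sub>R z + x)) * indicator {0..1} t \<partial>lborel)"
      by (intro nn_integral_cong) (auto simp: indicator_def)
    finally show ?thesis .
  qed
  have "(\<integral>\<^sup>+x. ennreal ((\<phi> (x + z) - \<phi> x)\<^sup>2) \<partial>lborel)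
      \<le> (\<integral>\<^sup>+x. (\<integral>\<^sup>+t. ennreal ((norm z)\<^sup>2 * ?G (t *\<^sub>R z + x)) * indicator {0..1} t \<partial>lborel) \<partial>lborel)"
    by (intro nn_integral_mono le)
  also have "\<dots> = (\<integral>\<^sup>+t. (\<integral>\<^sup>+x. ennreal ((norm z)\<^sup>2 * ?G (t *\<^sub>R z + x)) * indicator {0..1} t \<partial>lborel) \<partial>lborel)"
    by (rule lborel_pair.Fubini') measurable
  also have "\<dots> = (\<integral>\<^sup>+t. (ennreal ((norm z)\<^sup>2) * (\<integral>\<^sup>+x. ennreal (?G x) \<partial>lborel)) * indicator {0..1::real} t \<partial>lborel)"
    using nn_integral_translation[of "\<lambda>x. ennreal (?G x)"]
    by (intro nn_integral_cong) (simp add: nn_integral_multc nn_integral_cmult ennreal_mult')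
  also have "\<dots> = ennreal ((norm z)\<^sup>2) * (\<integral>\<^sup>+x. ennreal (?G x) \<partial>lborel)"
    by (simp add: nn_integral_cmult_indicator)
  finally show ?thesis .
qed

text \<open>The variance identity: on a cell it separates the mean of \<open>w\<close> from its oscillation.\<close>

lemma (in finite_measure) nn_integral_square_diff:
  fixes w :: "'a \<Rightarrow> real"
  assumes "L2 M w"
  defines "V \<equiv> 2 * measure M (space M) * (\<integral>x. (w x)\<^sup>2 \<partial>M) - 2 * (\<integral>x. w x \<partial>M)\<^sup>2"
  shows "(\<integral>\<^sup>+x. (\<integral>\<^sup>+y. ennreal ((w x - w y)\<^sup>2) \<partial>M) \<partial>M) = ennreal V" "V \<ge> 0"
proof -
  have i: "integrable M w" "integrable M (\<lambda>x. (w x)\<^sup>2)"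
    using assms L2_imp_integrable[OF assms(1)] by (auto simp: L2_def)
  let ?A = "measure M (space M)" and ?I = "\<integral>x. w x \<partial>M" and ?J = "\<integral>x. (w x)\<^sup>2 \<partial>M"
  have e: "(w x - w y)\<^sup>2 = (w x)\<^sup>2 - 2 * w x * w y + (w y)\<^sup>2" for x y
    by (simp add: power2_eq_square algebra_simps)
  have in_int: "integrable M (\<lambda>y. (w x - w y)\<^sup>2)" for x unfolding e using i by simp
  have inner: "(\<integral>y. (w x - w y)\<^sup>2 \<partial>M) = (w x)\<^sup>2 * ?A - 2 * w x * ?I + ?J" for x
    unfolding e using i by simp
  have "(\<integral>\<^sup>+x. (\<integral>\<^sup>+y. ennreal ((w x - w y)\<^sup>2) \<partial>M) \<partial>M)
      = (\<integral>\<^sup>+x. ennreal ((w x)\<^sup>2 * ?A - 2 * w x * ?I + ?J) \<partial>M)"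
    using in_int by (intro nn_integral_cong) (simp add: nn_integral_eq_integral inner)
  also have "\<dots> = ennreal (\<integral>x. (w x)\<^sup>2 * ?A - 2 * w x * ?I + ?J \<partial>M)"
  proof (rule nn_integral_eq_integral)
    show "integrable M (\<lambda>x. (w x)\<^sup>2 * ?A - 2 * w x * ?I + ?J)" using i by simp
    show "AE x in M. 0 \<le> (w x)\<^sup>2 * ?A - 2 * w x * ?I + ?J"
      unfolding inner[symmetric] by simp
  qed
  also have "(\<integral>x. (w x)\<^sup>2 * ?A - 2 * w x * ?I + ?J \<partial>M) = V"
    using i by (simp add: V_def power2_eq_square[of ?I] algebra_simps)
  finally show "(\<integral>\<^sup>+x. (\<integral>\<^sup>+y. ennreal ((w x - w y)\<^sup>2) \<partial>M) \<partial>M) = ennreal V" .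
  have "L2 M (\<lambda>x. 1 :: real)" by (simp add: L2_def)
  from L2_Cauchy_Schwarz[OF assms(1) this] show "V \<ge> 0" by (simp add: V_def mult.commute)
qed

section \<open>Compactness of bounded sequences of test functions\<close>

text \<open>The lattice point, in units of \<open>a\<close>, of the half-open cube of side \<open>a\<close> that contains \<open>x\<close>; the fibres of this map
are the cells.\<close>

definition cell :: "real \<Rightarrow> 'a::euclidean_space \<Rightarrow> 'a" where
  "cell a x = (\<Sum>i\<in>Basis. of_int \<lfloor>(x \<bullet> i) / a\<rfloor> *\<^sub>R i)"

lemma cell_inner: "i \<in> Basis \<Longrightarrow> cell a x \<bullet> i = of_int \<lfloor>(x \<bullet> i) / a\<rfloor>"
  unfolding cell_def by (simp add: inner_sum_left inner_Basis if_distrib cong: if_cong)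

lemma cell_measurable [measurable]: "cell a \<in> borel_measurable borel"
  unfolding cell_def[abs_def] by measurable

lemma cell_close:
  assumes "a > 0" "cell a x = cell a y" "i \<in> Basis"
  shows "\<bar>(y - x) \<bullet> i\<bar> \<le> a"
proof -
  have "\<lfloor>(x \<bullet> i) / a\<rfloor> = \<lfloor>(y \<bullet> i) / a\<rfloor>"
    using cell_inner[OF assms(3), of a x] cell_inner[OF assms(3), of a y] assms(2) by simp
  then have "\<bar>(y \<bullet> i) / a - (x \<bullet> i) / a\<bar> < 1" by linarith
  then have "\<bar>y \<bullet> i - x \<bullet> i\<bar> / a < 1" using assms(1) by (simp add: diff_divide_distrib[symmetric] abs_divide)
  then show ?thesis using assms(1) by (simp add: inner_diff_left)
qed

text \<open>A cell lies between an open and a closed box of the same volume.\<close>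

lemma emeasure_cell:
  assumes a: "a > 0"
  shows "emeasure lborel {x :: 'a::euclidean_space. cell a x = cell a y} = ennreal (a ^ DIM('a))"
proof -
  let ?Q = "{x :: 'a. cell a x = cell a y}"
  define l where "l = a *\<^sub>R cell a y"
  define u :: 'a where "u = l + a *\<^sub>R One"
  have u: "u \<bullet> i = l \<bullet> i + a" if "i \<in> Basis" for i using that by (simp add: u_def inner_add_left)
  have Q: "cell a x = cell a y \<longleftrightarrow> (\<forall>i\<in>Basis. l \<bullet> i \<le> x \<bullet> i \<and> x \<bullet> i < u \<bullet> i)" for x
  proof -
    have "cell a x = cell a y \<longleftrightarrow> (\<forall>i\<in>Basis. cell a x \<bullet> i = cell a y \<bullet> i)"
      by (simp add: euclidean_eq_iff[of "cell a x"])
    also have "\<dots> \<longleftrightarrow> (\<forall>i\<in>Basis. l \<bullet> i \<le> x \<bullet> i \<and> x \<bullet> i < u \<bullet> i)"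
    proof (intro ball_cong refl)
      fix i :: 'a assume i: "i \<in> Basis"
      let ?k = "\<lfloor>(y \<bullet> i) / a\<rfloor>"
      have "cell a x \<bullet> i = cell a y \<bullet> i \<longleftrightarrow> \<lfloor>(x \<bullet> i) / a\<rfloor> = ?k" using i by (simp add: cell_inner)
      also have "\<dots> \<longleftrightarrow> of_int ?k \<le> (x \<bullet> i) / a \<and> (x \<bullet> i) / a < of_int ?k + 1"
        by (rule floor_eq_iff)
      also have "\<dots> \<longleftrightarrow> l \<bullet> i \<le> x \<bullet> i \<and> x \<bullet> i < u \<bullet> i"
        using a i by (simp add: u l_def cell_inner field_simps)
      finally show "cell a x \<bullet> i = cell a y \<bullet> i \<longleftrightarrow> l \<bullet> i \<le> x \<bullet> i \<and> x \<bullet> i < u \<bullet> i" .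
    qed
    finally show ?thesis .
  qed
  have le: "l \<bullet> i \<le> u \<bullet> i" if "i \<in> Basis" for i using a u[OF that] by simp
  have p: "(\<Prod>b\<in>Basis. (u - l) \<bullet> b) = a ^ DIM('a)"
    by (simp add: inner_diff_left u)
  have m: "?Q \<in> sets lborel" by measurable
  show ?thesis
  proof (rule antisym)
    have "emeasure lborel ?Q \<le> emeasure lborel (cbox l u)"
      using m by (intro emeasure_mono) (auto simp: Q mem_box less_imp_le)
    then show "emeasure lborel ?Q \<le> ennreal (a ^ DIM('a))"
      by (simp add: emeasure_lborel_cbox[OF le] p)
    have "emeasure lborel (box l u) \<le> emeasure lborel ?Q"
      using m by (intro emeasure_mono) (auto simp: Q mem_box less_imp_le)
    then show "ennreal (a ^ DIM('a)) \<le> emeasure lborel ?Q"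
      by (simp add: emeasure_lborel_box[OF le] p)
  qed
qed

lemma finite_cells:
  assumes "bounded S" shows "finite (cell a ` S)"
proof -
  obtain R where R: "\<And>x. x \<in> S \<Longrightarrow> norm x \<le> R" using assms by (auto simp: bounded_iff)
  define N where "N = \<lceil>R / \<bar>a\<bar>\<rceil> + 1"
  let ?F = "\<lambda>f :: 'a \<Rightarrow> int. \<Sum>i\<in>Basis. of_int (f i) *\<^sub>R i"
  have "cell a x \<in> ?F ` (PiE Basis (\<lambda>_. {-N..N}))" if x: "x \<in> S" for x
  proof (rule image_eqI)
    show "cell a x = ?F (restrict (\<lambda>i. \<lfloor>(x \<bullet> i) / a\<rfloor>) Basis)" by (simp add: cell_def)
    have "\<lfloor>(x \<bullet> i) / a\<rfloor> \<in> {-N..N}" if "i \<in> Basis" for i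
    proof -
      define v where "v = (x \<bullet> i) / a"
      have "\<bar>v\<bar> \<le> R / \<bar>a\<bar>"
        using R[OF x] Basis_le_norm[OF that, of x] by (simp add: v_def abs_divide divide_right_mono)
      moreover have "R / \<bar>a\<bar> \<le> of_int N" unfolding N_def by (simp add: add_increasing2)
      ultimately have "of_int (- N) \<le> v" "v \<le> of_int N" by auto
      then show ?thesis unfolding v_def[symmetric]
        by (simp only: atLeastAtMost_iff le_floor_iff) (meson floor_mono floor_of_int order_trans of_int_le_iff of_int_floor_le)
    qed
    then show "restrict (\<lambda>i. \<lfloor>(x \<bullet> i) / a\<rfloor>) Basis \<in> PiE Basis (\<lambda>_. {-N..N})" by auto
  qed
  then have "cell a ` S \<subseteq> ?F ` (PiE Basis (\<lambda>_. {-N..N}))" by blast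
  then show ?thesis by (rule finite_subset) (intro finite_imageI finite_PiE; simp)
qed

text \<open>Substituting \<open>y = x + z\<close> reduces this to the translation estimate for each \<open>z\<close> in a cube of side
\<open>2 a\<close>.\<close>

lemma nn_integral_near_diagonal:
  fixes \<phi> :: "'a::euclidean_space \<Rightarrow> real" and a :: real
  assumes \<phi>: "test_function U \<phi>" and a: "a > 0"
  shows "(\<integral>\<^sup>+x. (\<integral>\<^sup>+y. indicator {z. \<forall>i\<in>Basis. \<bar>z \<bullet> i\<bar> \<le> a} (y - x) * ennreal ((\<phi> x - \<phi> y)\<^sup>2) \<partial>lborel) \<partial>lborel)
    \<le> ennreal (DIM('a) * a\<^sup>2 * (2 * a) ^ DIM('a)) * (\<integral>\<^sup>+x. ennreal ((norm (gradient \<phi> x))\<^sup>2) \<partial>lborel)"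
    (is "?L \<le> _ * ?G")
proof -
  have [measurable]: "\<phi> \<in> borel_measurable borel"
    by (rule borel_measurable_continuous_onI[OF test_function_continuous[OF \<phi>]])
  define Z where "Z = cbox (- a *\<^sub>R One) (a *\<^sub>R One :: 'a)"
  have Z: "{z. \<forall>i\<in>Basis. \<bar>z \<bullet> i\<bar> \<le> a} = Z" by (auto simp: Z_def mem_box abs_le_iff) force+
  have [measurable]: "Z \<in> sets borel" by (simp add: Z_def)
  have nz: "(norm z)\<^sup>2 \<le> DIM('a) * a\<^sup>2" if "z \<in> Z" for z
  proof -
    have "(norm z)\<^sup>2 = (\<Sum>i\<in>Basis. (z \<bullet> i)\<^sup>2)"
      unfolding power2_norm_eq_inner by (subst euclidean_inner) (simp add: power2_eq_square)
    also have "\<dots> \<le> (\<Sum>i\<in>(Basis::'a set). a\<^sup>2)"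
    proof (rule sum_mono)
      fix i :: 'a assume "i \<in> Basis"
      then have "\<bar>z \<bullet> i\<bar> \<le> \<bar>a\<bar>" using that a unfolding Z[symmetric] by auto
      then show "(z \<bullet> i)\<^sup>2 \<le> a\<^sup>2" by (simp add: abs_le_square_iff)
    qed
    finally show ?thesis by simp
  qed
  have "?L = (\<integral>\<^sup>+x. (\<integral>\<^sup>+z. indicator Z z * ennreal ((\<phi> x - \<phi> (x + z))\<^sup>2) \<partial>lborel) \<partial>lborel)"
    unfolding Z
  proof (rule nn_integral_cong)
    fix x
    have "(\<integral>\<^sup>+y. indicator Z (y - x) * ennreal ((\<phi> x - \<phi> y)\<^sup>2) \<partial>lborel)
        = (\<integral>\<^sup>+z. indicator Z ((x + z) - x) * ennreal ((\<phi> x - \<phi> (x + z))\<^sup>2) \<partial>lborel)"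
      by (rule nn_integral_translation[symmetric]) measurable
    then show "(\<integral>\<^sup>+y. indicator Z (y - x) * ennreal ((\<phi> x - \<phi> y)\<^sup>2) \<partial>lborel)
        = (\<integral>\<^sup>+z. indicator Z z * ennreal ((\<phi> x - \<phi> (x + z))\<^sup>2) \<partial>lborel)" by simp
  qed
  also have "\<dots> = (\<integral>\<^sup>+z. (\<integral>\<^sup>+x. indicator Z z * ennreal ((\<phi> x - \<phi> (x + z))\<^sup>2) \<partial>lborel) \<partial>lborel)"
    by (rule lborel_pair.Fubini') measurable
  also have "\<dots> \<le> (\<integral>\<^sup>+z. ennreal (DIM('a) * a\<^sup>2) * ?G * indicator Z z \<partial>lborel)"
  proof (rule nn_integral_mono)
    fix z :: 'a
    have "(\<integral>\<^sup>+x. indicator Z z * ennreal ((\<phi> x - \<phi> (x + z))\<^sup>2) \<partial>lborel)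
        = indicator Z z * (\<integral>\<^sup>+x. ennreal ((\<phi> (x + z) - \<phi> x)\<^sup>2) \<partial>lborel)"
      by (subst nn_integral_cmult[symmetric]) (simp_all add: power2_commute)
    also have "\<dots> \<le> indicator Z z * (ennreal ((norm z)\<^sup>2) * ?G)"
      by (intro mult_left_mono translation_estimate[OF \<phi>]) simp
    also have "\<dots> \<le> ennreal (DIM('a) * a\<^sup>2) * ?G * indicator Z z"
      using nz[of z] by (auto simp: indicator_def intro!: mult_right_mono ennreal_leI)
    finally show "(\<integral>\<^sup>+x. indicator Z z * ennreal ((\<phi> x - \<phi> (x + z))\<^sup>2) \<partial>lborel)
        \<le> ennreal (DIM('a) * a\<^sup>2) * ?G * indicator Z z" .
  qed
  also have "\<dots> = ennreal (DIM('a) * a\<^sup>2) * ?G * emeasure lborel Z"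
    by (simp add: nn_integral_cmult_indicator)
  also have "emeasure lborel Z = ennreal ((2 * a) ^ DIM('a))"
  proof -
    have "(\<Prod>b\<in>Basis. (a *\<^sub>R One - (- a *\<^sub>R One :: 'a)) \<bullet> b) = (\<Prod>b\<in>(Basis :: 'a set). 2 * a)"
      by (intro prod.cong) (auto simp: inner_add_left)
    then show ?thesis unfolding Z_def using a by (subst emeasure_lborel_cbox) auto
  qed
  also have "ennreal (DIM('a) * a\<^sup>2) * ?G * ennreal ((2 * a) ^ DIM('a))
      = ennreal (DIM('a) * a\<^sup>2 * (2 * a) ^ DIM('a)) * ?G"
    using a by (subst ennreal_mult) (auto simp: mult_ac)
  finally show ?thesis .
qed

lemma test_function_integrable_square:
  "test_function U \<phi> \<Longrightarrow> integrable lborel (\<lambda>x. (\<phi> x)\<^sup>2)"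
  "test_function U \<phi> \<Longrightarrow> integrable lborel (\<lambda>x. (norm (gradient \<phi> x))\<^sup>2)"
  "test_function U \<phi> \<Longrightarrow> integrable lborel \<phi>"
proof -
  assume \<phi>: "test_function U \<phi>"
  obtain K where K: "compact K" "K \<subseteq> U" "\<And>x. x \<notin> K \<Longrightarrow> \<phi> x = 0"
    using \<phi> by (rule test_functionE) blast
  show "integrable lborel (\<lambda>x. (\<phi> x)\<^sup>2)"
    by (rule compact_support_integrable[OF _ K(1)])
      (auto intro!: continuous_intros test_function_continuous[OF \<phi>] simp: K)
  show "integrable lborel \<phi>"
    by (rule compact_support_integrable[OF test_function_continuous[OF \<phi>] K(1,3)])
  show "integrable lborel (\<lambda>x. (norm (gradient \<phi> x))\<^sup>2)"
    by (rule compact_support_integrable[OF _ K(1)])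
      (auto intro!: continuous_intros test_function_continuous_gradient[OF \<phi>]
        simp: gradient_0_outside[OF compact_imp_closed[OF K(1)] K(3)])
qed

text \<open>A Poincare inequality on all cells at once: two points of one cell differ by a vector with coordinates
at most \<open>a\<close>, so the oscillations on the cells are controlled by the integral near the diagonal. Up to an
error \<open>O(a\<^sup>2)\<close> times the energy, finitely many linear functionals determine the \<open>L\<^sup>2\<close> norm.\<close>

lemma cell_inequality:
  fixes \<phi> :: "'a::euclidean_space \<Rightarrow> real" and a :: real
  assumes \<phi>: "test_function U \<phi>" and U: "bounded U" and a: "a > 0"
  defines "Q \<equiv> \<lambda>k. {x :: 'a. cell a x = k}"
  shows "(\<integral>x. (\<phi> x)\<^sup>2 \<partial>lborel) \<le> (\<Sum>k\<in>cell a ` U. (\<integral>x. indicator (Q k) x * \<phi> x \<partial>lborel)\<^sup>2) / a ^ DIM('a)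
    + DIM('a) * 2 ^ DIM('a) * a\<^sup>2 * (\<integral>x. (norm (gradient \<phi> x))\<^sup>2 \<partial>lborel)"
proof -
  let ?d = "DIM('a)" and ?K = "cell a ` U" and ?G = "\<integral>x. (norm (gradient \<phi> x))\<^sup>2 \<partial>lborel"
  have meas [measurable]: "\<phi> \<in> borel_measurable borel"
    by (rule borel_measurable_continuous_onI[OF test_function_continuous[OF \<phi>]])
  have Qm [measurable]: "Q k \<in> sets borel" for k unfolding Q_def by measurable
  have fin: "finite ?K" by (rule finite_cells[OF U])
  note int = test_function_integrable_square[OF \<phi>]
  define V where "V k = 2 * a ^ ?d * (\<integral>x. indicator (Q k) x * (\<phi> x)\<^sup>2 \<partial>lborel)
      - 2 * (\<integral>x. indicator (Q k) x * \<phi> x \<partial>lborel)\<^sup>2" for k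
  have V: "(\<integral>\<^sup>+x. (\<integral>\<^sup>+y. indicator (Q k) x * indicator (Q k) y * ennreal ((\<phi> x - \<phi> y)\<^sup>2) \<partial>lborel) \<partial>lborel) = ennreal (V k)"
    "V k \<ge> 0" if k: "k \<in> ?K" for k
  proof -
    let ?M = "restrict_space lborel (Q k)"
    have em: "emeasure lborel (Q k) = ennreal (a ^ ?d)"
      using k emeasure_cell[OF a] unfolding Q_def by auto
    have sp: "space ?M = Q k" by (simp add: space_restrict_space)
    interpret finite_measure ?M
      by (rule finite_measureI) (simp add: sp emeasure_restrict_space em)
    have ms: "measure ?M (space ?M) = a ^ ?d"
      using a by (simp add: sp measure_def[of ?M] emeasure_restrict_space em)
    have L2: "L2 ?M \<phi>"
      using integrable_mult_indicator[OF _ int(1), of "Q k"]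
      by (auto simp: L2_def integrable_restrict_space intro!: measurable_restrict_space1)
    have I: "(\<integral>x. f x \<partial>?M) = (\<integral>x. indicator (Q k) x * f x \<partial>lborel)" for f :: "'a \<Rightarrow> real"
      by (simp add: integral_restrict_space)
    have "(\<integral>\<^sup>+x. (\<integral>\<^sup>+y. ennreal ((\<phi> x - \<phi> y)\<^sup>2) \<partial>?M) \<partial>?M)
       = (\<integral>\<^sup>+x. (\<integral>\<^sup>+y. indicator (Q k) x * indicator (Q k) y * ennreal ((\<phi> x - \<phi> y)\<^sup>2) \<partial>lborel) \<partial>lborel)"
      unfolding nn_integral_restrict_space[of "Q k" lborel, simplified]
      by (subst nn_integral_multc[symmetric]) (auto intro!: nn_integral_cong simp: mult_ac)
    with nn_integral_square_diff[OF L2] show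
      "(\<integral>\<^sup>+x. (\<integral>\<^sup>+y. indicator (Q k) x * indicator (Q k) y * ennreal ((\<phi> x - \<phi> y)\<^sup>2) \<partial>lborel) \<partial>lborel) = ennreal (V k)"
      "V k \<ge> 0"
      unfolding ms I V_def by simp_all
  qed
  have "ennreal (\<Sum>k\<in>?K. V k) = (\<Sum>k\<in>?K. \<integral>\<^sup>+x. (\<integral>\<^sup>+y. indicator (Q k) x * indicator (Q k) y * ennreal ((\<phi> x - \<phi> y)\<^sup>2) \<partial>lborel) \<partial>lborel)"
    by (subst sum_ennreal[OF V(2), symmetric], assumption) (intro sum.cong refl V(1)[symmetric])
  also have "\<dots> = (\<integral>\<^sup>+x. (\<integral>\<^sup>+y. (\<Sum>k\<in>?K. indicator (Q k) x * indicator (Q k) y * ennreal ((\<phi> x - \<phi> y)\<^sup>2)) \<partial>lborel) \<partial>lborel)"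
    by (subst nn_integral_sum[symmetric], measurable) (intro nn_integral_cong nn_integral_sum[symmetric], measurable)
  also have "\<dots> \<le> (\<integral>\<^sup>+x. (\<integral>\<^sup>+y. indicator {z. \<forall>i\<in>Basis. \<bar>z \<bullet> i\<bar> \<le> a} (y - x) * ennreal ((\<phi> x - \<phi> y)\<^sup>2) \<partial>lborel) \<partial>lborel)"
  proof (intro nn_integral_mono)
    fix x y :: 'a
    have "(\<Sum>k\<in>?K. indicator (Q k) x * indicator (Q k) y) \<le> (indicator {z. \<forall>i\<in>Basis. \<bar>z \<bullet> i\<bar> \<le> a} (y - x) :: ennreal)"
    proof (cases "cell a x = cell a y")
      case True
      have "(\<Sum>k\<in>?K. indicator (Q k) x * indicator (Q k) y :: ennreal) \<le> (\<Sum>k\<in>?K. if cell a x = k then 1 else 0)"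
        by (intro sum_mono) (auto simp: Q_def indicator_def)
      also have "\<dots> \<le> 1" using fin by (simp add: sum.delta)
      finally show ?thesis using cell_close[OF a True] by (simp add: indicator_def)
    next
      case False
      then have "(\<Sum>k\<in>?K. indicator (Q k) x * indicator (Q k) y :: ennreal) = 0"
        by (intro sum.neutral) (auto simp: Q_def indicator_def)
      then show ?thesis by simp
    qed
    then show "(\<Sum>k\<in>?K. indicator (Q k) x * indicator (Q k) y * ennreal ((\<phi> x - \<phi> y)\<^sup>2))
        \<le> indicator {z. \<forall>i\<in>Basis. \<bar>z \<bullet> i\<bar> \<le> a} (y - x) * ennreal ((\<phi> x - \<phi> y)\<^sup>2)"
      unfolding sum_distrib_right[symmetric] by (intro mult_right_mono) auto
  qed
  also have "\<dots> \<le> ennreal (?d * a\<^sup>2 * (2 * a) ^ ?d) * (\<integral>\<^sup>+x. ennreal ((norm (gradient \<phi> x))\<^sup>2) \<partial>lborel)"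
    by (rule nn_integral_near_diagonal[OF \<phi> a])
  also have "\<dots> = ennreal (?d * a\<^sup>2 * (2 * a) ^ ?d * ?G)"
    using int(2) a by (subst nn_integral_eq_integral) (auto simp: ennreal_mult)
  finally have "(\<Sum>k\<in>?K. V k) \<le> ?d * a\<^sup>2 * (2 * a) ^ ?d * ?G"
    using a by (subst (asm) ennreal_le_iff) (auto intro!: mult_nonneg_nonneg)
  moreover have "(\<Sum>k\<in>?K. V k) = 2 * a ^ ?d * (\<integral>x. (\<phi> x)\<^sup>2 \<partial>lborel)
      - 2 * (\<Sum>k\<in>?K. (\<integral>x. indicator (Q k) x * \<phi> x \<partial>lborel)\<^sup>2)"
  proof -
    have "(\<phi> x)\<^sup>2 = (\<Sum>k\<in>?K. indicator (Q k) x * (\<phi> x)\<^sup>2)" for x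
    proof (cases "x \<in> U")
      case True
      have "(\<Sum>k\<in>?K. indicator (Q k) x * (\<phi> x)\<^sup>2) = (\<Sum>k\<in>?K. if cell a x = k then (\<phi> x)\<^sup>2 else 0)"
        by (intro sum.cong) (auto simp: Q_def indicator_def)
      then show ?thesis using True fin by (simp add: sum.delta)
    next
      case False
      then show ?thesis using test_function_0[OF \<phi>] by simp
    qed
    then have "(\<integral>x. (\<phi> x)\<^sup>2 \<partial>lborel) = (\<integral>x. (\<Sum>k\<in>?K. indicator (Q k) x * (\<phi> x)\<^sup>2) \<partial>lborel)" by simp
    also have "\<dots> = (\<Sum>k\<in>?K. \<integral>x. indicator (Q k) x * (\<phi> x)\<^sup>2 \<partial>lborel)"
      using integrable_mult_indicator[OF _ int(1)] by (intro Bochner_Integration.integral_sum) simp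
    finally show ?thesis by (simp add: V_def sum_subtractf sum_distrib_left)
  qed
  ultimately have "2 * a ^ ?d * (\<integral>x. (\<phi> x)\<^sup>2 \<partial>lborel)
      \<le> 2 * (\<Sum>k\<in>?K. (\<integral>x. indicator (Q k) x * \<phi> x \<partial>lborel)\<^sup>2) + ?d * a\<^sup>2 * (2 * a) ^ ?d * ?G"
    by simp
  also have "\<dots> \<le> 2 * (\<Sum>k\<in>?K. (\<integral>x. indicator (Q k) x * \<phi> x \<partial>lborel)\<^sup>2) + 2 * (?d * a\<^sup>2 * (2 * a) ^ ?d * ?G)"
    using a by simp
  finally have "a ^ ?d * (\<integral>x. (\<phi> x)\<^sup>2 \<partial>lborel)
      \<le> (\<Sum>k\<in>?K. (\<integral>x. indicator (Q k) x * \<phi> x \<partial>lborel)\<^sup>2) + a ^ ?d * (?d * 2 ^ ?d * a\<^sup>2 * ?G)"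
    by (simp add: power_mult_distrib mult_ac)
  then show ?thesis using a by (simp add: field_simps)
qed

lemma norm_diff_squared_le: "(norm (x - y))\<^sup>2 \<le> 2 * (norm x)\<^sup>2 + 2 * (norm (y :: 'a::real_inner))\<^sup>2"
proof -
  have "(norm (x - y))\<^sup>2 + (norm (x + y))\<^sup>2 = 2 * (norm x)\<^sup>2 + 2 * (norm y)\<^sup>2"
    by (simp add: norm_diff_squared norm_add_squared)
  then show ?thesis using zero_le_power2[of "norm (x + y)"] by linarith
qed

lemma test_function_diff: "test_function U \<phi> \<Longrightarrow> test_function U \<psi> \<Longrightarrow> test_function U (\<lambda>x. \<phi> x - \<psi> x)"
  using test_function_lincomb[of U \<phi> \<psi> 1 "-1"] by simp

lemma gradient_diff:
  "test_function U \<phi> \<Longrightarrow> test_function U \<psi> \<Longrightarrow> gradient (\<lambda>x. \<phi> x - \<psi> x) x = gradient \<phi> x - gradient \<psi> x"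
  using gradient_lincomb[of \<phi> x \<psi> 1 "-1"] test_function_differentiable by fastforce

lemma test_function_L1_bound:
  assumes \<phi>: "test_function (U :: 'a::euclidean_space set) \<phi>" and R: "U \<subseteq> cball 0 R"
  shows "(\<integral>x. \<bar>\<phi> x\<bar> \<partial>lborel) \<le> measure lborel (cball 0 R :: 'a set) + (\<integral>x. (\<phi> x)\<^sup>2 \<partial>lborel)"
proof -
  note int = test_function_integrable_square[OF \<phi>]
  have i: "integrable lborel (\<lambda>x. indicator (cball 0 R :: 'a set) x :: real)"
    using emeasure_bounded_finite[of "cball (0::'a) R"] by (simp add: integrable_indicator_iff)
  have "(\<integral>x. \<bar>\<phi> x\<bar> \<partial>lborel) \<le> (\<integral>x. indicator (cball 0 R) x + (\<phi> x)\<^sup>2 \<partial>lborel)"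
  proof (rule integral_mono)
    show "\<bar>\<phi> x\<bar> \<le> indicator (cball 0 R) x + (\<phi> x)\<^sup>2" for x
    proof (cases "x \<in> U")
      case True
      then show ?thesis using R le_add_square_divide[of 1 "\<bar>\<phi> x\<bar>"] by (auto simp: indicator_def)
    next
      case False
      then show ?thesis using test_function_0[OF \<phi>] by simp
    qed
  qed (use int i in auto)
  then show ?thesis using int i by simp
qed

text \<open>The integrals over the countably many cells of side \<open>2\<^sup>-\<^sup>j\<close> are uniformly bounded, so along a
subsequence all of them converge. For a difference of two members the cell inequality then has a small
mean part (finitely many cells of a fixed scale) and a small gradient part (fine scale).\<close>

theorem rellich:
  fixes \<phi> :: "nat \<Rightarrow> 'a::euclidean_space \<Rightarrow> real"
  assumes \<phi>: "\<And>n. test_function U (\<phi> n)" and U: "bounded U"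
    and A: "\<And>n. (\<integral>x. (\<phi> n x)\<^sup>2 \<partial>lborel) \<le> A" "\<And>n. (\<integral>x. (norm (gradient (\<phi> n) x))\<^sup>2 \<partial>lborel) \<le> A"
  obtains r :: "nat \<Rightarrow> nat" where "strict_mono r"
    "\<And>e. e > 0 \<Longrightarrow> \<exists>N. \<forall>i\<ge>N. \<forall>j\<ge>N. (\<integral>x. (\<phi> (r i) x - \<phi> (r j) x)\<^sup>2 \<partial>lborel) < e"
proof -
  let ?d = "DIM('a)"
  \<comment> \<open>dyadic sides, indexed by \<open>j\<close>; a pair \<open>(j, k)\<close> in \<open>S\<close> denotes a cell of side \<open>s j\<close> that meets \<open>U\<close>\<close>
  define s where "s j = (1 / 2 :: real) ^ j" for j :: nat
  define Q where "Q j k = {x :: 'a. cell (s j) x = k}" for j k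
  define S where "S = (SIGMA j:UNIV. cell (s j) ` U)"
  define f where "f n = (\<lambda>(j, k). \<integral>x. indicator (Q j k) x * \<phi> n x \<partial>lborel)" for n
  note int = test_function_integrable_square[OF \<phi>]
  have Qm [measurable]: "Q j k \<in> sets borel" for j k unfolding Q_def by measurable
  have intQ: "integrable lborel (\<lambda>x. indicator (Q j k) x * \<phi> n x)" for j k n
    using integrable_mult_indicator[OF _ int(3)[of n], of "Q j k"] by simp
  have cS: "countable S"
    unfolding S_def by (intro countable_SIGMA) (auto intro: countable_finite finite_cells[OF U])
  obtain R where R: "U \<subseteq> cball 0 R" using U by (auto simp: bounded_iff subset_iff)
  have bound: "norm (f n p) \<le> measure lborel (cball 0 R :: 'a set) + A" for n p
  proof -
    obtain j k where p: "p = (j, k)" by (cases p)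
    have "norm (f n p) \<le> (\<integral>x. norm (indicator (Q j k) x * \<phi> n x) \<partial>lborel)"
      unfolding f_def p by simp
    also have "\<dots> \<le> (\<integral>x. \<bar>\<phi> n x\<bar> \<partial>lborel)"
      using intQ[of j k n] int(3)[of n] by (intro integral_mono) (auto simp: indicator_def)
    also have "\<dots> \<le> measure lborel (cball 0 R :: 'a set) + A"
      using test_function_L1_bound[OF \<phi> R, of n] A(1)[of n] by linarith
    finally show ?thesis .
  qed
  obtain r :: "nat \<Rightarrow> nat" where r: "strict_mono r"
    and conv: "\<And>p. p \<in> S \<Longrightarrow> \<exists>l. (\<lambda>n. f (r n) p) \<longlonglongrightarrow> l"
    by (rule function_convergent_subsequence[of S f, OF cS bound]) blast
  have "\<exists>N. \<forall>i\<ge>N. \<forall>j\<ge>N. (\<integral>x. (\<phi> (r i) x - \<phi> (r j) x)\<^sup>2 \<partial>lborel) < e" if e: "e > 0" for e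
  proof -
    \<comment> \<open>the constant of the gradient part: a difference of two members has energy at most \<open>4 A\<close>\<close>
    let ?C = "?d * 2 ^ ?d * (4 * A)"
    have "(\<lambda>j. ?C * (s j * s j)) \<longlonglongrightarrow> ?C * (0 * 0)"
      unfolding s_def by (intro tendsto_intros LIMSEQ_power_zero) auto
    then have "\<forall>\<^sub>F j in sequentially. ?C * (s j * s j) < e / 2"
      by (rule order_tendstoD) (use e in simp)
    then obtain j where j: "?C * (s j * s j) < e / 2" by (auto simp: eventually_sequentially)
    define a where "a = s j"
    have a: "a > 0" by (simp add: a_def s_def)
    let ?K = "cell a ` U"
    have fin: "finite ?K" by (rule finite_cells[OF U])
    \<comment> \<open>small enough for the sum over the cells of side \<open>a\<close>, divided by the cell volume, to stay below \<open>e / 2\<close>\<close>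
    define \<delta> where "\<delta> = e * a ^ ?d / (2 * (card ?K + 1))"
    have \<delta>: "\<delta> > 0" using e a by (simp add: \<delta>_def)
    have "\<forall>k\<in>?K. \<forall>\<^sub>F N in sequentially. \<forall>m\<ge>N. \<forall>n\<ge>N. (f (r m) (j, k) - f (r n) (j, k))\<^sup>2 < \<delta>"
    proof
      fix k assume "k \<in> ?K"
      then have "(j, k) \<in> S" by (auto simp: S_def a_def)
      then have "Cauchy (\<lambda>n. f (r n) (j, k))" using conv LIMSEQ_imp_Cauchy by blast
      then obtain N where N: "\<And>m n. m \<ge> N \<Longrightarrow> n \<ge> N \<Longrightarrow> norm (f (r m) (j, k) - f (r n) (j, k)) < sqrt \<delta>"
        using \<delta> unfolding Cauchy_iff by (meson real_sqrt_gt_zero)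
      have "(f (r m) (j, k) - f (r n) (j, k))\<^sup>2 < \<delta>" if "m \<ge> N" "n \<ge> N" for m n
        using N[OF that] by (simp add: real_sqrt_less_iff flip: real_sqrt_abs)
      then show "\<forall>\<^sub>F N in sequentially. \<forall>m\<ge>N. \<forall>n\<ge>N. (f (r m) (j, k) - f (r n) (j, k))\<^sup>2 < \<delta>"
        unfolding eventually_sequentially by (meson order_trans)
    qed
    then have "\<forall>\<^sub>F N in sequentially. \<forall>k\<in>?K. \<forall>m\<ge>N. \<forall>n\<ge>N. (f (r m) (j, k) - f (r n) (j, k))\<^sup>2 < \<delta>"
      by (rule eventually_ball_finite[OF fin])
    then obtain N where N: "\<And>k m n. k \<in> ?K \<Longrightarrow> m \<ge> N \<Longrightarrow> n \<ge> N \<Longrightarrow> (f (r m) (j, k) - f (r n) (j, k))\<^sup>2 < \<delta>"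
      using eventually_happens'[OF sequentially_bot] by blast
    have "(\<integral>x. (\<phi> (r m) x - \<phi> (r n) x)\<^sup>2 \<partial>lborel) < e" if mn: "m \<ge> N" "n \<ge> N" for m n
    proof -
      let ?w = "\<lambda>x. \<phi> (r m) x - \<phi> (r n) x"
      have w: "test_function U ?w" by (rule test_function_diff[OF \<phi> \<phi>])
      have "(\<integral>x. (norm (gradient ?w x))\<^sup>2 \<partial>lborel)
          \<le> (\<integral>x. 2 * (norm (gradient (\<phi> (r m)) x))\<^sup>2 + 2 * (norm (gradient (\<phi> (r n)) x))\<^sup>2 \<partial>lborel)"
        by (intro integral_mono test_function_integrable_square(2)[OF w] Bochner_Integration.integrable_add
            integrable_mult_right int(2)) (simp add: gradient_diff[OF \<phi> \<phi>] norm_diff_squared_le)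
      also have "\<dots> \<le> 4 * A" using int(2) A(2)[of "r m"] A(2)[of "r n"] by simp
      finally have grad: "(\<integral>x. (norm (gradient ?w x))\<^sup>2 \<partial>lborel) \<le> 4 * A" .
      have fw: "(\<integral>x. indicator {x. cell a x = k} x * ?w x \<partial>lborel) = f (r m) (j, k) - f (r n) (j, k)" for k
      proof -
        have "(\<integral>x. indicator {x. cell a x = k} x * ?w x \<partial>lborel)
            = (\<integral>x. indicator (Q j k) x * \<phi> (r m) x - indicator (Q j k) x * \<phi> (r n) x \<partial>lborel)"
          by (simp add: Q_def a_def right_diff_distrib)
        then show ?thesis using intQ by (simp add: f_def)
      qed
      have "(\<integral>x. (?w x)\<^sup>2 \<partial>lborel)
          \<le> (\<Sum>k\<in>?K. (f (r m) (j, k) - f (r n) (j, k))\<^sup>2) / a ^ ?d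
            + ?d * 2 ^ ?d * a\<^sup>2 * (\<integral>x. (norm (gradient ?w x))\<^sup>2 \<partial>lborel)"
        using cell_inequality[OF w U a] unfolding fw .
      also have "\<dots> \<le> (\<Sum>k\<in>?K. \<delta>) / a ^ ?d + ?d * 2 ^ ?d * a\<^sup>2 * (4 * A)"
        using a grad N mn by (intro add_mono divide_right_mono sum_mono mult_left_mono) (auto intro: less_imp_le)
      also have "(\<Sum>k\<in>?K. \<delta>) / a ^ ?d \<le> e / 2"
      proof -
        have "(\<Sum>k\<in>?K. \<delta>) / a ^ ?d = e / 2 * (real (card ?K) / (real (card ?K) + 1))"
          using a by (simp add: \<delta>_def ac_simps)
        also have "\<dots> \<le> e / 2 * 1" using e by (intro mult_left_mono) auto
        finally show ?thesis by simp
      qed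
      also have "?d * 2 ^ ?d * a\<^sup>2 * (4 * A) < e / 2"
        using j by (simp add: a_def power2_eq_square mult_ac)
      finally show ?thesis by simp
    qed
    then show ?thesis by blast
  qed
  with r show ?thesis by (rule that)
qed

section \<open>The Dirichlet form on test functions\<close>

text \<open>The general \<open>L\<^sup>2\<close> lemmas apply to this measure, to which the set integrals in the definition of the
Sobolev spaces are translated once and for all.\<close>

abbreviation lebesgue_in :: "'a::euclidean_space set \<Rightarrow> 'a measure" where
  "lebesgue_in U \<equiv> restrict_space lborel U"

lemma L2_on_iff: "open U \<Longrightarrow> L2_on U f \<longleftrightarrow> L2 (lebesgue_in U) f"
  unfolding L2_on_def L2_def set_borel_measurable_def set_integrable_def
  by (simp add: borel_measurable_restrict_space_iff integrable_restrict_space)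

lemma set_integral_eq:
  fixes f :: "'a::euclidean_space \<Rightarrow> real"
  shows "open U \<Longrightarrow> (LINT x:U|lborel. f x) = (\<integral>x. f x \<partial>lebesgue_in U)"
  unfolding set_lebesgue_integral_def by (simp add: integral_restrict_space)

lemma integral_lebesgue_in_eq:
  fixes f :: "'a::euclidean_space \<Rightarrow> real"
  assumes "open U" "\<And>x. x \<notin> U \<Longrightarrow> f x = 0"
  shows "(\<integral>x. f x \<partial>lebesgue_in U) = (\<integral>x. f x \<partial>lborel)"
proof -
  have "(\<lambda>x. indicator U x *\<^sub>R f x) = f" using assms(2) by (auto simp: fun_eq_iff indicator_def)
  then show ?thesis using assms(1) by (simp add: integral_restrict_space)
qed

lemma finite_measure_lebesgue_in:
  assumes "open U" "bounded U" shows "finite_measure (lebesgue_in U)"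
proof (rule finite_measureI)
  have "emeasure lborel U < \<infinity>" using assms(2) by (rule emeasure_bounded_finite)
  then show "emeasure (lebesgue_in U) (space (lebesgue_in U)) \<noteq> \<infinity>"
    using assms(1) by (simp add: space_restrict_space emeasure_restrict_space)
qed

lemma AE_lebesgue_in: "open U \<Longrightarrow> (AE x in lebesgue_in U. P x) \<longleftrightarrow> (AE x\<in>U in lborel. P x)"
  by (simp add: AE_restrict_space_iff)

lemma test_function_L2:
  assumes "open U" "test_function V \<phi>"
  shows "L2 (lebesgue_in U) \<phi>" "L2 (lebesgue_in U) (gradient \<phi>)"
proof -
  have 1: "\<phi> \<in> borel_measurable (lebesgue_in U)"
    using borel_measurable_continuous_onI[OF test_function_continuous[OF assms(2)]]
    by (simp add: measurable_restrict_space1)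
  have 2: "gradient \<phi> \<in> borel_measurable (lebesgue_in U)"
    using borel_measurable_continuous_onI[OF test_function_continuous_gradient[OF assms(2)]]
    by (simp add: measurable_restrict_space1)
  have 3: "integrable (lebesgue_in U) (\<lambda>x. (\<phi> x)\<^sup>2)" "integrable (lebesgue_in U) (\<lambda>x. (norm (gradient \<phi> x))\<^sup>2)"
    using integrable_mult_indicator[OF _ test_function_integrable_square(1)[OF assms(2)], of U]
      integrable_mult_indicator[OF _ test_function_integrable_square(2)[OF assms(2)], of U] assms(1)
    by (simp_all add: integrable_restrict_space)
  from 1 2 3 show "L2 (lebesgue_in U) \<phi>" "L2 (lebesgue_in U) (gradient \<phi>)" by (simp_all add: L2_def)
qed

definition dirichlet_energy :: "('a::euclidean_space \<Rightarrow> real) \<Rightarrow> real" where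
  "dirichlet_energy \<phi> = (\<integral>x. (norm (gradient \<phi> x))\<^sup>2 \<partial>lborel)"

definition mass :: "('a::euclidean_space \<Rightarrow> real) \<Rightarrow> real" where
  "mass \<phi> = (\<integral>x. (\<phi> x)\<^sup>2 \<partial>lborel)"

lemma dirichlet_energy_nonneg: "dirichlet_energy \<phi> \<ge> 0" and mass_nonneg: "mass \<phi> \<ge> 0"
  by (simp_all add: dirichlet_energy_def mass_def)

lemma mass_eq: "open U \<Longrightarrow> test_function U \<phi> \<Longrightarrow> (\<integral>x. (norm (\<phi> x))\<^sup>2 \<partial>lebesgue_in U) = mass \<phi>"
  unfolding mass_def by (subst integral_lebesgue_in_eq) (auto simp: test_function_0)

lemma dirichlet_energy_eq: "open U \<Longrightarrow> test_function U \<phi> \<Longrightarrow> (\<integral>x. (norm (gradient \<phi> x))\<^sup>2 \<partial>lebesgue_in U) = dirichlet_energy \<phi>"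
  unfolding dirichlet_energy_def by (subst integral_lebesgue_in_eq) (auto simp: test_function_gradient_0)

lemma integral_square_eq_0_iff:
  assumes "L2 M f" shows "(\<integral>x. (norm (f x))\<^sup>2 \<partial>M) = 0 \<longleftrightarrow> (AE x in M. f x = 0)"
  using integral_nonneg_eq_0_iff_AE[OF L2_integrable[OF assms]] by simp

text \<open>Splits the \<open>H\<^sup>1\<close> convergence into its two parts, each squeezed by their sum.\<close>

lemma H10_approx:
  assumes "open U" "H10 U u G"
  obtains \<phi> where "\<And>n. test_function U (\<phi> n)"
    "(\<lambda>n. \<integral>x. (norm (\<phi> n x - u x))\<^sup>2 \<partial>lebesgue_in U) \<longlonglongrightarrow> 0"
    "(\<lambda>n. \<integral>x. (norm (gradient (\<phi> n) x - G x))\<^sup>2 \<partial>lebesgue_in U) \<longlonglongrightarrow> 0"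
    "L2 (lebesgue_in U) u" "L2 (lebesgue_in U) G"
proof -
  obtain \<phi> where \<phi>: "\<And>n. test_function U (\<phi> n)"
    and lim: "(\<lambda>n. (LINT x:U|lborel. (u x - \<phi> n x)\<^sup>2)
            + (LINT x:U|lborel. (norm (G x - gradient (\<phi> n) x))\<^sup>2)) \<longlonglongrightarrow> 0"
    using assms(2) unfolding H10_def by blast
  let ?a = "\<lambda>n. \<integral>x. (norm (\<phi> n x - u x))\<^sup>2 \<partial>lebesgue_in U"
  let ?b = "\<lambda>n. \<integral>x. (norm (gradient (\<phi> n) x - G x))\<^sup>2 \<partial>lebesgue_in U"
  have lim': "(\<lambda>n. ?a n + ?b n) \<longlonglongrightarrow> 0"
    using lim by (simp add: set_integral_eq[OF assms(1)] norm_minus_commute power2_commute)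
  have "?a \<longlonglongrightarrow> 0" by (rule tendsto_sandwich[OF _ _ tendsto_const lim']) auto
  moreover have "?b \<longlonglongrightarrow> 0" by (rule tendsto_sandwich[OF _ _ tendsto_const lim']) auto
  moreover have "L2 (lebesgue_in U) u" "L2 (lebesgue_in U) G"
    using assms by (auto simp: H10_def H1_def L2_on_iff)
  ultimately show ?thesis using that \<phi> by blast
qed

text \<open>Closedness of the gradient: both sides of the integration by parts formula are continuous in
\<open>L\<^sup>2\<close>.\<close>

lemma H10_limit:
  assumes U: "open U" and \<phi>: "\<And>n. test_function U (\<phi> n)"
    and u: "L2 (lebesgue_in U) u" "(\<lambda>n. \<integral>x. (norm (\<phi> n x - u x))\<^sup>2 \<partial>lebesgue_in U) \<longlonglongrightarrow> 0"
    and G: "L2 (lebesgue_in U) G" "(\<lambda>n. \<integral>x. (norm (gradient (\<phi> n) x - G x))\<^sup>2 \<partial>lebesgue_in U) \<longlonglongrightarrow> 0"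
  shows "H10 U u G"
proof -
  have "weak_gradient_on U u G" unfolding weak_gradient_on_def set_integral_eq[OF U]
  proof (intro allI impI ballI)
    fix \<psi> :: "'a \<Rightarrow> real" and i :: 'a assume \<psi>: "test_function U \<psi>" and i: "i \<in> Basis"
    have 1: "(\<lambda>n. \<integral>x. \<phi> n x \<bullet> pderiv_at i \<psi> x \<partial>lebesgue_in U) \<longlonglongrightarrow> (\<integral>x. u x \<bullet> pderiv_at i \<psi> x \<partial>lebesgue_in U)"
      by (intro L2_tendsto_inner test_function_L2[OF U \<phi>] u test_function_L2[OF U test_function_pderiv[OF \<psi> i]])
    have L: "L2 (lebesgue_in U) (\<lambda>x. \<psi> x *\<^sub>R i)"
      using test_function_L2(1)[OF U \<psi>] i by (auto simp: L2_def power_mult_distrib)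
    have 2: "(\<lambda>n. \<integral>x. gradient (\<phi> n) x \<bullet> (\<psi> x *\<^sub>R i) \<partial>lebesgue_in U) \<longlonglongrightarrow> (\<integral>x. G x \<bullet> (\<psi> x *\<^sub>R i) \<partial>lebesgue_in U)"
      by (intro L2_tendsto_inner test_function_L2[OF U \<phi>] G L)
    have "(\<integral>x. \<phi> n x \<bullet> pderiv_at i \<psi> x \<partial>lebesgue_in U) = - (\<integral>x. gradient (\<phi> n) x \<bullet> (\<psi> x *\<^sub>R i) \<partial>lebesgue_in U)" for n
      using integral_by_parts_pderiv[OF test_function_Ck[OF \<phi>] \<psi> i, of n]
      by (simp add: integral_lebesgue_in_eq[OF U] test_function_0[OF \<phi>] test_function_0[OF \<psi>]
          inner_gradient_Basis[OF i] mult.commute)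
    then have "(\<lambda>n. - (\<integral>x. gradient (\<phi> n) x \<bullet> (\<psi> x *\<^sub>R i) \<partial>lebesgue_in U)) \<longlonglongrightarrow> (\<integral>x. u x \<bullet> pderiv_at i \<psi> x \<partial>lebesgue_in U)"
      using 1 by simp
    from LIMSEQ_unique[OF this tendsto_minus[OF 2]]
    show "(\<integral>x. u x * pderiv_at i \<psi> x \<partial>lebesgue_in U) = - (\<integral>x. G x \<bullet> i * \<psi> x \<partial>lebesgue_in U)"
      by (simp add: mult.commute)
  qed
  moreover have "(\<lambda>n. (\<integral>x. (norm (\<phi> n x - u x))\<^sup>2 \<partial>lebesgue_in U)
      + (\<integral>x. (norm (gradient (\<phi> n) x - G x))\<^sup>2 \<partial>lebesgue_in U)) \<longlonglongrightarrow> 0 + 0"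
    by (intro tendsto_add u G)
  ultimately show ?thesis
    unfolding H10_def H1_def L2_on_iff[OF U] set_integral_eq[OF U]
    using u(1) G(1) \<phi> by (auto simp: norm_minus_commute power2_commute intro!: exI[of _ \<phi>])
qed

text \<open>The side condition excludes exactly \<open>\<phi> = 0\<close> among the test functions.\<close>

definition rayleigh_inf :: "'a::euclidean_space set \<Rightarrow> real" where
  "rayleigh_inf U = Inf {dirichlet_energy \<phi> / mass \<phi> |\<phi>. test_function U \<phi> \<and> mass \<phi> > 0}"

lemma rayleigh_bdd_below: "bdd_below {dirichlet_energy \<phi> / mass \<phi> |\<phi>. test_function U \<phi> \<and> mass \<phi> > 0}"
  by (rule bdd_belowI[of _ 0]) (auto intro!: divide_nonneg_pos dirichlet_energy_nonneg)

lemma rayleigh_inf_le: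
  assumes "test_function U \<phi>" shows "rayleigh_inf U * mass \<phi> \<le> dirichlet_energy \<phi>"
proof (cases "mass \<phi> > 0")
  case True
  have "rayleigh_inf U \<le> dirichlet_energy \<phi> / mass \<phi>"
    unfolding rayleigh_inf_def by (rule cInf_lower[OF _ rayleigh_bdd_below]) (use assms True in auto)
  then show ?thesis using True by (simp add: field_simps)
next
  case False
  then have "mass \<phi> = 0" using mass_nonneg[of \<phi>] by linarith
  then show ?thesis by (simp add: dirichlet_energy_nonneg)
qed

text \<open>A nonempty open set is not a null set.\<close>

lemma mass_pos:
  assumes "test_function U \<phi>" "\<phi> x \<noteq> 0" shows "mass \<phi> > 0"
proof (rule ccontr)
  assume "\<not> mass \<phi> > 0"
  then have "mass \<phi> = 0" using mass_nonneg[of \<phi>] by linarith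
  then have "AE x in lborel. (\<phi> x)\<^sup>2 = 0"
    using integral_nonneg_eq_0_iff_AE[OF test_function_integrable_square(1)[OF assms(1)]] by (simp add: mass_def)
  then have ae: "AE x in lborel. \<phi> x = 0" by simp
  have o: "open {x. \<phi> x \<noteq> 0}"
    by (intro open_Collect_neq test_function_continuous[OF assms(1)] continuous_intros)
  have "{x. \<phi> x \<noteq> 0} \<in> null_sets lborel"
    using AE_iff_null_sets[of "{x. \<phi> x \<noteq> 0}" lborel] ae o by simp
  then have "negligible {x. \<phi> x \<noteq> 0}"
    by (simp add: negligible_iff_null_sets null_sets_completionI)
  then show False using open_not_negligible[OF o] assms(2) by blast
qed

lemma Ck_on_ident: "Ck_on k UNIV (\<lambda>x :: real. x)"
  using Ck_on_inner[of "UNIV :: real set" k 1] by simp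

lemma ex_test_function:
  assumes "open (U :: 'a::euclidean_space set)" "U \<noteq> {}"
  obtains \<phi> where "test_function U \<phi>" "mass \<phi> > 0"
proof -
  obtain x0 s where s: "s > 0" "cball x0 s \<subseteq> U" using assms open_contains_cball by blast
  have C: "Ck_on k UNIV (\<lambda>t. flat 0 (s\<^sup>2 - t))" for k
    by (rule Ck_on_compose[OF _ Ck_on_flat]) (auto intro!: Ck_on_diff Ck_on_ident)
  have T: "test_function U (\<lambda>x. flat 0 (s\<^sup>2 - (norm (x - x0))\<^sup>2))"
    by (rule test_function_radial[OF C, of s]) (use s in \<open>auto simp: flat_def\<close>)
  have "mass (\<lambda>x. flat 0 (s\<^sup>2 - (norm (x - x0))\<^sup>2)) > 0"
    by (rule mass_pos[OF T, of x0]) (use s flat_pos[of "s\<^sup>2" 0] in simp)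
  with T show ?thesis by (rule that)
qed

lemma rayleigh_inf_nonneg:
  assumes "open U" "U \<noteq> {}" shows "rayleigh_inf U \<ge> 0"
  unfolding rayleigh_inf_def
  by (rule cInf_greatest) (use ex_test_function[OF assms] in \<open>auto intro!: divide_nonneg_pos dirichlet_energy_nonneg\<close>)

lemma rayleigh_near:
  assumes "open U" "U \<noteq> {}" "e > 0"
  obtains \<phi> where "test_function U \<phi>" "mass \<phi> = 1" "dirichlet_energy \<phi> < rayleigh_inf U + e"
proof -
  have "\<exists>q\<in>{dirichlet_energy \<phi> / mass \<phi> |\<phi>. test_function U \<phi> \<and> mass \<phi> > 0}. q < rayleigh_inf U + e"
  proof (rule cInf_lessD)
    show "{dirichlet_energy \<phi> / mass \<phi> |\<phi>. test_function U \<phi> \<and> mass \<phi> > 0} \<noteq> {}"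
      using ex_test_function[OF assms(1,2)] by blast
  qed (use assms in \<open>simp add: rayleigh_inf_def\<close>)
  then obtain \<phi> where \<phi>: "test_function U \<phi>" "mass \<phi> > 0" "dirichlet_energy \<phi> / mass \<phi> < rayleigh_inf U + e"
    by auto
  define c where "c = 1 / sqrt (mass \<phi>)"
  have c: "c\<^sup>2 = 1 / mass \<phi>" using \<phi>(2) by (simp add: c_def power_divide)
  let ?\<psi> = "\<lambda>x. c * \<phi> x + 0 * \<phi> x"
  have g: "gradient ?\<psi> x = c *\<^sub>R gradient \<phi> x" for x
    using gradient_lincomb[of \<phi> x \<phi> c 0] test_function_differentiable[OF \<phi>(1)] by simp
  have "mass ?\<psi> = 1" using \<phi>(2) by (simp add: mass_def power_mult_distrib c)
  moreover have "dirichlet_energy ?\<psi> = dirichlet_energy \<phi> / mass \<phi>"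
    unfolding dirichlet_energy_def g by (simp add: power_mult_distrib c)
  ultimately show ?thesis using that[of ?\<psi>] test_function_lincomb[OF \<phi>(1) \<phi>(1), of c 0] \<phi>(3) by simp
qed

text \<open>A smooth substitute for \<open>|\<phi>|\<close> that still vanishes off the support of \<open>\<phi>\<close>. Using it on the minimising
sequence avoids the chain rule for \<open>|u|\<close> in \<open>H\<^sup>1\<close>.\<close>

lemma smooth_abs:
  assumes \<phi>: "test_function U \<phi>" and e: "\<epsilon> > 0"
  defines "\<psi> \<equiv> \<lambda>x. sqrt ((\<phi> x)\<^sup>2 + \<epsilon>\<^sup>2) - \<epsilon>"
  shows "test_function U \<psi>" "\<psi> x \<ge> 0" "\<psi> x \<le> \<bar>\<phi> x\<bar>" "(\<phi> x)\<^sup>2 - 2 * \<epsilon> * \<bar>\<phi> x\<bar> \<le> (\<psi> x)\<^sup>2"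
    "norm (gradient \<psi> x) \<le> norm (gradient \<phi> x)"
proof -
  have pos: "(\<phi> x)\<^sup>2 + \<epsilon>\<^sup>2 > 0" for x using e by (simp add: add_nonneg_pos)
  obtain K where K: "compact K" "K \<subseteq> U" "\<And>x. x \<notin> K \<Longrightarrow> \<phi> x = 0"
    using \<phi> by (rule test_functionE) blast
  have "Ck_on n UNIV (\<lambda>x. \<phi> x * \<phi> x + \<epsilon>\<^sup>2)" for n
    by (intro Ck_on_add Ck_on_mult Ck_on_const test_function_Ck[OF \<phi>] open_UNIV)
  then have "Ck_on n UNIV (\<lambda>x. sqrt (\<phi> x * \<phi> x + \<epsilon>\<^sup>2))" for n
    by (rule Ck_on_compose[OF open_UNIV Ck_on_sqrt]) (use pos in \<open>auto simp: power2_eq_square\<close>)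
  then have "Ck_on n UNIV \<psi>" for n
    unfolding \<psi>_def power2_eq_square[of "\<phi> _"] by (intro Ck_on_diff Ck_on_const open_UNIV)
  then show T: "test_function U \<psi>"
    by (rule test_functionI[OF _ K(1,2)]) (use K(3) e in \<open>simp add: \<psi>_def\<close>)
  define s where "s = sqrt ((\<phi> x)\<^sup>2 + \<epsilon>\<^sup>2)"
  have s2: "s\<^sup>2 = (\<phi> x)\<^sup>2 + \<epsilon>\<^sup>2" using pos[of x] by (simp add: s_def)
  have s0: "s > 0" using pos[of x] by (simp add: s_def)
  have s_le: "s \<le> \<bar>\<phi> x\<bar> + \<epsilon>"
    unfolding s_def by (rule real_le_lsqrt) (use e in \<open>auto simp: power2_sum\<close>)
  have s_ge: "\<epsilon> \<le> s" "\<bar>\<phi> x\<bar> \<le> s" unfolding s_def using e by (auto intro!: real_le_rsqrt)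
  show "\<psi> x \<ge> 0" "\<psi> x \<le> \<bar>\<phi> x\<bar>" using s_le s_ge by (auto simp: \<psi>_def s_def)
  have "(\<psi> x)\<^sup>2 = s\<^sup>2 - 2 * \<epsilon> * s + \<epsilon>\<^sup>2" by (simp add: \<psi>_def s_def[symmetric] power2_diff)
  also have "\<dots> = (\<phi> x)\<^sup>2 + 2 * \<epsilon>\<^sup>2 - 2 * \<epsilon> * s" by (simp add: s2)
  also have "\<dots> \<ge> (\<phi> x)\<^sup>2 + 2 * \<epsilon>\<^sup>2 - 2 * \<epsilon> * (\<bar>\<phi> x\<bar> + \<epsilon>)"
    using s_le e by simp
  finally show "(\<phi> x)\<^sup>2 - 2 * \<epsilon> * \<bar>\<phi> x\<bar> \<le> (\<psi> x)\<^sup>2" by (simp add: algebra_simps power2_eq_square)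
  have "((\<lambda>x. (\<phi> x)\<^sup>2 + \<epsilon>\<^sup>2) has_derivative (\<lambda>h. 2 * \<phi> x * (h \<bullet> gradient \<phi> x))) (at x)"
    by (auto intro!: derivative_eq_intros gradient_has_derivative test_function_differentiable[OF \<phi>])
  moreover have "(sqrt has_derivative (*) (inverse s / 2)) (at ((\<phi> x)\<^sup>2 + \<epsilon>\<^sup>2))"
    using DERIV_real_sqrt[OF pos[of x]] by (simp add: s_def has_field_derivative_def)
  ultimately have "((\<lambda>x. sqrt ((\<phi> x)\<^sup>2 + \<epsilon>\<^sup>2)) has_derivative (\<lambda>h. inverse s / 2 * (2 * \<phi> x * (h \<bullet> gradient \<phi> x)))) (at x)"
    by (rule has_derivative_compose)
  then have "(\<psi> has_derivative (\<lambda>h. inverse s / 2 * (2 * \<phi> x * (h \<bullet> gradient \<phi> x)) - 0)) (at x)"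
    unfolding \<psi>_def by (rule has_derivative_diff[OF _ has_derivative_const])
  moreover have "(\<lambda>h. inverse s / 2 * (2 * \<phi> x * (h \<bullet> gradient \<phi> x)) - 0)
      = (\<lambda>h. h \<bullet> ((\<phi> x / s) *\<^sub>R gradient \<phi> x))"
    using s0 by (auto simp: fun_eq_iff field_simps)
  ultimately have "gradient \<psi> x = (\<phi> x / s) *\<^sub>R gradient \<phi> x"
    by (intro gradient_eqI) (simp only:)
  moreover have "\<bar>\<phi> x / s\<bar> \<le> 1" using s_ge s0 by (simp add: abs_divide)
  then have "\<bar>\<phi> x / s\<bar> * norm (gradient \<phi> x) \<le> 1 * norm (gradient \<phi> x)"
    by (rule mult_right_mono) simp
  ultimately show "norm (gradient \<psi> x) \<le> norm (gradient \<phi> x)" by simp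
qed

text \<open>For a normalised near-minimiser \<open>\<phi>\<close> the smoothed modulus loses at most \<open>2 \<epsilon> \<integral>|\<phi>|\<close> of the mass,
which is negligible for small \<open>\<epsilon>\<close>.\<close>

lemma rayleigh_near_nonneg:
  assumes U: "open U" "U \<noteq> {}" and e: "e > 0"
  obtains \<psi> where "test_function U \<psi>" "\<And>x. \<psi> x \<ge> 0" "1 / 2 \<le> mass \<psi>" "mass \<psi> \<le> 1"
    "dirichlet_energy \<psi> - rayleigh_inf U * mass \<psi> \<le> e"
proof -
  let ?l = "rayleigh_inf U"
  have l: "?l \<ge> 0" by (rule rayleigh_inf_nonneg[OF U])
  obtain \<phi> where \<phi>: "test_function U \<phi>" "mass \<phi> = 1" "dirichlet_energy \<phi> < ?l + e / 2"
    using rayleigh_near[OF U, of "e / 2"] e by auto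
  \<comment> \<open>the admissible loss of mass\<close>
  define d where "d = min (1 / 2) (e / (2 * (?l + 1)))"
  have d: "d > 0" "d \<le> 1 / 2" "?l * d \<le> e / 2"
  proof -
    show "d > 0" using e l by (simp add: d_def)
    show "d \<le> 1 / 2" unfolding d_def by (rule min.cobounded1)
    have "?l * d \<le> ?l * (e / (2 * (?l + 1)))" using l by (intro mult_left_mono) (auto simp: d_def)
    also have "\<dots> = e / 2 * (?l / (?l + 1))" using l by (simp add: field_simps)
    also have "\<dots> \<le> e / 2 * 1" using e l by (intro mult_left_mono) auto
    finally show "?l * d \<le> e / 2" by simp
  qed
  define c where "c = (\<integral>x. \<bar>\<phi> x\<bar> \<partial>lborel)"
  have c: "c \<ge> 0" by (simp add: c_def)
  define \<epsilon> where "\<epsilon> = d / (2 * (c + 1))"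
  have \<epsilon>: "\<epsilon> > 0" unfolding \<epsilon>_def by (intro divide_pos_pos mult_pos_pos add_nonneg_pos c d) auto
  have \<epsilon>c: "2 * \<epsilon> * c \<le> d"
  proof -
    have "2 * \<epsilon> * c = d * (c / (c + 1))" using c by (simp add: \<epsilon>_def divide_simps)
    also have "\<dots> \<le> d * 1" using c d by (intro mult_left_mono) auto
    finally show ?thesis by simp
  qed
  define \<psi> where "\<psi> = (\<lambda>x. sqrt ((\<phi> x)\<^sup>2 + \<epsilon>\<^sup>2) - \<epsilon>)"
  have sa: "test_function U \<psi>" "\<psi> x \<ge> 0" "\<psi> x \<le> \<bar>\<phi> x\<bar>" "(\<phi> x)\<^sup>2 - 2 * \<epsilon> * \<bar>\<phi> x\<bar> \<le> (\<psi> x)\<^sup>2"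
    "norm (gradient \<psi> x) \<le> norm (gradient \<phi> x)" for x
    unfolding \<psi>_def by (rule smooth_abs[OF \<phi>(1) \<epsilon>])+
  note i\<phi> = test_function_integrable_square[OF \<phi>(1)] and i\<psi> = test_function_integrable_square[OF sa(1)]
  have m1: "mass \<psi> \<le> 1"
  proof -
    have "mass \<psi> \<le> mass \<phi>" unfolding mass_def
    proof (intro integral_mono i\<phi> i\<psi>)
      show "(\<psi> x)\<^sup>2 \<le> (\<phi> x)\<^sup>2" for x using sa(2,3)[of x] by (simp add: abs_le_square_iff[symmetric])
    qed
    then show ?thesis using \<phi>(2) by simp
  qed
  have m2: "mass \<psi> \<ge> 1 - d"
  proof -
    have "(\<integral>x. (\<phi> x)\<^sup>2 - 2 * \<epsilon> * \<bar>\<phi> x\<bar> \<partial>lborel) \<le> mass \<psi>" unfolding mass_def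
      by (intro integral_mono i\<psi> sa(4) Bochner_Integration.integrable_diff i\<phi> integrable_mult_right integrable_abs)
    moreover have "(\<integral>x. (\<phi> x)\<^sup>2 - 2 * \<epsilon> * \<bar>\<phi> x\<bar> \<partial>lborel) = 1 - 2 * \<epsilon> * c"
      using i\<phi> \<phi>(2) by (simp add: mass_def c_def)
    ultimately show ?thesis using \<epsilon>c by linarith
  qed
  have "dirichlet_energy \<psi> \<le> dirichlet_energy \<phi>" unfolding dirichlet_energy_def
    by (intro integral_mono i\<phi> i\<psi> power_mono sa(5)) simp
  moreover have "?l * mass \<psi> \<ge> ?l * (1 - d)" using m2 l by (rule mult_left_mono)
  ultimately have "dirichlet_energy \<psi> - ?l * mass \<psi> \<le> e"
    using \<phi>(3) d(3) by (simp add: algebra_simps)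
  then show ?thesis using that[of \<psi>] sa(1,2) m1 m2 d(2) by auto
qed

section \<open>Existence of a ground state\<close>

text \<open>The symmetric bilinear form whose quadratic form measures how far a test function is from being a
minimiser.\<close>

definition defect_form :: "'a::euclidean_space set \<Rightarrow> ('a \<Rightarrow> real) \<Rightarrow> ('a \<Rightarrow> real) \<Rightarrow> real" where
  "defect_form U \<phi> \<psi> = (\<integral>x. gradient \<phi> x \<bullet> gradient \<psi> x \<partial>lebesgue_in U)
    - rayleigh_inf U * (\<integral>x. \<phi> x \<bullet> \<psi> x \<partial>lebesgue_in U)"

definition defect :: "'a::euclidean_space set \<Rightarrow> ('a \<Rightarrow> real) \<Rightarrow> real" where
  "defect U \<phi> = dirichlet_energy \<phi> - rayleigh_inf U * mass \<phi>"

lemma defect_add: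
  assumes U: "open U" and \<phi>: "test_function U \<phi>" and \<psi>: "test_function U \<psi>"
  shows "defect U (\<lambda>x. \<phi> x + t * \<psi> x) = defect U \<phi> + 2 * t * defect_form U \<phi> \<psi> + t\<^sup>2 * defect U \<psi>"
proof -
  have T: "test_function U (\<lambda>x. \<phi> x + t * \<psi> x)"
    using test_function_lincomb[OF \<phi> \<psi>, of 1 t] by simp
  have g: "gradient (\<lambda>x. \<phi> x + t * \<psi> x) x = gradient \<phi> x + t *\<^sub>R gradient \<psi> x" for x
    using gradient_lincomb[of \<phi> x \<psi> 1 t] test_function_differentiable[OF \<phi>] test_function_differentiable[OF \<psi>]
    by simp
  note L2 = test_function_L2[OF U \<phi>] test_function_L2[OF U \<psi>]
  have "dirichlet_energy (\<lambda>x. \<phi> x + t * \<psi> x) = dirichlet_energy \<phi>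
      + 2 * t * (\<integral>x. gradient \<phi> x \<bullet> gradient \<psi> x \<partial>lebesgue_in U) + t\<^sup>2 * dirichlet_energy \<psi>"
    unfolding dirichlet_energy_eq[OF U T, symmetric] dirichlet_energy_eq[OF U \<phi>, symmetric] dirichlet_energy_eq[OF U \<psi>, symmetric] g
    by (rule L2_norm_add_squared[OF L2(2,4)])
  moreover have "mass (\<lambda>x. \<phi> x + t * \<psi> x) = mass \<phi>
      + 2 * t * (\<integral>x. \<phi> x \<bullet> \<psi> x \<partial>lebesgue_in U) + t\<^sup>2 * mass \<psi>"
    unfolding mass_eq[OF U T, symmetric] mass_eq[OF U \<phi>, symmetric] mass_eq[OF U \<psi>, symmetric]
    using L2_norm_add_squared[OF L2(1,3), of t] by simp
  ultimately show ?thesis by (simp add: defect_form_def defect_def algebra_simps)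
qed

lemma defect_nonneg: "test_function U \<phi> \<Longrightarrow> defect U \<phi> \<ge> 0"
  using rayleigh_inf_le[of U \<phi>] by (simp add: defect_def)

lemma defect_form_Cauchy_Schwarz:
  assumes U: "open U" and \<phi>: "test_function U \<phi>" and \<psi>: "test_function U \<psi>"
  shows "(defect_form U \<phi> \<psi>)\<^sup>2 \<le> defect U \<phi> * defect U \<psi>"
proof (rule discriminant_le)
  show "defect U \<phi> + 2 * t * defect_form U \<phi> \<psi> + t\<^sup>2 * defect U \<psi> \<ge> 0" for t
    unfolding defect_add[OF U \<phi> \<psi>, symmetric]
    by (rule defect_nonneg) (use test_function_lincomb[OF \<phi> \<psi>, of 1 t] in simp)
qed (rule defect_nonneg[OF \<psi>])

text \<open>The parallelogram law for a nonnegative form. It bounds the energy of a difference of near-minimisers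
by their mass difference, up to small terms.\<close>

lemma defect_diff_le:
  assumes U: "open U" and \<phi>: "test_function U \<phi>" and \<psi>: "test_function U \<psi>"
  shows "defect U (\<lambda>x. \<phi> x - \<psi> x) \<le> 2 * (defect U \<phi> + defect U \<psi>)"
proof -
  have "test_function U (\<lambda>x. \<phi> x + 1 * \<psi> x)"
    using test_function_lincomb[OF \<phi> \<psi>, of 1 1] by simp
  from defect_nonneg[OF this, unfolded defect_add[OF U \<phi> \<psi>]]
  have "0 \<le> defect U \<phi> + 2 * defect_form U \<phi> \<psi> + defect U \<psi>" by simp
  moreover have "defect U (\<lambda>x. \<phi> x - \<psi> x) = defect U \<phi> - 2 * defect_form U \<phi> \<psi> + defect U \<psi>"
    using defect_add[OF U \<phi> \<psi>, of "-1"] by simp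
  ultimately show ?thesis by (simp only:) simp
qed

text \<open>Limit of a nonnegative minimising sequence. Rellich gives convergence of the functions, the
parallelogram law convergence of the gradients, and the Cauchy-Schwarz inequality for the defect form the
equation, first against test functions and then by density.\<close>

theorem ground_state_exists:
  fixes U :: "'a::euclidean_space set"
  assumes U: "open U" "bounded U" "U \<noteq> {}"
  obtains u G where "H10 U u G" "(\<integral>x. (norm (u x))\<^sup>2 \<partial>lebesgue_in U) > 0"
    "AE x in lebesgue_in U. u x \<ge> 0"
    "\<And>v H. H10 U v H \<Longrightarrow> (\<integral>x. G x \<bullet> H x \<partial>lebesgue_in U) = rayleigh_inf U * (\<integral>x. u x \<bullet> v x \<partial>lebesgue_in U)"
proof -
  let ?l = "rayleigh_inf U" and ?M = "lebesgue_in U"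
  interpret finite_measure ?M by (rule finite_measure_lebesgue_in[OF U(1,2)])
  have l: "?l \<ge> 0" by (rule rayleigh_inf_nonneg[OF U(1,3)])
  have "\<exists>\<psi>. test_function U \<psi> \<and> (\<forall>x. \<psi> x \<ge> 0) \<and> 1 / 2 \<le> mass \<psi> \<and> mass \<psi> \<le> 1 \<and> defect U \<psi> \<le> inverse (real (Suc n))" for n
    using rayleigh_near_nonneg[OF U(1,3), of "inverse (real (Suc n))", folded defect_def] by (metis inverse_positive_iff_positive of_nat_0_less_iff zero_less_Suc)
  then obtain \<psi> where \<psi>: "\<And>n. test_function U (\<psi> n)" "\<And>n x. \<psi> n x \<ge> 0" "\<And>n. 1 / 2 \<le> mass (\<psi> n)"
    "\<And>n. mass (\<psi> n) \<le> 1" "\<And>n. defect U (\<psi> n) \<le> inverse (real (Suc n))"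
    by metis
  have A1: "(\<integral>x. (\<psi> n x)\<^sup>2 \<partial>lborel) \<le> ?l + 1" for n
    using \<psi>(4)[of n] l by (simp add: mass_def)
  have A2: "(\<integral>x. (norm (gradient (\<psi> n) x))\<^sup>2 \<partial>lborel) \<le> ?l + 1" for n
  proof -
    have "?l * mass (\<psi> n) \<le> ?l * 1" using \<psi>(4) l by (intro mult_left_mono)
    moreover have "inverse (real (Suc n)) \<le> 1" by (simp add: inverse_eq_divide)
    ultimately show ?thesis using \<psi>(5)[of n] unfolding defect_def dirichlet_energy_def by linarith
  qed
  obtain r :: "nat \<Rightarrow> nat" where r: "strict_mono r"
    and Cauchy_r: "\<And>e. e > 0 \<Longrightarrow> \<exists>N. \<forall>i\<ge>N. \<forall>j\<ge>N. (\<integral>x. (\<psi> (r i) x - \<psi> (r j) x)\<^sup>2 \<partial>lborel) < e"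
    by (rule rellich[where \<phi> = \<psi>, OF \<psi>(1) U(2) A1 A2]) blast
  define \<phi> where "\<phi> n = \<psi> (r n)" for n
  have \<phi>: "test_function U (\<phi> n)" for n using \<psi>(1) by (simp add: \<phi>_def)
  have \<phi>d: "test_function U (\<lambda>x. \<phi> i x - \<phi> j x)" for i j by (rule test_function_diff[OF \<phi> \<phi>])
  have def_le: "defect U (\<phi> n) \<le> inverse (real (Suc n))" for n
  proof -
    have "inverse (real (Suc (r n))) \<le> inverse (real (Suc n))"
      using seq_suble[OF r, of n] by (intro le_imp_inverse_le) auto
    with \<psi>(5)[of "r n"] show ?thesis unfolding \<phi>_def by (rule order_trans)
  qed
  have def0: "(\<lambda>n. defect U (\<phi> n)) \<longlonglongrightarrow> 0"
    by (rule tendsto_sandwich[OF _ _ tendsto_const LIMSEQ_inverse_real_of_nat])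
      (use def_le defect_nonneg[OF \<phi>] in auto)
  have mC: "\<exists>N. \<forall>i\<ge>N. \<forall>j\<ge>N. mass (\<lambda>x. \<phi> i x - \<phi> j x) < e" if "e > 0" for e
    using Cauchy_r[OF that] unfolding mass_def \<phi>_def .
  have Cu: "\<exists>N. \<forall>i\<ge>N. \<forall>j\<ge>N. (\<integral>x. (norm (\<phi> i x - \<phi> j x))\<^sup>2 \<partial>?M) < e" if "e > 0" for e
    using mC[OF that] unfolding mass_eq[OF U(1) \<phi>d] .
  obtain u where u: "L2 ?M u" "(\<lambda>n. \<integral>x. (norm (\<phi> n x - u x))\<^sup>2 \<partial>?M) \<longlonglongrightarrow> 0"
    by (rule L2_complete[of \<phi>, OF test_function_L2(1)[OF U(1) \<phi>] Cu]) blast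
  have CG: "\<exists>N. \<forall>i\<ge>N. \<forall>j\<ge>N. (\<integral>x. (norm (gradient (\<phi> i) x - gradient (\<phi> j) x))\<^sup>2 \<partial>?M) < e" if e: "e > 0" for e
  proof -
    obtain N1 where N1: "\<And>n. n \<ge> N1 \<Longrightarrow> defect U (\<phi> n) < e / 8"
      using order_tendstoD(2)[OF def0, of "e / 8"] e by (auto simp: eventually_sequentially)
    obtain N2 where N2: "\<And>i j. i \<ge> N2 \<Longrightarrow> j \<ge> N2 \<Longrightarrow> mass (\<lambda>x. \<phi> i x - \<phi> j x) < e / (2 * (?l + 1))"
      using mC[of "e / (2 * (?l + 1))"] e l by auto
    have "(\<integral>x. (norm (gradient (\<phi> i) x - gradient (\<phi> j) x))\<^sup>2 \<partial>?M) < e" if "i \<ge> max N1 N2" "j \<ge> max N1 N2" for i j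
    proof -
      have "(\<integral>x. (norm (gradient (\<phi> i) x - gradient (\<phi> j) x))\<^sup>2 \<partial>?M) = dirichlet_energy (\<lambda>x. \<phi> i x - \<phi> j x)"
        unfolding dirichlet_energy_eq[OF U(1) \<phi>d, symmetric] gradient_diff[OF \<phi> \<phi>] ..
      also have "\<dots> = defect U (\<lambda>x. \<phi> i x - \<phi> j x) + ?l * mass (\<lambda>x. \<phi> i x - \<phi> j x)" by (simp add: defect_def)
      also have "defect U (\<lambda>x. \<phi> i x - \<phi> j x) < e / 2"
        using defect_diff_le[OF U(1) \<phi> \<phi>, of i j] N1[of i] N1[of j] that by simp
      also have "?l * mass (\<lambda>x. \<phi> i x - \<phi> j x) \<le> (?l + 1) * (e / (2 * (?l + 1)))"
        using N2[of i j] that l by (intro mult_mono) (auto simp: mass_nonneg)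
      also have "(?l + 1) * (e / (2 * (?l + 1))) = e / 2" using l by (simp add: divide_simps)
      finally show ?thesis by simp
    qed
    then show ?thesis by blast
  qed
  obtain G where G: "L2 ?M G" "(\<lambda>n. \<integral>x. (norm (gradient (\<phi> n) x - G x))\<^sup>2 \<partial>?M) \<longlonglongrightarrow> 0"
    by (rule L2_complete[of "\<lambda>n. gradient (\<phi> n)", OF test_function_L2(2)[OF U(1) \<phi>] CG]) blast
  have H: "H10 U u G" by (rule H10_limit[OF U(1) \<phi> u G])
  have eq_test: "(\<integral>x. G x \<bullet> gradient \<xi> x \<partial>?M) = ?l * (\<integral>x. u x \<bullet> \<xi> x \<partial>?M)" if \<xi>: "test_function U \<xi>" for \<xi>
  proof -
    have "(\<lambda>n. (defect_form U (\<phi> n) \<xi>)\<^sup>2) \<longlonglongrightarrow> 0"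
      by (rule tendsto_sandwich[OF _ _ tendsto_const tendsto_mult_left_zero[OF def0, of "defect U \<xi>"]])
        (use defect_form_Cauchy_Schwarz[OF U(1) \<phi> \<xi>] in auto)
    then have "(\<lambda>n. defect_form U (\<phi> n) \<xi>) \<longlonglongrightarrow> 0" by simp
    moreover have "(\<lambda>n. defect_form U (\<phi> n) \<xi>) \<longlonglongrightarrow> (\<integral>x. G x \<bullet> gradient \<xi> x \<partial>?M) - ?l * (\<integral>x. u x \<bullet> \<xi> x \<partial>?M)"
      unfolding defect_form_def
      by (intro tendsto_intros L2_tendsto_inner test_function_L2[OF U(1) \<phi>] test_function_L2[OF U(1) \<xi>] u G)
    ultimately show ?thesis using LIMSEQ_unique by fastforce
  qed
  have eq: "(\<integral>x. G x \<bullet> H x \<partial>?M) = ?l * (\<integral>x. u x \<bullet> v x \<partial>?M)" if vH: "H10 U v H" for v H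
  proof -
    obtain \<xi> where \<xi>: "\<And>n. test_function U (\<xi> n)"
      "(\<lambda>n. \<integral>x. (norm (\<xi> n x - v x))\<^sup>2 \<partial>?M) \<longlonglongrightarrow> 0"
      "(\<lambda>n. \<integral>x. (norm (gradient (\<xi> n) x - H x))\<^sup>2 \<partial>?M) \<longlonglongrightarrow> 0" "L2 ?M v" "L2 ?M H"
      by (rule H10_approx[OF U(1) vH]) blast
    have "(\<lambda>n. \<integral>x. gradient (\<xi> n) x \<bullet> G x \<partial>?M) \<longlonglongrightarrow> (\<integral>x. H x \<bullet> G x \<partial>?M)"
      by (intro L2_tendsto_inner test_function_L2[OF U(1) \<xi>(1)] \<xi> G)
    moreover have "(\<lambda>n. ?l * (\<integral>x. \<xi> n x \<bullet> u x \<partial>?M)) \<longlonglongrightarrow> ?l * (\<integral>x. v x \<bullet> u x \<partial>?M)"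
      by (intro tendsto_intros L2_tendsto_inner test_function_L2[OF U(1) \<xi>(1)] \<xi> u)
    moreover have "(\<integral>x. gradient (\<xi> n) x \<bullet> G x \<partial>?M) = ?l * (\<integral>x. \<xi> n x \<bullet> u x \<partial>?M)" for n
      using eq_test[OF \<xi>(1)[of n]] by (simp add: inner_commute mult.commute)
    ultimately have "(\<integral>x. H x \<bullet> G x \<partial>?M) = ?l * (\<integral>x. v x \<bullet> u x \<partial>?M)"
      using LIMSEQ_unique by auto
    then show ?thesis by (simp add: inner_commute mult.commute)
  qed
  have mass_u: "(\<integral>x. (norm (u x))\<^sup>2 \<partial>?M) \<ge> 1 / 2"
  proof (rule LIMSEQ_le_const)
    show "(\<lambda>n. \<integral>x. (norm (\<phi> n x))\<^sup>2 \<partial>?M) \<longlonglongrightarrow> (\<integral>x. (norm (u x))\<^sup>2 \<partial>?M)"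
      by (intro L2_tendsto_norm test_function_L2[OF U(1) \<phi>] u)
    show "\<exists>N. \<forall>n\<ge>N. 1 / 2 \<le> (\<integral>x. (norm (\<phi> n x))\<^sup>2 \<partial>?M)"
      unfolding mass_eq[OF U(1) \<phi>] using \<psi>(3) by (simp add: \<phi>_def)
  qed
  have nonneg: "AE x in ?M. u x \<ge> 0"
  proof -
    have m: "L2 ?M (\<lambda>x. min (u x) 0)"
    proof -
      have "integrable ?M (\<lambda>x. (norm (min (u x) 0))\<^sup>2)"
        by (rule Bochner_Integration.integrable_bound[OF L2_integrable[OF u(1)]])
          (use u(1) in \<open>auto simp: L2_def min_def\<close>)
      then show ?thesis using u(1) by (auto simp: L2_def)
    qed
    have le: "(\<integral>x. (norm (min (u x) 0))\<^sup>2 \<partial>?M) \<le> (\<integral>x. (norm (\<phi> n x - u x))\<^sup>2 \<partial>?M)" for n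
    proof (intro integral_mono L2_integrable m L2_diff test_function_L2[OF U(1) \<phi>] u)
      show "(norm (min (u x) 0))\<^sup>2 \<le> (norm (\<phi> n x - u x))\<^sup>2" for x
        using \<psi>(2)[of "r n" x] by (intro power_mono) (auto simp: \<phi>_def min_def)
    qed
    have "(\<integral>x. (norm (min (u x) 0))\<^sup>2 \<partial>?M) \<le> 0"
      by (rule LIMSEQ_le_const[OF u(2)]) (use le in auto)
    then have "(\<integral>x. (norm (min (u x) 0))\<^sup>2 \<partial>?M) = 0" by (simp add: antisym)
    then have "AE x in ?M. min (u x) 0 = 0" unfolding integral_square_eq_0_iff[OF m] .
    then show ?thesis by eventually_elim (simp add: min_def split: if_splits)
  qed
  show ?thesis by (rule that[OF H _ nonneg eq]) (use mass_u in simp)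
qed

text \<open>Testing an eigenfunction with itself shows that its eigenvalue is its Rayleigh quotient, which is a
limit of Rayleigh quotients of test functions.\<close>

theorem first_dirichlet_eigenvalue_eq:
  assumes U: "open U" "bounded U" "U \<noteq> {}"
  shows "first_dirichlet_eigenvalue U = rayleigh_inf U"
  unfolding first_dirichlet_eigenvalue_def
proof (rule Least_equality)
  let ?M = "lebesgue_in U"
  obtain u G where u: "H10 U u G" "(\<integral>x. (norm (u x))\<^sup>2 \<partial>?M) > 0"
    "\<And>v H. H10 U v H \<Longrightarrow> (\<integral>x. G x \<bullet> H x \<partial>?M) = rayleigh_inf U * (\<integral>x. u x \<bullet> v x \<partial>?M)"
    by (rule ground_state_exists[OF U]) blast
  have L2: "L2 ?M u" using u(1) U(1) by (auto simp: H10_def H1_def L2_on_iff)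
  have "\<not> (AE x\<in>U in lborel. u x = 0)"
    using u(2) integral_square_eq_0_iff[OF L2] AE_lebesgue_in[OF U(1), of "\<lambda>x. u x = 0"] by auto
  then show "dirichlet_eigenvalue U (rayleigh_inf U)"
    unfolding dirichlet_eigenvalue_def set_integral_eq[OF U(1)] using u(1,3) by auto
  fix \<mu> assume "dirichlet_eigenvalue U \<mu>"
  then obtain u G where u: "H10 U u G" "\<not> (AE x\<in>U in lborel. u x = 0)"
    "\<And>v H. H10 U v H \<Longrightarrow> (\<integral>x. G x \<bullet> H x \<partial>?M) = \<mu> * (\<integral>x. u x * v x \<partial>?M)"
    unfolding dirichlet_eigenvalue_def set_integral_eq[OF U(1)] by blast
  obtain \<phi> where \<phi>: "\<And>n. test_function U (\<phi> n)"
    "(\<lambda>n. \<integral>x. (norm (\<phi> n x - u x))\<^sup>2 \<partial>?M) \<longlonglongrightarrow> 0"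
    "(\<lambda>n. \<integral>x. (norm (gradient (\<phi> n) x - G x))\<^sup>2 \<partial>?M) \<longlonglongrightarrow> 0" "L2 ?M u" "L2 ?M G"
    by (rule H10_approx[OF U(1) u(1)]) blast
  let ?m = "\<integral>x. (norm (u x))\<^sup>2 \<partial>?M"
  have "?m \<noteq> 0" using u(2) integral_square_eq_0_iff[OF \<phi>(4)] AE_lebesgue_in[OF U(1), of "\<lambda>x. u x = 0"] by auto
  moreover have "?m \<ge> 0" by simp
  ultimately have m: "?m > 0" by linarith
  have "rayleigh_inf U * ?m \<le> (\<integral>x. (norm (G x))\<^sup>2 \<partial>?M)"
  proof (rule LIMSEQ_le)
    show "(\<lambda>n. rayleigh_inf U * (\<integral>x. (norm (\<phi> n x))\<^sup>2 \<partial>?M)) \<longlonglongrightarrow> rayleigh_inf U * ?m"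
      by (intro tendsto_intros L2_tendsto_norm test_function_L2[OF U(1) \<phi>(1)] \<phi>)
    show "(\<lambda>n. \<integral>x. (norm (gradient (\<phi> n) x))\<^sup>2 \<partial>?M) \<longlonglongrightarrow> (\<integral>x. (norm (G x))\<^sup>2 \<partial>?M)"
      by (intro L2_tendsto_norm test_function_L2[OF U(1) \<phi>(1)] \<phi>)
    show "\<exists>N. \<forall>n\<ge>N. rayleigh_inf U * (\<integral>x. (norm (\<phi> n x))\<^sup>2 \<partial>?M) \<le> (\<integral>x. (norm (gradient (\<phi> n) x))\<^sup>2 \<partial>?M)"
      unfolding mass_eq[OF U(1) \<phi>(1)] dirichlet_energy_eq[OF U(1) \<phi>(1)] using rayleigh_inf_le[OF \<phi>(1)] by blast
  qed
  also have "(\<integral>x. (norm (G x))\<^sup>2 \<partial>?M) = \<mu> * ?m"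
    using u(3)[OF u(1)] by (simp only: power2_norm_eq_inner inner_real_def)
  finally show "rayleigh_inf U \<le> \<mu>" using m by simp
qed

section \<open>Positive supersolutions bound the Rayleigh quotient\<close>

lemma pderiv_at_mult:
  assumes "f differentiable (at x)" "g differentiable (at x)"
  shows "pderiv_at i (\<lambda>x. f x * g x) x = f x * pderiv_at i g x + pderiv_at i f x * g x"
  using pderiv_at_eq[OF has_derivative_mult[OF assms[unfolded frechet_derivative_works]]]
  by (simp add: pderiv_at_def)

lemma pderiv_at_divide:
  assumes "f differentiable (at x)" "g differentiable (at x)" "g x \<noteq> (0::real)"
  shows "pderiv_at i (\<lambda>x. f x / g x) x = pderiv_at i f x / g x - f x * pderiv_at i g x / (g x)\<^sup>2"
proof -
  have "pderiv_at i (\<lambda>x. f x / g x) x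
      = (frechet_derivative f (at x) i * g x - f x * frechet_derivative g (at x) i) / (g x * g x)"
    by (rule pderiv_at_eq[OF has_derivative_divide'[OF assms(1,2)[unfolded frechet_derivative_works] assms(3)]])
  then show ?thesis using assms(3) by (simp add: pderiv_at_def diff_divide_distrib power2_eq_square)
qed

lemma norm_gradient_squared: "(norm (gradient f x))\<^sup>2 = (\<Sum>i\<in>Basis. (pderiv_at i f x)\<^sup>2)"
  unfolding power2_norm_eq_inner
  by (subst euclidean_inner) (simp add: inner_gradient_Basis power2_eq_square)

text \<open>Expand \<open>0 \<le> |\<nabla>\<phi> - \<phi> \<nabla>v / v|\<^sup>2\<close> and integrate. The field \<open>F = \<phi>\<^sup>2 \<nabla>v / v\<close> is \<open>C\<^sup>1\<close> on the
whole space, since it vanishes off the support of \<open>\<phi>\<close>, so its divergence has integral \<open>0\<close>.\<close>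

theorem positive_supersolution_bound:
  fixes v :: "'a::euclidean_space \<Rightarrow> real"
  assumes U: "open U" and v: "Ck_on 2 U v" "\<And>x. x \<in> U \<Longrightarrow> v x > 0"
    and super: "\<And>x. x \<in> U \<Longrightarrow> laplacian v x + \<kappa> * v x \<le> 0"
    and \<phi>: "test_function U \<phi>"
  shows "\<kappa> * mass \<phi> \<le> dirichlet_energy \<phi>"
proof -
  obtain K where K: "compact K" "K \<subseteq> U" "\<And>x. x \<notin> K \<Longrightarrow> \<phi> x = 0"
    using \<phi> by (rule test_functionE) blast
  note cK = compact_imp_closed[OF K(1)]
  have v1: "Ck_on 1 U v" by (rule Ck_on_le[OF v(1)]) simp
  have dv1: "Ck_on 1 U (pderiv_at i v)" if "i \<in> Basis" for i
    using v(1) that by (simp add: numeral_2_eq_2)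
  have \<phi>1: "Ck_on 1 S \<phi>" for S by (rule Ck_on_mono[OF test_function_Ck[OF \<phi>]]) simp
  define q where "q i x = pderiv_at i v x / v x" for i x
  define F where "F i x = (\<phi> x * \<phi> x) * q i x" for i x
  have q1: "Ck_on 1 U (q i)" if "i \<in> Basis" for i
    unfolding q_def[abs_def] by (rule Ck_on_divide[OF U dv1[OF that] v1]) (use v(2) in fastforce)
  have F0: "F i x = 0" if "x \<notin> K" for i x using K(3)[OF that] by (simp add: F_def)
  have F1: "Ck_on 1 UNIV (F i)" if i: "i \<in> Basis" for i
  proof (rule Ck_on_local)
    fix x
    show "\<exists>N. open N \<and> x \<in> N \<and> Ck_on 1 N (F i)"
    proof (cases "x \<in> U")
      case True
      have "Ck_on 1 U (F i)" unfolding F_def[abs_def] by (intro Ck_on_mult U \<phi>1 q1 i)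
      then show ?thesis using U True by blast
    next
      case False
      have o: "open (- K)" by (rule open_Compl[OF cK])
      have "Ck_on 1 (- K) (F i)"
        by (rule Ck_on_cong[OF o _ Ck_on_const[of _ _ 0]]) (simp add: F0)
      then show ?thesis using o False K(2) by blast
    qed
  qed
  have int_F: "integrable lborel (pderiv_at i (F i))" if i: "i \<in> Basis" for i
    by (rule compact_support_integrable[OF _ K(1) pderiv_at_0_outside[OF cK F0]]) (use F1[OF i] i in simp_all)
  have int0: "(\<integral>x. (\<Sum>i\<in>Basis. pderiv_at i (F i) x) \<partial>lborel) = 0"
    using int_F integral_pderiv_eq_0[OF F1 K(1) F0] by (subst Bochner_Integration.integral_sum) auto
  have pointwise: "\<kappa> * (\<phi> x)\<^sup>2 + (\<Sum>i\<in>Basis. pderiv_at i (F i) x) \<le> (norm (gradient \<phi> x))\<^sup>2" for x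
  proof (cases "x \<in> U")
    case True
    have vx: "v x > 0" by (rule v(2)[OF True])
    have d\<phi>: "\<phi> differentiable (at x)" by (rule test_function_differentiable[OF \<phi>])
    have dv: "v differentiable (at x)" using v1 True by simp
    let ?p = "\<lambda>i. pderiv_at i \<phi> x" and ?d = "\<lambda>i. pderiv_at i v x"
    have pF: "pderiv_at i (F i) x = 2 * \<phi> x * ?p i * ?d i / v x
        + (\<phi> x)\<^sup>2 * (pderiv_at i (pderiv_at i v) x / v x - (?d i)\<^sup>2 / (v x)\<^sup>2)" if i: "i \<in> Basis" for i
    proof -
      have dd: "pderiv_at i v differentiable (at x)" using dv1[OF i] True by simp
      have dq: "q i differentiable (at x)" using q1[OF i] True by simp
      have "pderiv_at i (F i) x = (\<phi> x * \<phi> x) * pderiv_at i (q i) x + pderiv_at i (\<lambda>x. \<phi> x * \<phi> x) x * q i x"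
        unfolding F_def[abs_def] by (rule pderiv_at_mult[OF _ dq]) (intro differentiable_mult d\<phi>)
      also have "pderiv_at i (\<lambda>x. \<phi> x * \<phi> x) x = 2 * \<phi> x * ?p i"
        by (subst pderiv_at_mult[OF d\<phi> d\<phi>]) simp
      also have "pderiv_at i (q i) x = pderiv_at i (pderiv_at i v) x / v x - (?d i)\<^sup>2 / (v x)\<^sup>2"
        unfolding q_def[abs_def] using pderiv_at_divide[OF dd dv, of i] vx by (simp add: power2_eq_square)
      finally show ?thesis by (simp add: q_def power2_eq_square)
    qed
    have "(\<phi> x)\<^sup>2 / v x * (laplacian v x + \<kappa> * v x) \<le> 0"
      using super[OF True] vx by (intro mult_nonneg_nonpos) auto
    then have A: "\<kappa> * (\<phi> x)\<^sup>2 \<le> - ((\<phi> x)\<^sup>2 * (laplacian v x / v x))"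
      using vx by (simp add: field_simps)
    have "0 \<le> (\<Sum>i\<in>Basis. (?p i - \<phi> x * ?d i / v x)\<^sup>2)" by (intro sum_nonneg) simp
    also have "\<dots> = (\<Sum>i\<in>Basis. (?p i)\<^sup>2 - pderiv_at i (F i) x + (\<phi> x)\<^sup>2 * (pderiv_at i (pderiv_at i v) x / v x))"
      by (intro sum.cong refl) (simp add: pF power2_diff power_mult_distrib power_divide algebra_simps)
    also have "\<dots> = (norm (gradient \<phi> x))\<^sup>2 - (\<Sum>i\<in>Basis. pderiv_at i (F i) x) + (\<phi> x)\<^sup>2 * (laplacian v x / v x)"
      by (simp add: norm_gradient_squared laplacian_def sum.distrib sum_subtractf sum_distrib_left sum_divide_distrib)
    finally show ?thesis using A by linarith
  next
    case False
    then have xK: "x \<notin> K" using K(2) by blast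
    show ?thesis using K(3)[OF xK] pderiv_at_0_outside[OF cK F0 xK] by simp
  qed
  note i\<phi> = test_function_integrable_square[OF \<phi>]
  have "\<kappa> * mass \<phi> = (\<integral>x. \<kappa> * (\<phi> x)\<^sup>2 + (\<Sum>i\<in>Basis. pderiv_at i (F i) x) \<partial>lborel)"
    using i\<phi> int_F int0 by (subst Bochner_Integration.integral_add) (auto simp: mass_def)
  also have "\<dots> \<le> dirichlet_energy \<phi>"
    unfolding dirichlet_energy_def using i\<phi> int_F
    by (intro integral_mono pointwise Bochner_Integration.integrable_add) auto
  finally show ?thesis .
qed

section \<open>Smoothing by convolution\<close>

text \<open>The gradient bound makes the integrands Lipschitz in the parameter, hence the difference quotients
dominated. It is used with a point of the space and with the radius of a kernel as parameter.\<close>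

lemma has_derivative_parametric_integral:
  fixes f :: "'p::euclidean_space \<Rightarrow> 'b \<Rightarrow> real" and g :: "'p \<Rightarrow> 'b \<Rightarrow> 'p"
  assumes u: "integrable M u" and \<delta>: "\<delta> > 0"
    and der: "\<And>p y. p \<in> ball p0 \<delta> \<Longrightarrow> y \<in> space M \<Longrightarrow> ((\<lambda>p. f p y) has_derivative (\<lambda>h. h \<bullet> g p y)) (at p)"
    and B: "\<And>p y. p \<in> ball p0 \<delta> \<Longrightarrow> y \<in> space M \<Longrightarrow> norm (g p y) \<le> B"
    and int: "\<And>p. p \<in> ball p0 \<delta> \<Longrightarrow> integrable M (\<lambda>y. u y * f p y)"
    and g: "g p0 \<in> borel_measurable M"
  shows "((\<lambda>p. \<integral>y. u y * f p y \<partial>M) has_derivative (\<lambda>h. h \<bullet> (\<integral>y. u y *\<^sub>R g p0 y \<partial>M))) (at p0)"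
proof -
  have p0: "p0 \<in> ball p0 \<delta>" using \<delta> by simp
  have um: "u \<in> borel_measurable M" using u by simp
  have ig: "integrable M (\<lambda>y. u y *\<^sub>R g p0 y)"
  proof (rule Bochner_Integration.integrable_bound)
    show "integrable M (\<lambda>y. B * norm (u y))" using u by simp
    show "(\<lambda>y. u y *\<^sub>R g p0 y) \<in> borel_measurable M" using um g by simp
    show "AE y in M. norm (u y *\<^sub>R g p0 y) \<le> norm (B * norm (u y))"
    proof (rule AE_I2)
      fix y assume "y \<in> space M"
      then have "norm (g p0 y) \<le> \<bar>B\<bar>" using B[OF p0] by fastforce
      from mult_left_mono[OF this abs_ge_zero[of "u y"]]
      show "norm (u y *\<^sub>R g p0 y) \<le> norm (B * norm (u y))"
        by (simp add: abs_mult mult.commute)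
    qed
  qed
  define D where "D = (\<lambda>p y. (f p y - f p0 y - (p - p0) \<bullet> g p0 y) / norm (p - p0))"
  let ?I = "\<lambda>p. \<integral>y. u y * f p y \<partial>M" and ?J = "\<integral>y. u y *\<^sub>R g p0 y \<partial>M"
  have quotient: "(?I p - ?I p0 - (p - p0) \<bullet> ?J) / norm (p - p0) = (\<integral>y. u y * D p y \<partial>M)"
    if p: "p \<in> ball p0 \<delta>" for p
  proof -
    have "(\<integral>y. u y * D p y \<partial>M)
        = (\<integral>y. (u y * f p y - u y * f p0 y - (p - p0) \<bullet> (u y *\<^sub>R g p0 y)) / norm (p - p0) \<partial>M)"
      by (simp add: D_def algebra_simps)
    also have "\<dots> = (?I p - ?I p0 - (\<integral>y. (p - p0) \<bullet> (u y *\<^sub>R g p0 y) \<partial>M)) / norm (p - p0)"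
      using int[OF p] int[OF p0] integrable_inner_right[of "p - p0", OF ig] by simp
    also have "(\<integral>y. (p - p0) \<bullet> (u y *\<^sub>R g p0 y) \<partial>M) = (p - p0) \<bullet> ?J"
      by (rule integral_inner_right[OF ig])
    finally show ?thesis by simp
  qed
  have lip: "\<bar>f p y - f p0 y\<bar> \<le> B * norm (p - p0)" if p: "p \<in> ball p0 \<delta>" and y: "y \<in> space M" for p y
  proof -
    have "norm (f p y - f p0 y) \<le> B * norm (p - p0)"
    proof (rule differentiable_bound[of "ball p0 \<delta>" "\<lambda>p. f p y" "\<lambda>p h. h \<bullet> g p y"])
      show "((\<lambda>p. f p y) has_derivative (\<lambda>h. h \<bullet> g q y)) (at q within ball p0 \<delta>)" if "q \<in> ball p0 \<delta>" for q
        using der[OF that y] by (rule has_derivative_at_withinI)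
      show "onorm (\<lambda>h. h \<bullet> g q y) \<le> B" if q: "q \<in> ball p0 \<delta>" for q
      proof (rule onorm_bound)
        show "0 \<le> B" using B[OF q y] norm_ge_zero order_trans by blast
        fix h
        have "norm (h \<bullet> g q y) \<le> norm h * norm (g q y)" using Cauchy_Schwarz_ineq2 by simp
        also have "\<dots> \<le> norm h * B" using B[OF q y] by (rule mult_left_mono) simp
        finally show "norm (h \<bullet> g q y) \<le> B * norm h" by (simp add: mult.commute)
      qed
    qed (use p p0 in auto)
    then show ?thesis by simp
  qed
  have D_bound: "norm (D p y) \<le> 2 * B" if p: "p \<in> ball p0 \<delta>" and y: "y \<in> space M" for p y
  proof -
    have B0: "B \<ge> 0" using B[OF p0 y] norm_ge_zero order_trans by blast
    have "\<bar>(p - p0) \<bullet> g p0 y\<bar> \<le> norm (p - p0) * B"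
      using Cauchy_Schwarz_ineq2[of "p - p0" "g p0 y"] mult_left_mono[OF B[OF p0 y], of "norm (p - p0)"]
      by simp
    then have "\<bar>f p y - f p0 y - (p - p0) \<bullet> g p0 y\<bar> \<le> 2 * B * norm (p - p0)"
      using lip[OF p y] abs_triangle_ineq4[of "f p y - f p0 y" "(p - p0) \<bullet> g p0 y"]
      by (simp add: algebra_simps)
    then show ?thesis using B0 by (cases "p = p0") (simp_all add: D_def abs_divide field_simps)
  qed
  have "((\<lambda>p. (?I p - ?I p0 - (p - p0) \<bullet> ?J) / norm (p - p0)) \<longlongrightarrow> 0) (at p0)"
    unfolding tendsto_at_iff_sequentially
  proof (intro allI impI)
    fix X assume X: "\<forall>i. X i \<in> UNIV - {p0}" "X \<longlonglongrightarrow> p0"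
    obtain N where N: "\<And>n. n \<ge> N \<Longrightarrow> X n \<in> ball p0 \<delta>"
      using topological_tendstoD[OF X(2) open_ball p0] by (auto simp: eventually_sequentially)
    define Y where "Y n = X (n + N)" for n
    have Y: "Y n \<in> ball p0 \<delta>" "Y n \<noteq> p0" for n using N X(1) by (auto simp: Y_def)
    have Ylim: "Y \<longlonglongrightarrow> p0" unfolding Y_def[abs_def] using X(2) by (rule LIMSEQ_ignore_initial_segment)
    have Yat: "filterlim Y (at p0) sequentially"
      unfolding filterlim_at using Ylim Y(2) by auto
    have "(\<lambda>n. \<integral>y. u y * D (Y n) y \<partial>M) \<longlonglongrightarrow> (\<integral>y. 0 \<partial>M)"
    proof (rule integral_dominated_convergence)
      show "integrable M (\<lambda>y. norm (u y) * (2 * B))" using u by simp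
      show "(\<lambda>y. u y * D (Y n) y) \<in> borel_measurable M" for n
      proof -
        have "(\<lambda>y. u y * D (Y n) y)
          = (\<lambda>y. (u y * f (Y n) y - u y * f p0 y - u y * ((Y n - p0) \<bullet> g p0 y)) / norm (Y n - p0))"
          by (simp add: D_def algebra_simps)
        then show ?thesis using int[OF Y(1)] int[OF p0] um g by simp
      qed
      show "AE y in M. norm (u y * D (Y n) y) \<le> norm (u y) * (2 * B)" for n
        using D_bound[OF Y(1)] by (auto intro!: AE_I2 mult_left_mono simp: abs_mult)
      show "AE y in M. (\<lambda>n. u y * D (Y n) y) \<longlonglongrightarrow> 0"
      proof (rule AE_I2)
        fix y assume y: "y \<in> space M"
        have "((\<lambda>p. norm (f p y - f p0 y - (p - p0) \<bullet> g p0 y) / norm (p - p0)) \<longlongrightarrow> 0) (at p0)"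
          using der[OF p0 y] by (simp add: has_derivative_iff_norm)
        from filterlim_compose[OF this Yat]
        have "(\<lambda>n. norm (D (Y n) y)) \<longlonglongrightarrow> 0" by (simp add: D_def)
        then have "(\<lambda>n. D (Y n) y) \<longlonglongrightarrow> 0" by (rule tendsto_norm_zero_cancel)
        then show "(\<lambda>n. u y * D (Y n) y) \<longlonglongrightarrow> 0" by (rule tendsto_mult_right_zero)
      qed
    qed simp
    then have "(\<lambda>n. (?I (Y n) - ?I p0 - (Y n - p0) \<bullet> ?J) / norm (Y n - p0)) \<longlonglongrightarrow> 0"
      using quotient[OF Y(1)] by simp
    then show "((\<lambda>p. (?I p - ?I p0 - (p - p0) \<bullet> ?J) / norm (p - p0)) \<circ> X) \<longlonglongrightarrow> 0"
      unfolding Y_def comp_def by (rule LIMSEQ_offset)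
  qed
  then have "((\<lambda>p. norm (?I p - ?I p0 - (p - p0) \<bullet> ?J) / norm (p - p0)) \<longlongrightarrow> 0) (at p0)"
    using tendsto_norm_zero by fastforce
  moreover have "bounded_linear (\<lambda>h. h \<bullet> ?J)" by (rule bounded_linear_inner_left)
  ultimately show ?thesis by (simp add: has_derivative_iff_norm)
qed

lemma laplacian_test_function:
  "test_function U \<phi> \<Longrightarrow> test_function U (laplacian \<phi>)"
proof -
  assume \<phi>: "test_function U \<phi>"
  have "test_function U (\<lambda>x. \<Sum>i\<in>B. pderiv_at i (pderiv_at i \<phi>) x)" if "finite B" "B \<subseteq> Basis" for B
    using that
  proof (induction B)
    case empty
    show ?case by (rule test_functionI[of _ "{}"]) auto
  next
    case (insert i B)
    then show ?case
      using test_function_lincomb[of U "pderiv_at i (pderiv_at i \<phi>)" "\<lambda>x. \<Sum>i\<in>B. pderiv_at i (pderiv_at i \<phi>) x" 1 1]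
        test_function_pderiv[OF test_function_pderiv[OF \<phi>]] by auto
  qed
  from this[of Basis] show ?thesis by (simp add: laplacian_def[abs_def])
qed

lemma integrable_mult_bounded:
  fixes u g :: "'b \<Rightarrow> real"
  assumes "integrable M u" "g \<in> borel_measurable M" "\<And>y. \<bar>g y\<bar> \<le> B"
  shows "integrable M (\<lambda>y. u y * g y)"
proof (rule Bochner_Integration.integrable_bound)
  show "integrable M (\<lambda>y. \<bar>u y\<bar> * B)" using assms(1) by simp
  show "(\<lambda>y. u y * g y) \<in> borel_measurable M" using assms(1,2) by simp
  have "\<bar>u y * g y\<bar> \<le> \<bar>\<bar>u y\<bar> * B\<bar>" for y
    using mult_left_mono[OF order_trans[OF assms(3)[of y] abs_ge_self] abs_ge_zero[of "u y"]]
    by (simp add: abs_mult)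
  then show "AE y in M. norm (u y * g y) \<le> norm (\<bar>u y\<bar> * B)" by simp
qed

lemma test_function_bounded:
  assumes "test_function V K" obtains B where "\<And>x. \<bar>K x\<bar> \<le> B"
proof -
  obtain C where C: "compact C" "C \<subseteq> V" "\<And>x. x \<notin> C \<Longrightarrow> K x = 0"
    using assms by (rule test_functionE) blast
  obtain B where "B \<ge> 0" "\<And>x. norm (K x) \<le> B"
    by (rule compact_support_bounded[OF test_function_continuous[OF assms] C(1,3)]) auto
  then show ?thesis using that[of B] by simp
qed

lemma integrable_mult_test_function:
  fixes K :: "'a::euclidean_space \<Rightarrow> real"
  assumes "integrable (lebesgue_in U) u" "test_function V K"
  shows "integrable (lebesgue_in U) (\<lambda>y. u y * K (x - y))"
proof -
  have "K \<in> borel_measurable borel"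
    by (rule borel_measurable_continuous_onI[OF test_function_continuous[OF assms(2)]])
  then have "(\<lambda>y. K (x - y)) \<in> borel_measurable (lebesgue_in U)"
    by (intro measurable_restrict_space1) simp
  moreover obtain B where "\<And>x. \<bar>K x\<bar> \<le> B" using test_function_bounded[OF assms(2)] by blast
  ultimately show ?thesis using assms(1) by (intro integrable_mult_bounded[where B = B]) auto
qed

lemma convolution_has_derivative:
  fixes K :: "'a::euclidean_space \<Rightarrow> real"
  assumes u: "integrable (lebesgue_in U) u" and K: "test_function V K"
  shows "((\<lambda>x. \<integral>y. u y * K (x - y) \<partial>lebesgue_in U) has_derivative
    (\<lambda>h. h \<bullet> (\<integral>y. u y *\<^sub>R gradient K (x - y) \<partial>lebesgue_in U))) (at x)"
proof -
  obtain C where C: "compact C" "C \<subseteq> V" "\<And>x. x \<notin> C \<Longrightarrow> K x = 0"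
    using K by (rule test_functionE) blast
  obtain B where B: "B \<ge> 0" "\<And>x. norm (gradient K x) \<le> B"
    by (rule compact_support_bounded[OF test_function_continuous_gradient[OF K] C(1)
          gradient_0_outside[OF compact_imp_closed[OF C(1)] C(3)]]) auto
  have m: "gradient K \<in> borel_measurable borel"
    by (rule borel_measurable_continuous_onI[OF test_function_continuous_gradient[OF K]])
  show ?thesis
  proof (rule has_derivative_parametric_integral[where \<delta> = 1 and B = B])
    show "((\<lambda>p. K (p - y)) has_derivative (\<lambda>h. h \<bullet> gradient K (p - y))) (at p)" for p y
    proof -
      have "((\<lambda>p. p - y) has_derivative (\<lambda>h. h)) (at p)" by (auto intro!: derivative_eq_intros)
      from has_derivative_compose[OF this gradient_has_derivative[OF test_function_differentiable[OF K]]]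
      show ?thesis .
    qed
    show "(\<lambda>y. gradient K (x - y)) \<in> borel_measurable (lebesgue_in U)"
      using m by (intro measurable_restrict_space1) simp
  qed (use u B integrable_mult_test_function[OF u K] in auto)
qed

lemma convolution_pderiv:
  fixes K :: "'a::euclidean_space \<Rightarrow> real"
  assumes u: "integrable (lebesgue_in U) u" and K: "test_function V K" and i: "i \<in> Basis"
  shows "pderiv_at i (\<lambda>x. \<integral>y. u y * K (x - y) \<partial>lebesgue_in U)
    = (\<lambda>x. \<integral>y. u y * pderiv_at i K (x - y) \<partial>lebesgue_in U)"
proof
  fix x
  have m: "gradient K \<in> borel_measurable borel"
    by (rule borel_measurable_continuous_onI[OF test_function_continuous_gradient[OF K]])
  have ig: "integrable (lebesgue_in U) (\<lambda>y. u y *\<^sub>R gradient K (x - y))"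
  proof -
    have "integrable (lebesgue_in U) (\<lambda>y. \<Sum>i\<in>Basis. (u y * pderiv_at i K (x - y)) *\<^sub>R i)"
      by (intro Bochner_Integration.integrable_sum integrable_scaleR_left
          integrable_mult_test_function[OF u test_function_pderiv[OF K]])
    then show ?thesis by (simp add: gradient_def scaleR_sum_right)
  qed
  have "pderiv_at i (\<lambda>x. \<integral>y. u y * K (x - y) \<partial>lebesgue_in U) x
      = i \<bullet> (\<integral>y. u y *\<^sub>R gradient K (x - y) \<partial>lebesgue_in U)"
    by (rule pderiv_at_eq[OF convolution_has_derivative[OF u K]])
  also have "\<dots> = (\<integral>y. i \<bullet> (u y *\<^sub>R gradient K (x - y)) \<partial>lebesgue_in U)"
    by (rule integral_inner_right[OF ig, symmetric])
  finally show "pderiv_at i (\<lambda>x. \<integral>y. u y * K (x - y) \<partial>lebesgue_in U) x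
      = (\<integral>y. u y * pderiv_at i K (x - y) \<partial>lebesgue_in U)"
    by (simp add: inner_commute[of i] inner_gradient_Basis[OF i])
qed

lemma convolution_Ck:
  fixes K :: "'a::euclidean_space \<Rightarrow> real"
  assumes u: "integrable (lebesgue_in U) u"
  shows "test_function V K \<Longrightarrow> Ck_on n UNIV (\<lambda>x. \<integral>y. u y * K (x - y) \<partial>lebesgue_in U)"
proof (induction n arbitrary: K)
  case 0
  show ?case using convolution_has_derivative[OF u 0]
    by (auto intro!: continuous_at_imp_continuous_on has_derivative_continuous)
next
  case (Suc n)
  have "(\<lambda>x. \<integral>y. u y * K (x - y) \<partial>lebesgue_in U) differentiable (at x)" for x
    using convolution_has_derivative[OF u Suc.prems] unfolding differentiable_def by blast
  moreover have "Ck_on n UNIV (pderiv_at i (\<lambda>x. \<integral>y. u y * K (x - y) \<partial>lebesgue_in U))" if "i \<in> Basis" for i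
    unfolding convolution_pderiv[OF u Suc.prems that] by (rule Suc.IH[OF test_function_pderiv[OF Suc.prems that]])
  ultimately show ?case by simp
qed

lemma convolution_laplacian:
  fixes K :: "'a::euclidean_space \<Rightarrow> real"
  assumes u: "integrable (lebesgue_in U) u" and K: "test_function V K"
  shows "laplacian (\<lambda>x. \<integral>y. u y * K (x - y) \<partial>lebesgue_in U) x
    = (\<integral>y. u y * laplacian K (x - y) \<partial>lebesgue_in U)"
proof -
  have "laplacian (\<lambda>x. \<integral>y. u y * K (x - y) \<partial>lebesgue_in U) x
      = (\<Sum>i\<in>Basis. \<integral>y. u y * pderiv_at i (pderiv_at i K) (x - y) \<partial>lebesgue_in U)"
    unfolding laplacian_def
    by (intro sum.cong refl)
      (simp add: convolution_pderiv[OF u K] convolution_pderiv[OF u test_function_pderiv[OF K]])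
  also have "\<dots> = (\<integral>y. (\<Sum>i\<in>Basis. u y * pderiv_at i (pderiv_at i K) (x - y)) \<partial>lebesgue_in U)"
    by (rule Bochner_Integration.integral_sum[symmetric])
      (rule integrable_mult_test_function[OF u test_function_pderiv[OF test_function_pderiv[OF K]]])
  finally show ?thesis by (simp add: laplacian_def sum_distrib_left)
qed

text \<open>Both derivatives go to the test function: one by the definition of the weak gradient, applied to
\<open>\<partial>\<^sub>i \<xi>\<close>, the other by the weak equation.\<close>

lemma weak_eigenfunction_laplacian:
  assumes U: "open U" and H: "H10 U u G"
    and eq: "\<And>v H. H10 U v H \<Longrightarrow> (\<integral>x. G x \<bullet> H x \<partial>lebesgue_in U) = \<mu> * (\<integral>x. u x \<bullet> v x \<partial>lebesgue_in U)"
    and \<xi>: "test_function U \<xi>"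
  shows "(\<integral>x. u x * laplacian \<xi> x \<partial>lebesgue_in U) = - \<mu> * (\<integral>x. u x * \<xi> x \<partial>lebesgue_in U)"
proof -
  let ?M = "lebesgue_in U"
  have L2: "L2 ?M u" "L2 ?M G" and wg: "weak_gradient_on U u G"
    using H U by (auto simp: H10_def H1_def L2_on_iff)
  note p = test_function_pderiv[OF \<xi>]
  have i1: "integrable ?M (\<lambda>x. u x * pderiv_at i (pderiv_at i \<xi>) x)" if "i \<in> Basis" for i
    using L2_inner_integrable[OF L2(1) test_function_L2(1)[OF U test_function_pderiv[OF p[OF that] that]]] by simp
  have i2: "integrable ?M (\<lambda>x. (G x \<bullet> i) * pderiv_at i \<xi> x)" if "i \<in> Basis" for i
    using L2_inner_integrable[OF L2_inner_const[OF L2(2)] test_function_L2(1)[OF U p[OF that]]] by simp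
  have "(\<integral>x. u x * laplacian \<xi> x \<partial>?M) = (\<Sum>i\<in>Basis. \<integral>x. u x * pderiv_at i (pderiv_at i \<xi>) x \<partial>?M)"
    using i1 by (simp add: laplacian_def sum_distrib_left)
  also have "\<dots> = (\<Sum>i\<in>Basis. - (\<integral>x. (G x \<bullet> i) * pderiv_at i \<xi> x \<partial>?M))"
    using wg p unfolding weak_gradient_on_def set_integral_eq[OF U] by (intro sum.cong refl) blast
  also have "\<dots> = - (\<integral>x. (\<Sum>i\<in>Basis. (G x \<bullet> i) * pderiv_at i \<xi> x) \<partial>?M)"
    using i2 by (simp add: sum_negf)
  also have "(\<lambda>x. \<Sum>i\<in>Basis. (G x \<bullet> i) * pderiv_at i \<xi> x) = (\<lambda>x. G x \<bullet> gradient \<xi> x)"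
    by (simp add: gradient_def inner_sum_right mult.commute)
  also have "(\<integral>x. G x \<bullet> gradient \<xi> x \<partial>?M) = \<mu> * (\<integral>x. u x \<bullet> \<xi> x \<partial>?M)"
  proof (rule eq)
    show "H10 U \<xi> (gradient \<xi>)"
      by (rule H10_limit[OF U, of "\<lambda>_. \<xi>"]) (auto intro: \<xi> test_function_L2[OF U \<xi>])
  qed
  finally show ?thesis by simp
qed

section \<open>A mean value property of weak solutions\<close>

text \<open>The profile, in \<open>t = |x|\<^sup>2\<close>, of a smooth function supported in the ball of radius \<open>s\<close>. In dimension
\<open>d\<close> the factor makes its integral independent of \<open>s\<close>, so that its derivative in \<open>s\<close> is a divergence.\<close>

definition bump :: "nat \<Rightarrow> real \<Rightarrow> real \<Rightarrow> real" where
  "bump d s t = flat 0 (1 - t / s\<^sup>2) / s ^ d"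

lemma bump_nonneg: "s > 0 \<Longrightarrow> bump d s t \<ge> 0"
  using flat_le[of 0] by (simp add: bump_def)

lemma bump_pos: "s > 0 \<Longrightarrow> t < s\<^sup>2 \<Longrightarrow> bump d s t > 0"
  unfolding bump_def by (intro divide_pos_pos flat_pos) auto

lemma bump_0: "s > 0 \<Longrightarrow> t \<ge> s\<^sup>2 \<Longrightarrow> bump d s t = 0"
  by (simp add: bump_def flat_def field_simps)

lemma Ck_on_bump: "Ck_on k UNIV (bump d s)"
proof -
  have "Ck_on k UNIV (\<lambda>t. flat 0 (1 - (1 / s\<^sup>2) * t))"
    by (rule Ck_on_compose[OF open_UNIV Ck_on_flat])
      (intro Ck_on_diff Ck_on_const Ck_on_cmult Ck_on_ident open_UNIV subset_UNIV)+
  from Ck_on_cmult[OF open_UNIV this, of "1 / s ^ d"] show ?thesis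
    by (simp add: bump_def[abs_def])
qed

lemma DERIV_bump:
  "(bump d s has_real_derivative - flat 2 (1 - t / s\<^sup>2) / s ^ (d + 2)) (at t)"
proof -
  have "((\<lambda>t. 1 - t / s\<^sup>2) has_real_derivative - (1 / s\<^sup>2)) (at t)"
    by (rule DERIV_cong[OF DERIV_diff[OF DERIV_const DERIV_cdivide[OF DERIV_ident]]]) simp
  from DERIV_chain2[OF DERIV_flat[of 0] this]
  have "((\<lambda>t. flat 0 (1 - t / s\<^sup>2)) has_real_derivative flat 2 (1 - t / s\<^sup>2) * (- (1 / s\<^sup>2))) (at t)"
    by (simp add: numeral_2_eq_2)
  from DERIV_cdivide[OF this, of "s ^ d"] show ?thesis
    by (simp add: bump_def[abs_def] power_add power2_eq_square mult_ac)
qed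

definition bump_ds :: "nat \<Rightarrow> real \<Rightarrow> real \<Rightarrow> real" where
  "bump_ds d s t = (2 * t * flat 2 (1 - t / s\<^sup>2) / s\<^sup>2 - d * flat 0 (1 - t / s\<^sup>2)) / s ^ (d + 1)"

lemma DERIV_bump_scale:
  assumes "s > 0"
  shows "((\<lambda>s. bump d s t) has_real_derivative bump_ds d s t) (at s)"
proof -
  have "((\<lambda>s. 1 - t / s\<^sup>2) has_real_derivative 2 * t / s ^ 3) (at s)"
    using assms by (auto intro!: derivative_eq_intros simp: field_simps power2_eq_square power3_eq_cube)
  from DERIV_chain2[OF DERIV_flat[of 0] this]
  have 1: "((\<lambda>s. flat 0 (1 - t / s\<^sup>2)) has_real_derivative flat 2 (1 - t / s\<^sup>2) * (2 * t / s ^ 3)) (at s)"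
    by (simp add: numeral_2_eq_2)
  have 2: "((\<lambda>s. s ^ d) has_real_derivative real d * s ^ d / s) (at s)"
    using DERIV_pow[of d s] assms by (cases d) auto
  have "((\<lambda>s. flat 0 (1 - t / s\<^sup>2) / s ^ d) has_real_derivative
      (flat 2 (1 - t / s\<^sup>2) * (2 * t / s ^ 3) * s ^ d - flat 0 (1 - t / s\<^sup>2) * (real d * s ^ d / s)) / (s ^ d * s ^ d)) (at s)"
    by (rule DERIV_divide[OF 1 2]) (use assms in simp)
  moreover have "(flat 2 (1 - t / s\<^sup>2) * (2 * t / s ^ 3) * s ^ d - flat 0 (1 - t / s\<^sup>2) * (real d * s ^ d / s)) / (s ^ d * s ^ d)
      = bump_ds d s t"
    using assms by (simp add: bump_ds_def divide_simps power3_eq_cube power2_eq_square) (simp add: algebra_simps)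
  ultimately show ?thesis unfolding bump_def by simp
qed

text \<open>The derivative in \<open>s\<close> of \<open>\<eta>\<^sub>s(x) = s\<^sup>-\<^sup>d \<eta>(x / s)\<close> is \<open>- div (x \<eta>\<^sub>s) / s\<close>; the second summand
contains the derivative of the profile.\<close>

lemma bump_ds_eq:
  assumes "s > 0"
  shows "bump_ds d s t = - (d * bump d s t + 2 * t * (- flat 2 (1 - t / s\<^sup>2) / s ^ (d + 2))) / s"
  using assms by (simp add: bump_ds_def bump_def divide_simps power2_eq_square)

text \<open>The radius \<open>sqrt \<rho>\<close> is one up to which the radial solution stays positive, so that division by it is
harmless. The function \<open>u\<close> is a solution in the sense of distributions.\<close>

locale weak_helmholtz =
  fixes \<mu> \<rho> :: real and U :: "'a::euclidean_space set" and u :: "'a \<Rightarrow> real"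
  assumes \<rho>: "\<rho> > 0" and bess_pos: "\<And>t. t < \<rho> \<Longrightarrow> bess (- \<mu> / 4) (DIM('a) / 2) t > 0"
    and U: "open U"
    and u: "integrable (lebesgue_in U) u"
    and weak: "\<And>\<xi>. test_function U \<xi> \<Longrightarrow>
      (\<integral>y. u y * laplacian \<xi> y \<partial>lebesgue_in U) = - \<mu> * (\<integral>y. u y * \<xi> y \<partial>lebesgue_in U)"
begin

definition radial_solution :: "real \<Rightarrow> real" where "radial_solution = bess (- \<mu> / 4) (DIM('a) / 2)"

text \<open>The averaging kernel \<open>\<eta>\<^sub>s / j\<close> in the variable \<open>t = |x|\<^sup>2\<close>, with the bump \<open>\<eta>\<^sub>s\<close> and the radial
solution \<open>j\<close>. For \<open>t \<ge> \<rho>\<close> the denominator may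
vanish, but if \<open>s\<^sup>2 < \<rho>\<close> then so does the numerator.\<close>

definition kernel :: "real \<Rightarrow> real \<Rightarrow> real" where "kernel s t = bump DIM('a) s t / radial_solution t"

lemma radial_solution_pos: "t < \<rho> \<Longrightarrow> radial_solution t > 0"
  using bess_pos by (simp add: radial_solution_def)

lemma Ck_on_radial_solution: "Ck_on k UNIV radial_solution"
  unfolding radial_solution_def by (rule Ck_on_bess) simp

lemma kernel_nonneg: "s > 0 \<Longrightarrow> s\<^sup>2 < \<rho> \<Longrightarrow> kernel s t \<ge> 0"
  using bump_nonneg[of s "DIM('a)" t] bump_0[of s t "DIM('a)"] radial_solution_pos[of t]
  by (cases "t < \<rho>") (auto simp: kernel_def)

lemma kernel_pos: "s > 0 \<Longrightarrow> s\<^sup>2 < \<rho> \<Longrightarrow> t < s\<^sup>2 \<Longrightarrow> kernel s t > 0"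
  using bump_pos[of s t "DIM('a)"] radial_solution_pos[of t] by (auto simp: kernel_def)

lemma kernel_0: "s > 0 \<Longrightarrow> t \<ge> s\<^sup>2 \<Longrightarrow> kernel s t = 0"
  by (simp add: kernel_def bump_0)

lemma Ck_on_kernel:
  assumes s: "s > 0" "s\<^sup>2 < \<rho>" shows "Ck_on k UNIV (kernel s)"
proof (rule Ck_on_local)
  fix t :: real
  show "\<exists>N. open N \<and> t \<in> N \<and> Ck_on k N (kernel s)"
  proof (cases "t < \<rho>")
    case True
    have "Ck_on k {..<\<rho>} (kernel s)" unfolding kernel_def[abs_def]
      by (rule Ck_on_divide[OF _ Ck_on_mono[OF Ck_on_bump] Ck_on_mono[OF Ck_on_radial_solution]]) (use radial_solution_pos in fastforce)+
    then show ?thesis using True by (intro exI[of _ "{..<\<rho>}"]) auto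
  next
    case False
    have "Ck_on k {s\<^sup>2<..} (kernel s)"
      by (rule Ck_on_cong[OF _ _ Ck_on_const[of _ _ 0]]) (use s in \<open>auto simp: kernel_0\<close>)
    then show ?thesis using False s by (intro exI[of _ "{s\<^sup>2<..}"]) auto
  qed
qed

lemma test_function_kernel:
  assumes "s > 0" "s\<^sup>2 < \<rho>" "cball x s \<subseteq> V"
  shows "test_function V (\<lambda>y. kernel s ((norm (y - x :: 'a))\<^sup>2))"
  by (rule test_function_radial[where s = s]) (use assms Ck_on_kernel kernel_0 in auto)

definition kernel_ds :: "real \<Rightarrow> real \<Rightarrow> real" where "kernel_ds s t = bump_ds DIM('a) s t / radial_solution t"

lemma DERIV_kernel: "s > 0 \<Longrightarrow> ((\<lambda>s. kernel s t) has_real_derivative kernel_ds s t) (at s)"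
  unfolding kernel_def kernel_ds_def by (intro DERIV_cdivide DERIV_bump_scale)

lemma kernel_ds_0: "s > 0 \<Longrightarrow> t \<ge> s\<^sup>2 \<Longrightarrow> kernel_ds s t = 0"
  by (simp add: kernel_ds_def bump_ds_def flat_def field_simps)

lemma continuous_flat: "continuous_on S (flat n)"
  using Ck_on_imp_continuous_on[OF Ck_on_flat[of 0 n]] by (rule continuous_on_subset) simp

text \<open>Needed to differentiate averages in the radius under the integral sign.\<close>

lemma kernel_ds_bounded:
  assumes a: "0 < a" "b\<^sup>2 < \<rho>"
  obtains B where "\<And>s t. a \<le> s \<Longrightarrow> s \<le> b \<Longrightarrow> t \<ge> 0 \<Longrightarrow> \<bar>kernel_ds s t\<bar> \<le> B"
proof -
  let ?C = "{a..b} \<times> {0..b\<^sup>2}" and ?f = "\<lambda>p. kernel_ds (fst p) (snd p)"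
  have j0: "radial_solution (snd p) \<noteq> 0" if "p \<in> ?C" for p using radial_solution_pos[of "snd p"] that a(2) by auto
  have cj: "continuous_on ?C (\<lambda>p. radial_solution (snd p))"
    by (rule continuous_on_compose2[OF Ck_on_imp_continuous_on[OF Ck_on_radial_solution[of 0]]]) (auto intro!: continuous_intros)
  have cf: "continuous_on ?C (\<lambda>p. flat n (1 - snd p / (fst p)\<^sup>2))" for n
    by (rule continuous_on_compose2[OF continuous_flat[of UNIV]]) (use a(1) in \<open>auto intro!: continuous_intros\<close>)
  have "continuous_on ?C ?f"
    unfolding kernel_ds_def bump_ds_def
    by (intro continuous_intros cj cf) (use a(1) j0 in auto)
  then have "bounded (?f ` ?C)"
    by (intro compact_imp_bounded compact_continuous_image compact_Times compact_Icc)
  then obtain B where "\<forall>z\<in>?f ` ?C. norm z \<le> B" unfolding bounded_iff by blast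
  then have B: "\<bar>?f p\<bar> \<le> B" if "p \<in> ?C" for p using that by fastforce
  have "\<bar>kernel_ds s t\<bar> \<le> max 0 B" if "a \<le> s" "s \<le> b" "t \<ge> 0" for s t
  proof (cases "t \<le> b\<^sup>2")
    case True
    then show ?thesis using B[of "(s, t)"] that by simp
  next
    case False
    have "s\<^sup>2 \<le> b\<^sup>2" using that a(1) by (intro power_mono) auto
    then have "s\<^sup>2 \<le> t" using False by linarith
    then show ?thesis using kernel_ds_0[of s t] that a(1) by simp
  qed
  then show ?thesis by (rule that)
qed

text \<open>The identity behind the mean value property, obtained from \<open>radial_primitive\<close> with \<open>w = \<eta>\<^sub>s\<close>.\<close>

lemma kernel_ds_is_helmholtz:
  assumes s: "s > 0" "s\<^sup>2 < \<rho>" "cball x s \<subseteq> V"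
  obtains \<xi> where "test_function V \<xi>"
    "\<And>y. laplacian \<xi> y + \<mu> * \<xi> y = kernel_ds s ((norm (y - x :: 'a))\<^sup>2)"
proof -
  let ?m = "DIM('a)"
  have m: "real ?m > 0" by simp
  show ?thesis
  proof (rule radial_primitive[where m = "real ?m" and r = "s\<^sup>2" and w = "bump ?m s",
        OF m s(2) bess_pos DERIV_bump Ck_on_bump bump_0[OF s(1)]])
    fix F F' F'' :: "real \<Rightarrow> real" assume F0: "\<And>k. Ck_on k UNIV F" "\<And>t. t \<ge> s\<^sup>2 \<Longrightarrow> F t = 0"
      "\<And>t. (F has_real_derivative F' t) (at t)" "\<And>t. (F' has_real_derivative F'' t) (at t)"
      "\<And>t. 4 * t * F'' t + 2 * real ?m * F' t + \<mu> * F t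
        = - (?m * bump ?m s t + 2 * t * (- flat 2 (1 - t / s\<^sup>2) / s ^ (?m + 2)))
          / bess (- \<mu> / 4) (real ?m / 2) t"
    note F = F0(1-4) F0(5)[folded radial_solution_def]
    define f where "f t = F t / s" for t
    have f: "Ck_on k UNIV f" for k
      using Ck_on_cmult[OF open_UNIV F(1), where c = "1 / s"] by (simp add: f_def[abs_def])
    have f0: "f t = 0" if "t \<ge> s\<^sup>2" for t using F(2)[OF that] by (simp add: f_def)
    have f': "(f has_real_derivative F' t / s) (at t)" for t
      unfolding f_def[abs_def] by (rule DERIV_cdivide[OF F(3)])
    have f'': "((\<lambda>t. F' t / s) has_real_derivative F'' t / s) (at t)" for t by (rule DERIV_cdivide[OF F(4)])
    show ?thesis
    proof (rule that)
      show "test_function V (\<lambda>y. f ((norm (y - x))\<^sup>2))"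
        by (rule test_function_radial[OF f f0]) (use s in auto)
      fix y
      let ?t = "(norm (y - x))\<^sup>2"
      have "laplacian (\<lambda>y. f ((norm (y - x))\<^sup>2)) y + \<mu> * f ?t
          = (4 * ?t * F'' ?t + 2 * real ?m * F' ?t + \<mu> * F ?t) / s"
        unfolding laplacian_radial[OF f' f''] by (simp add: f_def add_divide_distrib)
      also have "\<dots> = kernel_ds s ?t"
        unfolding F(5) kernel_ds_def bump_ds_eq[OF s(1)] by simp
      finally show "laplacian (\<lambda>y. f ((norm (y - x))\<^sup>2)) y + \<mu> * f ?t = kernel_ds s ?t" .
    qed
  qed
qed

definition average :: "real \<Rightarrow> 'a \<Rightarrow> real" where
  "average s x = (\<integral>y. u y * kernel s ((norm (x - y))\<^sup>2) \<partial>lebesgue_in U)"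

abbreviation admissible :: "'a \<Rightarrow> real \<Rightarrow> bool" where
  "admissible x s \<equiv> s > 0 \<and> s\<^sup>2 < \<rho> \<and> cball x s \<subseteq> U"

lemma ex_admissible:
  assumes "x \<in> U" shows "\<exists>s. admissible x s"
proof -
  obtain e where e: "e > 0" "cball x e \<subseteq> U" using assms U open_contains_cball by blast
  define s where "s = min e (sqrt \<rho> / 2)"
  have s: "s > 0" "s \<le> e" "s < sqrt \<rho>" using e \<rho> by (auto simp: s_def min_less_iff_disj)
  then have "s\<^sup>2 < (sqrt \<rho>)\<^sup>2" by (intro power_strict_mono) auto
  then show ?thesis using s e \<rho> by (intro exI[of _ s]) auto
qed

lemma integrable_average:
  assumes "s > 0" "s\<^sup>2 < \<rho>"
  shows "integrable (lebesgue_in U) (\<lambda>y. u y * kernel s ((norm (x - y))\<^sup>2))"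
  using integrable_mult_test_function[OF u test_function_kernel[of s 0 UNIV], of x] assms by simp

lemma Ck_on_average:
  assumes "s > 0" "s\<^sup>2 < \<rho>" shows "Ck_on n UNIV (average s)"
  using convolution_Ck[OF u test_function_kernel[of s 0 UNIV], of n] assms by (simp add: average_def[abs_def])

text \<open>The Laplacian in the centre \<open>x\<close> equals the Laplacian in the integration variable, where the kernel is
an admissible test function.\<close>

lemma laplacian_average:
  assumes s: "admissible x s" shows "laplacian (average s) x = - \<mu> * average s x"
proof -
  define f' where "f' = pderiv_at 1 (kernel s)"
  define f'' where "f'' = pderiv_at 1 f'"
  have f': "(kernel s has_real_derivative f' t) (at t)" for t
    unfolding f'_def by (rule Ck_on_real_SucD[of 0 UNIV]) (use Ck_on_kernel[of s "Suc 0"] s in auto)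
  have f'': "(f' has_real_derivative f'' t) (at t)" for t
    unfolding f''_def
    by (rule Ck_on_real_SucD[of 0 UNIV]) (use Ck_on_kernel[of s 2] s in \<open>auto simp: f'_def numeral_2_eq_2\<close>)
  have T: "test_function UNIV (\<lambda>y. kernel s ((norm (y - 0 :: 'a))\<^sup>2))"
    by (rule test_function_kernel) (use s in auto)
  let ?\<xi> = "\<lambda>y. kernel s ((norm (y - x))\<^sup>2)"
  have T': "test_function U ?\<xi>" by (rule test_function_kernel) (use s in auto)
  have "laplacian (average s) x = (\<integral>y. u y * laplacian (\<lambda>y. kernel s ((norm (y - 0 :: 'a))\<^sup>2)) (x - y) \<partial>lebesgue_in U)"
    using convolution_laplacian[OF u T, of x] by (simp add: average_def[abs_def])
  also have "\<dots> = (\<integral>y. u y * laplacian ?\<xi> y \<partial>lebesgue_in U)"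
    unfolding laplacian_radial[OF f' f''] by (simp add: norm_minus_commute)
  also have "\<dots> = - \<mu> * (\<integral>y. u y * ?\<xi> y \<partial>lebesgue_in U)" by (rule weak[OF T'])
  finally show ?thesis by (simp add: average_def norm_minus_commute)
qed

text \<open>Differentiation under the integral sign pairs \<open>u\<close> with \<open>kernel_ds\<close>, which is \<open>\<Delta> + \<mu>\<close> applied to a test
function; this pairing vanishes for a weak solution.\<close>

lemma DERIV_average:
  assumes s: "admissible x s" shows "((\<lambda>s. average s x) has_real_derivative 0) (at s)"
proof -
  define \<delta> where "\<delta> = min (s / 2) ((sqrt \<rho> - s) / 2)"
  have "s < sqrt \<rho>" using s by (simp add: real_less_rsqrt)
  then have \<delta>: "\<delta> > 0" "s - \<delta> > 0" "s + \<delta> < sqrt \<rho>" using s by (auto simp: \<delta>_def min_def field_simps)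
  have b: "(s + \<delta>)\<^sup>2 < \<rho>"
  proof -
    have "(s + \<delta>)\<^sup>2 < (sqrt \<rho>)\<^sup>2" using \<delta> by (intro power_strict_mono) auto
    then show ?thesis using \<rho> by simp
  qed
  obtain B where B: "\<And>r t. s - \<delta> \<le> r \<Longrightarrow> r \<le> s + \<delta> \<Longrightarrow> t \<ge> 0 \<Longrightarrow> \<bar>kernel_ds r t\<bar> \<le> B"
    by (rule kernel_ds_bounded[OF \<delta>(2) b]) blast
  have r: "r > 0" "r\<^sup>2 < \<rho>" "s - \<delta> \<le> r" "r \<le> s + \<delta>" if "r \<in> ball s \<delta>" for r
  proof -
    have "\<bar>s - r\<bar> < \<delta>" using that by (simp add: dist_real_def)
    then show "r > 0" "s - \<delta> \<le> r" "r \<le> s + \<delta>" using \<delta> by auto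
    then have "r\<^sup>2 \<le> (s + \<delta>)\<^sup>2" by (intro power_mono) auto
    then show "r\<^sup>2 < \<rho>" using b by simp
  qed
  obtain \<xi> where \<xi>: "test_function U \<xi>"
    "\<And>y. laplacian \<xi> y + \<mu> * \<xi> y = kernel_ds s ((norm (y - x))\<^sup>2)"
    by (rule kernel_ds_is_helmholtz[of s x U]) (use s in auto)
  have eq: "kernel_ds s ((norm (x - y))\<^sup>2) = laplacian \<xi> y + \<mu> * \<xi> y" for y
    using \<xi>(2)[of y] by (simp add: norm_minus_commute)
  have i\<xi>: "integrable (lebesgue_in U) (\<lambda>y. u y * \<zeta> y)" if "test_function U \<zeta>" for \<zeta>
  proof -
    obtain B where "\<And>y. \<bar>\<zeta> y\<bar> \<le> B" using test_function_bounded[OF \<open>test_function U \<zeta>\<close>] by blast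
    then show ?thesis
      using test_function_L2(1)[OF U \<open>test_function U \<zeta>\<close>] u
      by (intro integrable_mult_bounded[where B = B]) (auto simp: L2_def)
  qed
  have "((\<lambda>s. average s x) has_derivative (\<lambda>h. h \<bullet> (\<integral>y. u y *\<^sub>R kernel_ds s ((norm (x - y))\<^sup>2) \<partial>lebesgue_in U))) (at s)"
    unfolding average_def
  proof (rule has_derivative_parametric_integral[OF u \<delta>(1), where B = B])
    fix p y assume p: "p \<in> ball s \<delta>"
    show "((\<lambda>p. kernel p ((norm (x - y))\<^sup>2)) has_derivative (\<lambda>h. h \<bullet> kernel_ds p ((norm (x - y))\<^sup>2))) (at p)"
    proof -
      have "(\<lambda>h. h \<bullet> c) = (*) c" for c :: real by (auto simp: mult.commute)
      then show ?thesis using DERIV_kernel[OF r(1)[OF p], of "(norm (x - y))\<^sup>2"]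
        by (simp only: has_field_derivative_def)
    qed
    show "norm (kernel_ds p ((norm (x - y))\<^sup>2)) \<le> B" using B r[OF p] by simp
    show "integrable (lebesgue_in U) (\<lambda>y. u y * kernel p ((norm (x - y))\<^sup>2))"
      by (rule integrable_average) (use r[OF p] in auto)
  next
    show "(\<lambda>y. kernel_ds s ((norm (x - y))\<^sup>2)) \<in> borel_measurable (lebesgue_in U)"
      unfolding eq using test_function_L2(1)[OF U \<xi>(1)] test_function_L2(1)[OF U laplacian_test_function[OF \<xi>(1)]]
      by (auto simp: L2_def)
  qed
  moreover have "(\<integral>y. u y *\<^sub>R kernel_ds s ((norm (x - y))\<^sup>2) \<partial>lebesgue_in U) = 0"
  proof -
    have "(\<integral>y. u y *\<^sub>R kernel_ds s ((norm (x - y))\<^sup>2) \<partial>lebesgue_in U)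
        = (\<integral>y. u y * laplacian \<xi> y + \<mu> * (u y * \<xi> y) \<partial>lebesgue_in U)"
      by (simp add: eq algebra_simps)
    also have "\<dots> = (\<integral>y. u y * laplacian \<xi> y \<partial>lebesgue_in U) + \<mu> * (\<integral>y. u y * \<xi> y \<partial>lebesgue_in U)"
      using i\<xi>[OF \<xi>(1)] i\<xi>[OF laplacian_test_function[OF \<xi>(1)]] by simp
    also have "\<dots> = 0" by (simp add: weak[OF \<xi>(1)])
    finally show ?thesis .
  qed
  ultimately show ?thesis by (simp add: has_field_derivative_def lambda_zero)
qed

text \<open>By \<open>DERIV_average\<close>: radii between two admissible ones are admissible.\<close>

lemma average_independent:
  assumes "admissible x r" "admissible x s" shows "average r x = average s x"
proof -
  have *: "average a x = average b x" if ab: "a < b" "admissible x a" "admissible x b" for a b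
  proof -
    have adm: "admissible x c" if "a \<le> c" "c \<le> b" for c
    proof -
      have "c\<^sup>2 \<le> b\<^sup>2" using that ab by (intro power_mono) auto
      then have "c\<^sup>2 < \<rho>" using ab(3) by linarith
      moreover have "cball x c \<subseteq> cball x b" using that by (intro subset_cball) simp
      ultimately show ?thesis using that ab by auto
    qed
    obtain z where "average b x - average a x = (b - a) * 0"
      using MVT2[of a b "\<lambda>s. average s x" "\<lambda>_. 0"] ab(1) DERIV_average adm by blast
    then show ?thesis by simp
  qed
  then show ?thesis using assms by (cases r s rule: linorder_cases) metis+
qed

text \<open>One radius does not serve all points, but by \<open>average_independent\<close> the choice is immaterial, and
locally a constant radius can be used.\<close>

definition mean_value :: "'a \<Rightarrow> real" where "mean_value x = average (SOME s. admissible x s) x"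

lemma mean_value_eq: assumes "admissible x s" shows "mean_value x = average s x"
  unfolding mean_value_def using someI[of "admissible x" s] assms by (intro average_independent) auto

lemma mean_value_local:
  assumes "admissible x s" "y \<in> ball x (s / 2)"
  shows "admissible y (s / 2)" "mean_value y = average (s / 2) y"
proof -
  have "(s / 2)\<^sup>2 \<le> s\<^sup>2" using assms by (intro power_mono) auto
  then have "(s / 2)\<^sup>2 < \<rho>" using assms(1) by linarith
  moreover have "cball y (s / 2) \<subseteq> cball x s"
  proof
    fix z assume "z \<in> cball y (s / 2)"
    then show "z \<in> cball x s" using assms(2) dist_triangle[of x z y] by simp
  qed
  ultimately show "admissible y (s / 2)" using assms(1) by auto
  then show "mean_value y = average (s / 2) y" by (rule mean_value_eq)
qed

lemma Ck_on_mean_value: "Ck_on n U mean_value"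
proof (rule Ck_on_local)
  fix x assume "x \<in> U"
  then obtain s where s: "admissible x s" using ex_admissible by blast
  have s2: "s / 2 > 0" "(s / 2)\<^sup>2 < \<rho>" using mean_value_local(1)[OF s, of x] s by auto
  have "Ck_on n (ball x (s / 2)) mean_value"
    by (rule Ck_on_cong[OF _ _ Ck_on_mono[OF Ck_on_average[OF s2]]]) (use mean_value_local(2)[OF s] in auto)
  then show "\<exists>N. open N \<and> x \<in> N \<and> Ck_on n N mean_value" using s by (intro exI[of _ "ball x (s / 2)"]) auto
qed

lemma laplacian_cong_open:
  assumes "open S" "x \<in> S" "\<And>y. y \<in> S \<Longrightarrow> f y = g y"
  shows "laplacian f x = laplacian g x"
  unfolding laplacian_def
  by (intro sum.cong refl pderiv_at_cong_open[OF assms(1,2)] pderiv_at_cong_open[OF assms(1)] assms(3))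

lemma laplacian_mean_value: assumes "x \<in> U" shows "laplacian mean_value x = - \<mu> * mean_value x"
proof -
  obtain s where s: "admissible x s" using ex_admissible[OF assms] by blast
  have xb: "x \<in> ball x (s / 2)" using s by simp
  have "laplacian mean_value x = laplacian (average (s / 2)) x"
    by (rule laplacian_cong_open[OF open_ball xb mean_value_local(2)[OF s]])
  then show ?thesis using laplacian_average[OF mean_value_local(1)[OF s xb]] mean_value_local(2)[OF s xb] by simp
qed

lemma mean_value_nonneg:
  assumes "AE y in lebesgue_in U. u y \<ge> 0" "x \<in> U" shows "mean_value x \<ge> 0"
proof -
  obtain s where s: "admissible x s" using ex_admissible[OF assms(2)] by blast
  show ?thesis unfolding mean_value_eq[OF s] average_def
    by (rule integral_nonneg_AE) (use assms(1) kernel_nonneg s in \<open>auto intro!: mult_nonneg_nonneg elim!: eventually_mono\<close>)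
qed

text \<open>The integrand is nonnegative and the kernel is positive inside its ball.\<close>

lemma mean_value_zero_imp:
  assumes nn: "AE y in lebesgue_in U. u y \<ge> 0" and s: "admissible x s" and v0: "mean_value x = 0"
  shows "AE y in lebesgue_in U. y \<in> ball x s \<longrightarrow> u y = 0"
proof -
  have "AE y in lebesgue_in U. u y * kernel s ((norm (x - y))\<^sup>2) = 0"
  proof (rule integral_nonneg_eq_0_iff_AE[THEN iffD1])
    show "integrable (lebesgue_in U) (\<lambda>y. u y * kernel s ((norm (x - y))\<^sup>2))" by (rule integrable_average) (use s in auto)
    show "AE y in lebesgue_in U. 0 \<le> u y * kernel s ((norm (x - y))\<^sup>2)"
      using nn kernel_nonneg s by (auto intro!: mult_nonneg_nonneg elim!: eventually_mono)
    show "(\<integral>y. u y * kernel s ((norm (x - y))\<^sup>2) \<partial>lebesgue_in U) = 0"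
      using v0 unfolding mean_value_eq[OF s] average_def .
  qed
  then show ?thesis
  proof eventually_elim
    case (elim y)
    have "kernel s ((norm (x - y))\<^sup>2) > 0" if "y \<in> ball x s"
      by (rule kernel_pos) (use s that in \<open>auto simp: dist_norm intro!: power_strict_mono\<close>)
    then show ?case using elim by auto
  qed
qed

text \<open>The strong maximum principle. If \<open>v(x) = 0\<close>, then \<open>u = 0\<close> almost everywhere on a ball around \<open>x\<close>, so
averages over smaller balls inside vanish and the zero set is open. It is not all of \<open>U\<close>, because by
Lindelof's theorem \<open>u\<close> would then vanish almost everywhere.\<close>

theorem mean_value_pos:
  assumes nn: "AE y in lebesgue_in U. u y \<ge> 0" and conn: "connected U"
    and nz: "\<not> (AE y in lebesgue_in U. u y = 0)" and x: "x \<in> U"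
  shows "mean_value x > 0"
proof -
  define Z where "Z = {x \<in> U. mean_value x = 0}"
  have "open Z" unfolding open_contains_ball
  proof
    fix x assume "x \<in> Z"
    then have x: "x \<in> U" "mean_value x = 0" by (auto simp: Z_def)
    obtain s where s: "admissible x s" using ex_admissible[OF x(1)] by blast
    have "y \<in> Z" if y: "y \<in> ball x (s / 2)" for y
    proof -
      note adm = mean_value_local(1)[OF s y]
      have "mean_value y = average (s / 2) y" by (rule mean_value_local(2)[OF s y])
      also have "\<dots> = (\<integral>z. 0 \<partial>lebesgue_in U)" unfolding average_def
      proof (rule integral_cong_AE)
        show "AE z in lebesgue_in U. u z * kernel (s / 2) ((norm (y - z))\<^sup>2) = 0"
          using mean_value_zero_imp[OF nn s x(2)]
        proof eventually_elim
          case (elim z)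
          show ?case
          proof (cases "z \<in> ball x s")
            case False
            then have "\<not> dist y z < s / 2" using y dist_triangle[of x z y] by simp
            then have "(norm (y - z))\<^sup>2 \<ge> (s / 2)\<^sup>2" using s by (intro power_mono) (auto simp: dist_norm)
            then show ?thesis using kernel_0[of "s / 2"] adm by simp
          qed (use elim in simp)
        qed
        show "(\<lambda>z. u z * kernel (s / 2) ((norm (y - z))\<^sup>2)) \<in> borel_measurable (lebesgue_in U)"
          using integrable_average[of "s / 2" y] adm by auto
      qed simp
      finally have "mean_value y = 0" by simp
      moreover have "y \<in> U" using adm by auto
      ultimately show ?thesis by (simp add: Z_def)
    qed
    then show "\<exists>e>0. ball x e \<subseteq> Z" using s by (intro exI[of _ "s / 2"]) auto
  qed
  moreover have "open (U - Z)"
  proof -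
    have "open (U \<inter> mean_value -` (- {0}))"
      by (rule continuous_open_preimage[OF Ck_on_imp_continuous_on[OF Ck_on_mean_value[of 0]] U]) auto
    moreover have "U \<inter> mean_value -` (- {0}) = U - Z" by (auto simp: Z_def)
    ultimately show ?thesis by simp
  qed
  ultimately have "Z = {} \<or> U - Z = {}"
    using connectedD[OF conn, of Z "U - Z"] by (auto simp: Z_def)
  moreover have "U - Z \<noteq> {}"
  proof
    assume "U - Z = {}"
    then have v0: "mean_value x = 0" if "x \<in> U" for x using that by (auto simp: Z_def)
    obtain \<sigma> where \<sigma>: "\<And>x. x \<in> U \<Longrightarrow> admissible x (\<sigma> x)" using ex_admissible by metis
    obtain F where F: "F \<subseteq> (\<lambda>x. ball x (\<sigma> x)) ` U" "countable F" "\<Union>F = (\<Union>x\<in>U. ball x (\<sigma> x))"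
      using Lindelof[of "(\<lambda>x. ball x (\<sigma> x)) ` U"] by auto
    have "AE y in lebesgue_in U. \<forall>B\<in>F. y \<in> B \<longrightarrow> u y = 0"
      unfolding AE_ball_countable[OF F(2)]
    proof
      fix B assume "B \<in> F"
      then obtain x where "x \<in> U" "B = ball x (\<sigma> x)" using F(1) by auto
      then show "AE y in lebesgue_in U. y \<in> B \<longrightarrow> u y = 0"
        using mean_value_zero_imp[OF nn \<sigma> v0] by simp
    qed
    moreover have "AE y in lebesgue_in U. y \<in> U"
      using AE_space[of "lebesgue_in U"] by (simp add: space_restrict_space)
    ultimately have "AE y in lebesgue_in U. u y = 0"
    proof eventually_elim
      case (elim y)
      have "y \<in> ball y (\<sigma> y)" using \<sigma>[OF elim(2)] by simp
      then have "y \<in> \<Union>F" using elim(2) unfolding F(3) by blast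
      then show ?case using elim(1) by blast
    qed
    then show False using nz by contradiction
  qed
  ultimately have "mean_value x \<noteq> 0" using x by (auto simp: Z_def)
  then show ?thesis using mean_value_nonneg[OF nn x] by simp
qed

end

section \<open>Positive solutions and the first eigenvalue\<close>

text \<open>Near \<open>0\<close> by continuity, and for negative arguments by \<open>bess_pos_nonpos\<close>.\<close>

lemma ex_bess_pos:
  assumes "c > 0" "\<mu> \<ge> 0"
  obtains \<rho> where "\<rho> > 0" "\<And>t. t < \<rho> \<Longrightarrow> bess (- \<mu> / 4) c t > 0"
proof -
  have "isCont (bess (- \<mu> / 4) c) 0" by (rule DERIV_isCont[OF DERIV_bess[OF assms(1)]])
  then have "(bess (- \<mu> / 4) c \<longlongrightarrow> 1) (at 0)" by (simp add: isCont_def)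
  then have "\<forall>\<^sub>F t in at 0. bess (- \<mu> / 4) c t > 0" by (rule order_tendstoD) simp
  then obtain \<rho> where \<rho>: "\<rho> > 0" "\<And>t. t \<noteq> 0 \<Longrightarrow> dist t 0 < \<rho> \<Longrightarrow> bess (- \<mu> / 4) c t > 0"
    by (auto simp: eventually_at)
  have "bess (- \<mu> / 4) c t > 0" if "t < \<rho>" for t
  proof (cases "t > 0")
    case True
    then show ?thesis using \<rho>(2)[of t] that by simp
  next
    case False
    then have "- \<mu> / 4 * t \<ge> 0" using assms(2) by (simp add: mult_nonneg_nonpos)
    then show ?thesis by (rule bess_pos_nonpos[OF assms(1)])
  qed
  with \<rho>(1) show ?thesis by (rule that)
qed

theorem ex_positive_eigenfunction:
  fixes U :: "'a::euclidean_space set"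
  assumes U: "open U" "bounded U" "U \<noteq> {}" "connected U"
  obtains v where "\<And>n. Ck_on n U v" "\<And>x. x \<in> U \<Longrightarrow> laplacian v x = - rayleigh_inf U * v x"
    "\<And>x. x \<in> U \<Longrightarrow> v x > 0"
proof -
  let ?M = "lebesgue_in U"
  obtain u G where H: "H10 U u G" and nz: "(\<integral>x. (norm (u x))\<^sup>2 \<partial>?M) > 0"
    and nn: "AE x in ?M. u x \<ge> 0"
    and eq: "\<And>v H. H10 U v H \<Longrightarrow> (\<integral>x. G x \<bullet> H x \<partial>?M) = rayleigh_inf U * (\<integral>x. u x \<bullet> v x \<partial>?M)"
    by (rule ground_state_exists[OF U(1-3)]) blast
  have L2: "L2 ?M u" using H U(1) by (auto simp: H10_def H1_def L2_on_iff)
  have int: "integrable ?M u"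
    by (rule finite_measure.L2_imp_integrable[OF finite_measure_lebesgue_in[OF U(1,2)] L2])
  obtain \<rho> where \<rho>: "\<rho> > 0" "\<And>t. t < \<rho> \<Longrightarrow> bess (- rayleigh_inf U / 4) (DIM('a) / 2) t > 0"
    using ex_bess_pos[OF _ rayleigh_inf_nonneg[OF U(1,3)], of "DIM('a) / 2"] by auto
  interpret W: weak_helmholtz "rayleigh_inf U" \<rho> U u
    by unfold_locales (use \<rho> U(1) int weak_eigenfunction_laplacian[OF U(1) H eq] in auto)
  have "\<not> (AE x in ?M. u x = 0)" using nz integral_square_eq_0_iff[OF L2] by auto
  then show ?thesis
    using that[of W.mean_value] W.Ck_on_mean_value W.laplacian_mean_value W.mean_value_pos[OF nn U(4)] by blast
qed

theorem proposition1p1: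
  fixes \<Omega> :: "(real ^ 'm) set" and k :: real
  assumes "CARD('m) = 2 \<or> CARD('m) = 3"
    and "\<Omega> \<noteq> {}" and "bounded \<Omega>" and "open \<Omega>" and "connected \<Omega>"
    and "k > 0"
  shows "(\<exists>v :: real ^ 'm \<Rightarrow> real.
            Ck_on 2 \<Omega> v \<and>
            (\<forall>x\<in>\<Omega>. laplacian v x + k\<^sup>2 * v x \<le> 0) \<and>
            (\<forall>x\<in>\<Omega>. v x > 0))
         \<longleftrightarrow> k\<^sup>2 \<le> first_dirichlet_eigenvalue \<Omega>"
  unfolding first_dirichlet_eigenvalue_eq[OF assms(4,3,2)]
proof
  assume "\<exists>v. Ck_on 2 \<Omega> v \<and> (\<forall>x\<in>\<Omega>. laplacian v x + k\<^sup>2 * v x \<le> 0) \<and> (\<forall>x\<in>\<Omega>. v x > 0)"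
  then have le: "k\<^sup>2 * mass \<phi> \<le> dirichlet_energy \<phi>" if "test_function \<Omega> \<phi>" for \<phi>
    using positive_supersolution_bound[OF assms(4) _ _ _ that] by blast
  show "k\<^sup>2 \<le> rayleigh_inf \<Omega>" unfolding rayleigh_inf_def
  proof (rule cInf_greatest)
    show "{dirichlet_energy \<phi> / mass \<phi> |\<phi>. test_function \<Omega> \<phi> \<and> mass \<phi> > 0} \<noteq> {}"
      using ex_test_function[OF assms(4,2)] by blast
  qed (use le in \<open>auto simp: pos_le_divide_eq\<close>)
next
  assume k: "k\<^sup>2 \<le> rayleigh_inf \<Omega>"
  obtain v where v: "\<And>n. Ck_on n \<Omega> v" "\<And>x. x \<in> \<Omega> \<Longrightarrow> laplacian v x = - rayleigh_inf \<Omega> * v x"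
    "\<And>x. x \<in> \<Omega> \<Longrightarrow> v x > 0"
    by (rule ex_positive_eigenfunction[OF assms(4,3,2,5)]) blast
  have "laplacian v x + k\<^sup>2 * v x \<le> 0" if "x \<in> \<Omega>" for x
    using v(2)[OF that] mult_right_mono[OF k less_imp_le[OF v(3)[OF that]]] by simp
  then show "\<exists>v. Ck_on 2 \<Omega> v \<and> (\<forall>x\<in>\<Omega>. laplacian v x + k\<^sup>2 * v x \<le> 0) \<and> (\<forall>x\<in>\<Omega>. v x > 0)"
    using v by blast
qed

end
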